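(* There exists an absolute constant $\sigma>0$ such that the following holds. Let $\chi:\mathbb{R}\to\mathbb{R}$ be a smooth compactly supported function with $0\le\chi\le 1$ and let $K\subset\mathbb{R}$ be a compact interval. Then there exists a constant $C$ depending only on $K$ and $\chi$ such that for all $f_0\in L^\infty(\mathbb{R})$ supported in $K$ and all $f_1,f_2\in L^2(\mathbb{R})$, $$\mathcal{I}(f_0,f_1,f_2)\le C\,\|f_0\|_\infty\,\|f_1\|_2\,\|f_2\|_{H^{-\sigma}}.$$
   Context: Functions are complex-valued. The form is $$\mathcal{I}(f_0,f_1,f_2)=\Big|\int_{\mathbb{R}}\int_{\mathbb{R}} f_0(x)\,f_1(x+t)\,f_2(x+t^2)\,\chi(t)\,dt\,dx\Big|.$$ The Fourier transform is $\widehat f(\xi)=\int_{\mathbb{R}} f(x)e^{-2\pi i x\xi}\,dx$ (extended to $L^2$ as usual), and $\|f\|_{H^{-\sigma}}^2=\int_{\mathbb{R}}|\widehat f(\xi)|^2(1+|\xi|^2)^{-\sigma}\,d\xi$. *)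

theory Defs
  imports "HOL-Analysis.Analysis" "HOL-Probability.Essential_Supremum"
begin

text \<open>Elements of the Lebesgue spaces are represented by Lebesgue measurable functions, not by
  equivalence classes. The norms below are real numbers and are meaningful only for members of the
  corresponding space.\<close>

definition in_L1 :: "(real \<Rightarrow> complex) \<Rightarrow> bool" where
  "in_L1 f \<longleftrightarrow> integrable lebesgue f"

definition in_L2 :: "(real \<Rightarrow> complex) \<Rightarrow> bool" where
  "in_L2 f \<longleftrightarrow> f \<in> borel_measurable lebesgue \<and> integrable lebesgue (\<lambda>x. (cmod (f x))\<^sup>2)"

definition L2_norm :: "(real \<Rightarrow> complex) \<Rightarrow> real" where
  "L2_norm f = sqrt (LINT x|lebesgue. (cmod (f x))\<^sup>2)"

definition in_Linf :: "(real \<Rightarrow> complex) \<Rightarrow> bool" where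
  "in_Linf f \<longleftrightarrow> f \<in> borel_measurable lebesgue \<and> esssup lebesgue (\<lambda>x. ereal (cmod (f x))) < \<infinity>"

definition Linf_norm :: "(real \<Rightarrow> complex) \<Rightarrow> real" where
  "Linf_norm f = real_of_ereal (esssup lebesgue (\<lambda>x. ereal (cmod (f x))))"

text \<open>As usual for classes of functions modulo null sets, support in \<open>K\<close> means vanishing
  almost everywhere outside \<open>K\<close>.\<close>

definition ae_supported_in :: "(real \<Rightarrow> complex) \<Rightarrow> real set \<Rightarrow> bool" where
  "ae_supported_in f K \<longleftrightarrow> (AE x in lebesgue. x \<notin> K \<longrightarrow> f x = 0)"

definition smooth :: "(real \<Rightarrow> real) \<Rightarrow> bool" where
  "smooth chi \<longleftrightarrow> (\<forall>n. (deriv ^^ n) chi differentiable_on UNIV)"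

definition compactly_supported :: "(real \<Rightarrow> real) \<Rightarrow> bool" where
  "compactly_supported chi \<longleftrightarrow> compact (closure {t. chi t \<noteq> 0})"

definition fourier :: "(real \<Rightarrow> complex) \<Rightarrow> real \<Rightarrow> complex" where
  "fourier f \<xi> = (LINT x|lebesgue. f x * exp (- 2 * of_real pi * \<i> * of_real x * of_real \<xi>))"

definition L2_tendsto :: "(nat \<Rightarrow> real \<Rightarrow> complex) \<Rightarrow> (real \<Rightarrow> complex) \<Rightarrow> bool" where
  "L2_tendsto h f \<longleftrightarrow> (\<forall>n. in_L2 (h n)) \<and> in_L2 f \<and> (\<lambda>n. L2_norm (\<lambda>x. h n x - f x)) \<longlonglongrightarrow> 0"

text \<open>Extension of the integral transform by continuity from $L^1 \cap L^2$ to $L^2$. Since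
  $L^1 \cap L^2$ is dense in $L^2$, the transform is determined up to equality almost everywhere;
  \<open>L2_fourier\<close> picks a representative.\<close>

definition is_L2_fourier :: "(real \<Rightarrow> complex) \<Rightarrow> (real \<Rightarrow> complex) \<Rightarrow> bool" where
  "is_L2_fourier f g \<longleftrightarrow> in_L2 g \<and>
     (\<forall>h. (\<forall>n. in_L1 (h n)) \<and> L2_tendsto h f \<longrightarrow> L2_tendsto (\<lambda>n. fourier (h n)) g)"

definition L2_fourier :: "(real \<Rightarrow> complex) \<Rightarrow> real \<Rightarrow> complex" where
  "L2_fourier f = (SOME g. is_L2_fourier f g)"

text \<open>The norm of $H^s$, for \<open>f\<close> in $L^2$ and $s \le 0$ (for $s > 0$ the integral may diverge,
  and the Bochner integral is then 0).\<close>

definition sobolev_norm :: "real \<Rightarrow> (real \<Rightarrow> complex) \<Rightarrow> real" where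
  "sobolev_norm s f =
     sqrt (LINT \<xi>|lebesgue. (cmod (L2_fourier f \<xi>))\<^sup>2 * (1 + \<bar>\<xi>\<bar>\<^sup>2) powr s)"

definition trilinear_form ::
  "(real \<Rightarrow> real) \<Rightarrow> (real \<Rightarrow> complex) \<Rightarrow> (real \<Rightarrow> complex) \<Rightarrow> (real \<Rightarrow> complex) \<Rightarrow> real" where
  "trilinear_form chi f\<^sub>0 f\<^sub>1 f\<^sub>2 =
     cmod (LINT x|lebesgue. LINT t|lebesgue. f\<^sub>0 x * f\<^sub>1 (x + t) * f\<^sub>2 (x + t\<^sup>2) * of_real (chi t))"

end

theory Submission
  imports Defs "HOL-Probability.Probability"
begin

text \<open>Let \<open>e(x) = exp(2\<pi>ix)\<close>. Since \<open>\<chi>(t) exp(\<pi>t\<^sup>2)\<close> is smooth with compact support, it is an absolutely convergent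
  superposition of characters \<open>e(\<theta>t)\<close>; modulating \<open>f\<^sub>0\<close> and \<open>f\<^sub>1\<close> absorbs \<open>e(\<theta>t) = e(\<theta>(x + t)) e(-\<theta>x)\<close>, so
  \<open>\<chi>\<close> may be replaced by the Gaussian \<open>exp(-\<pi>t\<^sup>2)\<close>. On the Fourier side the form becomes
  \<open>\<integral>\<integral> g(a) g\<^sub>1(\<xi>) \<phi>(a + \<xi>) m(a, \<xi>) da d\<xi>\<close>, where \<open>g\<close>, \<open>g\<^sub>1\<close>, \<open>\<phi>\<close> are the transforms of \<open>f\<^sub>2\<close>, \<open>f\<^sub>1\<close>, \<open>f\<^sub>0\<close> and
  \<open>m(a, \<xi>) = \<integral> exp(-\<pi>t\<^sup>2) e(at\<^sup>2 + \<xi>t) dt\<close> is an explicit complex Gaussian.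

  Let \<open>g\<close> live on \<open>N \<le> \<bar>a\<bar> \<le> 2N\<close> with constant sign. Eliminating \<open>g\<^sub>1\<close> by Cauchy-Schwarz doubles \<open>a\<close> to
  \<open>a, a - \<zeta>\<close>. For \<open>\<bar>\<zeta>\<bar> \<le> \<surd>N\<close> the bound \<open>\<bar>m\<bar>\<^sup>2 \<le> 1/(2N)\<close> suffices. For larger \<open>\<zeta>\<close> the bilinear form in \<open>a\<close> and
  \<open>u = a + \<xi>\<close> has a Gaussian kernel \<open>k\<close>, and a determinant computation gives
  \<open>\<bar>\<integral> k(a, u) k(a', u)\<^sup>* du\<bar> \<le> (16 N \<bar>\<zeta>\<bar> \<bar>a - a'\<bar>)\<^sup>-\<^sup>1\<^sup>/\<^sup>2\<close>, which is integrable in \<open>a'\<close> and gains a factor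
  \<open>\<bar>\<zeta>\<bar>\<^sup>-\<^sup>1\<^sup>/\<^sup>4\<close>. Altogether a power of \<open>N\<close> is gained, and dyadic pieces can be summed against a weight
  \<open>(1 + a\<^sup>2)\<^sup>-\<^sup>\<sigma>\<close>. General \<open>f\<^sub>1\<close>, \<open>f\<^sub>2\<close> are limits in \<open>L\<^sup>2\<close> of continuous functions with compact support, for which
  Fourier inversion holds after mollification.\<close>

section \<open>Gaussian integrals\<close>

text \<open>With a Gaussian cutoff every oscillatory integral, including the one over
  \<open>u\<close>, is evaluated exactly by completing the square, so no stationary phase with error
  terms arises. Only the moduli of the resulting constants matter, so no branch of a complex root
  has to be followed.

  The restriction to one sign comes from \<open>a b - a' b' = (a - a') (a + a' - \<zeta>)\<close>
  with \<open>b = a - \<zeta>\<close>, \<open>b' = a' - \<zeta>\<close>: on frequencies of one sign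
  the second factor is at least \<open>2 N\<close> in modulus, otherwise it may vanish.

  The exponents: differences up to \<open>\<surd>N\<close> contribute \<open>N^(-1) N^(1/2)\<close>,
  larger ones \<open>(\<surd>N)^(-1/4) = N^(-1/8)\<close>. For the form itself the root is taken,
  which gives \<open>N^(-1/16)\<close>. The weight with \<sigma> = 1/32 costs
  \<open>N^(1/32)\<close> in the norm, so a geometric series remains.

  Sup bounds on transforms and Gaussian factors in frequency secure absolute convergence and do not
  enter the final constant, which is why all limits can be taken. The function
  \<open>f\<^sub>0\<close> enters through its \<open>L\<^sup>2\<close> norm, at most the root of the
  length of \<open>K\<close> times its sup norm.\<close>

lemma (in pair_sigma_finite) integrable_pair_bound:
  fixes F :: "'a \<times> 'b \<Rightarrow> 'c::{banach, second_countable_topology}" and f g :: "_ \<Rightarrow> real"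
  assumes F: "F \<in> borel_measurable (M1 \<Otimes>\<^sub>M M2)"
    and f: "integrable M1 f" and g: "integrable M2 g"
    and le: "\<And>x y. norm (F (x, y)) \<le> f x * g y"
  shows "integrable (M1 \<Otimes>\<^sub>M M2) F"
proof (rule Bochner_Integration.integrable_bound)
  show "integrable (M1 \<Otimes>\<^sub>M M2) (\<lambda>(x, y). f x * g y)"
  proof (rule Fubini_integrable)
    have [measurable]: "f \<in> borel_measurable M1" "g \<in> borel_measurable M2" using f g by auto
    show "(\<lambda>(x, y). f x * g y) \<in> borel_measurable (M1 \<Otimes>\<^sub>M M2)" by measurable
    show "integrable M1 (\<lambda>x. LINT y|M2. norm (case (x, y) of (x, y) \<Rightarrow> f x * g y))"
      using f g by (simp add: abs_mult)
    show "AE x in M1. integrable M2 (\<lambda>y. case (x, y) of (x, y) \<Rightarrow> f x * g y)"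
      using g by simp
  qed
  show "AE x in M1 \<Otimes>\<^sub>M M2. norm (F x) \<le> norm (case x of (x, y) \<Rightarrow> f x * g y)"
    using le by (auto intro!: AE_I2 intro: order_trans[OF _ abs_ge_self])
qed (fact F)

lemma gaussian_integrable_real:
  fixes c :: real assumes "c > 0"
  shows "integrable lborel (\<lambda>t::real. exp (- (c * t\<^sup>2)))"
    and "(LINT t|lborel. exp (- (c * t\<^sup>2))) = sqrt (pi / c)"
proof -
  define s where "s = 1 / sqrt (2 * c)"
  have s: "s > 0" "s\<^sup>2 = 1 / (2 * c)" using assms by (auto simp: s_def power_divide)
  have eq: "exp (- (c * t\<^sup>2)) = sqrt (pi / c) * normal_density 0 s t" for t :: real
    using assms s(1) by (simp add: normal_density_def s(2) real_sqrt_divide field_simps)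
  have "integrable lborel (normal_density 0 s)" "(LINT t|lborel. normal_density 0 s t) = 1"
    using s by auto
  then show "integrable lborel (\<lambda>t::real. exp (- (c * t\<^sup>2)))"
    and "(LINT t|lborel. exp (- (c * t\<^sup>2))) = sqrt (pi / c)"
    unfolding eq by auto
qed

text \<open>For \<open>Re z > 0\<close> the value is \<open>z\<close> to the power -1/2, principal
  branch. It is left as an integral: later estimates use only its value at positive reals and its
  modulus, so no complex root has to be chosen.\<close>

definition gauss_const :: "complex \<Rightarrow> complex" where
  "gauss_const z = (LINT t|lborel. exp (- (of_real pi * z * of_real t ^ 2)))"

text \<open>The cross term \<open>2 * Im z * t * y\<close> is absorbed by a completed square into
  half of \<open>Re z * t\<^sup>2\<close>. The loss depends on \<open>Y\<close> only, so one real
  Gaussian dominates the integrand on the whole strip \<open>\<bar>y\<bar> \<le> Y\<close>.\<close>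

lemma Re_gauss_shift_bound:
  fixes z :: complex and t y Y :: real
  assumes "Re z > 0" "\<bar>y\<bar> \<le> Y"
  shows "Re (z * (of_real t + \<i> * of_real y)\<^sup>2) \<ge> Re z / 2 * t\<^sup>2 - (Re z + 2 * (Im z)\<^sup>2 / Re z) * Y\<^sup>2"
proof -
  have yY: "y\<^sup>2 \<le> Y\<^sup>2" using assms(2) by (metis abs_ge_zero power2_abs power_mono)
  have "Re (z * (of_real t + \<i> * of_real y)\<^sup>2) = Re z * (t\<^sup>2 - y\<^sup>2) - 2 * Im z * t * y"
    by (simp add: power2_eq_square algebra_simps)
  moreover have "2 * Im z * t * y \<le> Re z / 2 * t\<^sup>2 + 2 * (Im z)\<^sup>2 / Re z * y\<^sup>2"
  proof -
    have "0 \<le> (Re z * t - 2 * Im z * y)\<^sup>2 / (2 * Re z)" using assms by simp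
    also have "\<dots> = Re z / 2 * t\<^sup>2 + 2 * (Im z)\<^sup>2 / Re z * y\<^sup>2 - 2 * Im z * t * y"
      using assms by (simp add: power2_eq_square field_simps)
    finally show ?thesis by simp
  qed
  moreover have "(Re z + 2 * (Im z)\<^sup>2 / Re z) * y\<^sup>2 \<le> (Re z + 2 * (Im z)\<^sup>2 / Re z) * Y\<^sup>2"
    using assms yY by (intro mult_left_mono) auto
  ultimately show ?thesis by (simp add: algebra_simps)
qed

lemma gauss_shift_integrable:
  fixes z :: complex
  assumes "Re z > 0"
  shows "integrable lborel (\<lambda>t. exp (- (of_real pi * z * (of_real t + \<i> * of_real y)\<^sup>2)))"
proof (rule Bochner_Integration.integrable_bound)
  let ?K = "exp (pi * ((Re z + 2 * (Im z)\<^sup>2 / Re z) * \<bar>y\<bar>\<^sup>2))"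
  show "integrable lborel (\<lambda>t::real. ?K * exp (- ((pi * (Re z / 2)) * t\<^sup>2)))"
    using assms by (intro integrable_mult_right gaussian_integrable_real) auto
  have "norm (exp (- (of_real pi * z * (of_real t + \<i> * of_real y)\<^sup>2))) \<le>
     norm (?K * exp (- ((pi * (Re z / 2)) * t\<^sup>2)))" for t
  proof -
    have "norm (exp (- (of_real pi * z * (of_real t + \<i> * of_real y)\<^sup>2)))
      = exp (- (pi * Re (z * (of_real t + \<i> * of_real y)\<^sup>2)))"
      by (simp add: mult.assoc)
    also have "\<dots> \<le> exp (- (pi * (Re z / 2 * t\<^sup>2 - (Re z + 2 * (Im z)\<^sup>2 / Re z) * \<bar>y\<bar>\<^sup>2)))"
      using Re_gauss_shift_bound[OF assms order_refl, where y=y and t=t] by (simp add: mult_left_mono)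
    also have "\<dots> = ?K * exp (- ((pi * (Re z / 2)) * t\<^sup>2))"
      by (simp add: mult_exp_exp algebra_simps)
    finally show ?thesis by simp
  qed
  then show "AE t in lborel. norm (exp (- (of_real pi * z * (of_real t + \<i> * of_real y)\<^sup>2))) \<le>
     norm (?K * exp (- ((pi * (Re z / 2)) * t\<^sup>2)))" by simp
qed measurable

text \<open>A contour shift without contour integration: the \<open>y\<close>-derivative of the
  integrand is \<i> times its \<open>t\<close>-derivative \<open>D\<close>, and \<open>D\<close> has
  integral 0 over each horizontal line. Integrating over the strip between the heights 0 and
  \<open>Y\<close> in both orders shows that the two line integrals agree.\<close>

lemma gauss_shift_imaginary:
  fixes z :: complex and Y :: real
  assumes z: "Re z > 0" and Y: "Y \<ge> 0"
  shows "(LINT t|lborel. exp (- (of_real pi * z * (of_real t + \<i> * of_real Y)\<^sup>2))) = gauss_const z"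
proof -
  define F where "F t y = exp (- (of_real pi * z * (of_real t + \<i> * of_real y)\<^sup>2))" for t y :: real
  define D where "D t y = - (2 * of_real pi * z * (of_real t + \<i> * of_real y)) * F t y" for t y :: real
  \<comment> \<open>Half of the decay rate available for \<open>F\<close>, see \<open>Fb\<close>;
    the other half pays for the linear factor of \<open>D\<close> in \<open>Db\<close>.\<close>
  define c where "c = pi * (Re z / 4)"
  have c: "c > 0" using z by (simp add: c_def)
  define K where "K = exp (pi * ((Re z + 2 * (Im z)\<^sup>2 / Re z) * Y\<^sup>2))"
  have Fb: "norm (F t y) \<le> K * exp (- (2 * c * t\<^sup>2))" if "\<bar>y\<bar> \<le> Y" for t y
  proof -
    have "norm (F t y) = exp (- (pi * Re (z * (of_real t + \<i> * of_real y)\<^sup>2)))"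
      by (simp add: mult.assoc F_def)
    also have "\<dots> \<le> exp (- (pi * (Re z / 2 * t\<^sup>2 - (Re z + 2 * (Im z)\<^sup>2 / Re z) * Y\<^sup>2)))"
      using Re_gauss_shift_bound[OF z that, where t=t] by (simp add: mult_left_mono)
    also have "\<dots> = K * exp (- (2 * c * t\<^sup>2))"
      by (simp add: mult_exp_exp algebra_simps K_def c_def)
    finally show ?thesis .
  qed
  define L where "L = 2 * pi * norm z * (1 + 1/c + Y) * K"
  have Db: "norm (D t y) \<le> L * exp (- (c * t\<^sup>2))" if "\<bar>y\<bar> \<le> Y" for t y
  proof -
    have "norm (of_real t + \<i> * of_real y) \<le> \<bar>t\<bar> + \<bar>y\<bar>"
      by (metis norm_triangle_ineq norm_mult norm_ii norm_of_real mult_1)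
    also have "\<dots> \<le> 1 + t\<^sup>2 + Y" 
    proof -
      have "0 \<le> (\<bar>t\<bar> - 1)\<^sup>2" by simp
      then have "2 * \<bar>t\<bar> \<le> t\<^sup>2 + 1" by (simp add: power2_diff)
      then show ?thesis using that by linarith
    qed
    also have "\<dots> \<le> (1 + 1/c + Y) * exp (c * t\<^sup>2)"
    proof -
      have e1: "1 \<le> exp (c * t\<^sup>2)" using c by simp
      have "c * t\<^sup>2 \<le> exp (c * t\<^sup>2)" using exp_ge_add_one_self[of "c * t\<^sup>2"] by linarith
      then have "t\<^sup>2 \<le> 1/c * exp (c * t\<^sup>2)" using c by (simp add: field_simps)
      moreover have "Y \<le> Y * exp (c * t\<^sup>2)" using mult_left_mono[OF e1 Y] by simp
      ultimately have "1 + t\<^sup>2 + Y \<le> exp (c * t\<^sup>2) + 1/c * exp (c * t\<^sup>2) + Y * exp (c * t\<^sup>2)"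
        using e1 by linarith
      then show ?thesis by (simp add: algebra_simps)
    qed
    finally have *: "norm (of_real t + \<i> * of_real y) \<le> (1 + 1/c + Y) * exp (c * t\<^sup>2)" .
    have "norm (D t y) = 2 * pi * norm z * (norm (of_real t + \<i> * of_real y) * norm (F t y))"
      by (simp add: D_def norm_mult)
    also have "\<dots> \<le> 2 * pi * norm z * (((1 + 1/c + Y) * exp (c * t\<^sup>2)) * (K * exp (- (2 * c * t\<^sup>2))))"
      using * Fb[OF that, of t] c Y by (intro mult_left_mono mult_mono) auto
    also have "\<dots> = L * exp (- (c * t\<^sup>2))"
      by (simp add: L_def mult_exp_exp algebra_simps)
    finally show ?thesis .
  qed
  have [measurable]: "(\<lambda>(t,y). F t y) \<in> borel_measurable borel" "(\<lambda>(t,y). D t y) \<in> borel_measurable borel"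
    unfolding F_def D_def by (intro borel_measurable_continuous_onI continuous_intros; simp add: split_beta; intro continuous_intros)+
  have intD: "integrable lborel (\<lambda>t. D t y)" if "\<bar>y\<bar> \<le> Y" for y
  proof (rule Bochner_Integration.integrable_bound)
    show "integrable lborel (\<lambda>t::real. L * exp (- (c * t\<^sup>2)))"
      using c by (intro integrable_mult_right gaussian_integrable_real) auto
    show "AE t in lborel. norm (D t y) \<le> norm (L * exp (- (c * t\<^sup>2)))"
      using Db[OF that] by (smt (verit) AE_I2 real_norm_def)
  qed (simp add: D_def F_def)
  have derF: "((\<lambda>t. F t y) has_vector_derivative D t y) (at t)" for t y
    unfolding F_def D_def
    by (rule has_vector_derivative_real_field) (auto intro!: derivative_eq_intros simp: power2_eq_square algebra_simps)
  have derY: "((\<lambda>y. F t y) has_vector_derivative \<i> * D t y) (at y within S)" for t y S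
    unfolding F_def D_def
    by (rule has_vector_derivative_real_field) (auto intro!: derivative_eq_intros simp: power2_eq_square algebra_simps)
  have zeroD: "(LINT t|lborel. D t y) = 0" if y: "\<bar>y\<bar> \<le> Y" for y
  proof -
    have lim: "((\<lambda>t. F t y) \<longlongrightarrow> 0) at_top" "((\<lambda>t. F t y) \<longlongrightarrow> 0) at_bot"
    proof -
      have 1: "((\<lambda>t. K * exp (- (2 * c * t\<^sup>2))) \<longlongrightarrow> 0) at_top" using c by real_asymp
      have 2: "((\<lambda>t. K * exp (- (2 * c * t\<^sup>2))) \<longlongrightarrow> 0) at_bot" using c by real_asymp
      show "((\<lambda>t. F t y) \<longlongrightarrow> 0) at_top" "((\<lambda>t. F t y) \<longlongrightarrow> 0) at_bot"
        by (rule Lim_null_comparison[OF _ 1] Lim_null_comparison[OF _ 2], use Fb[OF y] in simp)+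
    qed
    have "(LBINT t=-\<infinity>..\<infinity>. D t y) = 0 - 0"
    proof (rule interval_integral_FTC_integrable[where F="\<lambda>t. F t y"])
      show "set_integrable lborel (einterval (-\<infinity>) \<infinity>) (\<lambda>t. D t y)"
        using intD[OF y] by (simp add: set_integrable_def einterval_def)
      show "isCont (\<lambda>t. D t y) t" for t
        unfolding D_def F_def by (intro continuous_intros)
    qed (use derF lim in \<open>auto simp: ereal_tendsto_simps\<close>)
    then show ?thesis by (simp add: interval_lebesgue_integral_def set_lebesgue_integral_def einterval_def)
  qed
  \<comment> \<open>The indicator turns the integral over heights into one over the line, so that
    Fubini on the product of two Lebesgue measures applies.\<close>
  define G where "G = (\<lambda>(t, y). indicator {0..Y} y *\<^sub>R (\<i> * D t y))"
  have intG: "integrable (lborel \<Otimes>\<^sub>M lborel) G"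
  proof (rule lborel_pair.integrable_pair_bound)
    show "integrable lborel (\<lambda>t. L * exp (- (c * t\<^sup>2)))"
      using c by (intro integrable_mult_right gaussian_integrable_real)
    show "integrable lborel (\<lambda>y. indicator {0..Y} y :: real)" using Y by (intro integrable_real_indicator) (auto simp: emeasure_lborel_Icc)
    show "G \<in> borel_measurable (lborel \<Otimes>\<^sub>M lborel)"
      unfolding G_def D_def F_def by measurable
    show "norm (G (t, y)) \<le> L * exp (- (c * t\<^sup>2)) * indicat_real {0..Y} y" for t y
      using Db[of y t] by (auto simp: G_def indicator_def norm_mult)
  qed
  have "(LINT t|lborel. LINT y|lborel. G (t, y)) = (LINT y|lborel. LINT t|lborel. G (t, y))"
    using lborel_pair.Fubini_integral[of "curry G"] intG by simp
  also have "\<dots> = 0"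
  proof -
    have "(LINT t|lborel. G (t, y)) = 0" for y
      unfolding G_def using zeroD[of y] by (cases "y \<in> {0..Y}") auto
    then show ?thesis by simp
  qed
  also have "(LINT t|lborel. LINT y|lborel. G (t, y)) = (LINT t|lborel. F t Y - F t 0)"
  proof (intro Bochner_Integration.integral_cong refl)
    fix t :: real
    show "(LINT y|lborel. G (t, y)) = F t Y - F t 0"
      unfolding G_def prod.case
    proof (rule integral_FTC_Icc[OF Y])
      show "continuous_on {0..Y} (\<lambda>y. \<i> * D t y)" unfolding D_def F_def by (intro continuous_intros)
    qed (rule derY)
  qed
  also have "\<dots> = (LINT t|lborel. F t Y) - (LINT t|lborel. F t 0)"
    unfolding F_def by (intro Bochner_Integration.integral_diff gauss_shift_integrable z)
  finally show ?thesis by (simp add: F_def gauss_const_def)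
qed

text \<open>Reflection in \<open>t\<close> reverses the sign of the height.\<close>

lemma gauss_shift_imaginary':
  fixes z :: complex and Y :: real
  assumes z: "Re z > 0"
  shows "(LINT t|lborel. exp (- (of_real pi * z * (of_real t + \<i> * of_real Y)\<^sup>2))) = gauss_const z"
proof (cases "Y \<ge> 0")
  case False
  have "(LINT t|lborel. exp (- (of_real pi * z * (of_real t + \<i> * of_real Y)\<^sup>2)))
      = (LINT t|lborel. exp (- (of_real pi * z * (of_real t + \<i> * of_real (-Y))\<^sup>2)))"
    by (subst lborel_integral_real_affine[where c="-1" and t=0]) (simp_all add: power2_eq_square algebra_simps)
  with gauss_shift_imaginary[OF z, of "-Y"] False show ?thesis by simp
qed (use gauss_shift_imaginary[OF z] in auto)

text \<open>Completing the square moves the line of integration by \<open>b / z\<close>. The real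
  part of this is a translation along the line, the imaginary part a contour shift.\<close>

lemma gauss_integral:
  fixes z b :: complex
  assumes z: "Re z > 0"
  shows "integrable lborel (\<lambda>t. exp (- (of_real pi * z * of_real t ^ 2) + 2 * of_real pi * b * of_real t))"
    and "(LINT t|lborel. exp (- (of_real pi * z * of_real t ^ 2) + 2 * of_real pi * b * of_real t))
      = exp (of_real pi * b\<^sup>2 / z) * gauss_const z"
proof -
  have z0: "z \<noteq> 0" using z by auto
  define c d where "c = Re (b / z)" and "d = Im (b / z)"
  have b: "b = z * (of_real c + \<i> * of_real d)"
    using z0 by (simp add: c_def d_def complex_eq[symmetric])
  let ?f = "\<lambda>t. exp (- (of_real pi * z * of_real t ^ 2) + 2 * of_real pi * b * of_real t)"
  have eq: "?f (c + 1 * t) = exp (of_real pi * b\<^sup>2 / z) * exp (- (of_real pi * z * (of_real t + \<i> * of_real (-d))\<^sup>2))" for t :: real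
  proof -
    have "of_real pi * b\<^sup>2 / z = of_real pi * z * (of_real c + \<i> * of_real d)\<^sup>2"
      using z0 unfolding b by (simp add: power2_eq_square)
    then show ?thesis unfolding mult_exp_exp
      by (intro arg_cong[where f=exp], unfold b) (simp add: power2_eq_square algebra_simps)
  qed
  have "integrable lborel (\<lambda>t. ?f (c + 1 * t))"
    unfolding eq by (intro integrable_mult_right gauss_shift_integrable z)
  then show "integrable lborel ?f"
    by (subst (asm) lborel_integrable_real_affine_iff) auto
  have "integral\<^sup>L lborel ?f = (LINT t|lborel. ?f (c + 1 * t))"
    by (subst lborel_integral_real_affine[where c=1 and t=c]) simp_all
  also have "\<dots> = exp (of_real pi * b\<^sup>2 / z) * gauss_const z"
    unfolding eq by (simp only: integral_mult_right_zero gauss_shift_imaginary'[OF z])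
  finally show "integral\<^sup>L lborel ?f = exp (of_real pi * b\<^sup>2 / z) * gauss_const z" .
qed

lemma gauss_const_of_real:
  assumes "r > 0"
  shows "gauss_const (of_real r) = of_real (1 / sqrt r)"
proof -
  have "gauss_const (of_real r) = (LINT t|lborel. of_real (exp (- ((pi * r) * t\<^sup>2))))"
    unfolding gauss_const_def by (intro Bochner_Integration.integral_cong) (auto simp: exp_of_real[symmetric])
  also have "\<dots> = of_real (sqrt (pi / (pi * r)))"
    using gaussian_integrable_real(2)[of "pi * r"] assms by (subst integral_complex_of_real) simp
  finally show ?thesis using assms by (simp add: real_sqrt_divide)
qed

text \<open>In the double integral for \<open>gauss_const z * cnj (gauss_const z)\<close> the first
  variable is replaced by \<open>s + w\<close>. The coefficient of \<open>s\<^sup>2\<close> becomes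
  \<open>z + cnj z\<close>, which is real; after the integration in \<open>s\<close> the coefficient
  of \<open>w\<^sup>2\<close> is \<open>(norm z)\<^sup>2 / (2 * Re z)\<close>, again real, and the
  factors \<open>Re z\<close> cancel.\<close>

lemma norm_gauss_const:
  assumes z: "Re z > 0"
  shows "(norm (gauss_const z))\<^sup>2 = 1 / norm z"
proof -
  define r where "r = Re z"
  have r: "r > 0" "z \<noteq> 0" using z by (auto simp: r_def)
  define F :: "real \<Rightarrow> real \<Rightarrow> complex" where
    "F s w = exp (- (of_real pi * z * of_real (s + w) ^ 2)) * exp (- (of_real pi * cnj z * of_real s ^ 2))" for s w
  have F: "F s w = exp (- (of_real pi * z * of_real w ^ 2)) *
     exp (- (of_real pi * of_real (2 * r) * of_real s ^ 2) + 2 * of_real pi * (- z * of_real w) * of_real s)" for s w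
  proof -
    have "z + cnj z = 2 * of_real r" by (simp add: r_def complex_add_cnj)
    then have cz: "cnj z = 2 * of_real r - z" by (simp add: algebra_simps)
    show ?thesis unfolding F_def mult_exp_exp cz
      by (rule arg_cong[where f=exp]) (simp add: power2_eq_square algebra_simps)
  qed
  have int: "integrable (lborel \<Otimes>\<^sub>M lborel) (case_prod F)"
  proof (rule lborel_pair.integrable_pair_bound)
    show "case_prod F \<in> borel_measurable (lborel \<Otimes>\<^sub>M lborel)" unfolding F_def by measurable
    show "integrable lborel (\<lambda>s. exp (- ((pi * r / 4) * s\<^sup>2)))" "integrable lborel (\<lambda>s. exp (- ((pi * r / 4) * s\<^sup>2)))"
      using r by (intro gaussian_integrable_real; simp)+
    show "norm (case (s, w) of (s, w) \<Rightarrow> F s w) \<le> exp (- ((pi * r / 4) * s\<^sup>2)) * exp (- ((pi * r / 4) * w\<^sup>2))" for s w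
    proof -
      \<comment> \<open>The right side is four times \<open>(s + w)\<^sup>2 + s\<^sup>2\<close>,
        minus \<open>s\<^sup>2 + w\<^sup>2\<close>, with the square completed in
        \<open>s\<close>.\<close>
      have "0 \<le> 7 * (s + 4/7 * w)\<^sup>2 + 5/7 * w\<^sup>2" by simp
      then have "(s\<^sup>2 + w\<^sup>2) / 4 \<le> (s + w)\<^sup>2 + s\<^sup>2" by (simp add: power2_eq_square algebra_simps)
      then have "pi * r * ((s\<^sup>2 + w\<^sup>2) / 4) \<le> pi * r * ((s + w)\<^sup>2 + s\<^sup>2)"
        using r by (intro mult_left_mono) auto
      moreover have "norm (F s w) = exp (- (pi * r * ((s + w)\<^sup>2 + s\<^sup>2)))"
        by (simp add: F_def norm_mult mult_exp_exp r_def algebra_simps flip: of_real_power of_real_add)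
      ultimately show ?thesis by (simp add: mult_exp_exp algebra_simps)
    qed
  qed
  have "of_real ((norm (gauss_const z))\<^sup>2) = gauss_const z * cnj (gauss_const z)"
    by (simp only: complex_norm_square)
  also have "cnj (gauss_const z) = (LINT s|lborel. exp (- (of_real pi * cnj z * of_real s ^ 2)))"
    using Bochner_Integration.integral_cnj[of lborel "\<lambda>t. exp (- (of_real pi * z * of_real t ^ 2))"]
    by (simp add: gauss_const_def exp_cnj del: Bochner_Integration.integral_cnj)
  also have "gauss_const z * \<dots> = (LINT s|lborel. gauss_const z * exp (- (of_real pi * cnj z * of_real s ^ 2)))"
    by simp
  also have "\<dots> = (LINT s|lborel. LINT w|lborel. F s w)"
  proof (intro Bochner_Integration.integral_cong refl)
    fix s :: real
    have "gauss_const z = (LINT w|lborel. exp (- (of_real pi * z * of_real (s + w) ^ 2)))"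
      unfolding gauss_const_def by (subst lborel_integral_real_affine[where c=1 and t=s]) simp_all
    then show "gauss_const z * exp (- (of_real pi * cnj z * of_real s ^ 2)) = (LINT w|lborel. F s w)"
      by (simp add: F_def)
  qed
  also have "\<dots> = (LINT w|lborel. LINT s|lborel. F s w)"
    using lborel_pair.Fubini_integral[OF int] by simp
  also have "\<dots> = (LINT w|lborel. of_real (1 / sqrt (2 * r)) * exp (- (of_real pi * of_real ((norm z)\<^sup>2 / (2 * r)) * of_real w ^ 2)))"
  proof (intro Bochner_Integration.integral_cong refl)
    fix w :: real
    have "(LINT s|lborel. F s w) = exp (- (of_real pi * z * of_real w ^ 2)) *
      (exp (of_real pi * (- z * of_real w)\<^sup>2 / of_real (2 * r)) * gauss_const (of_real (2 * r)))"
      unfolding F integral_mult_right_zero using r by (subst gauss_integral) auto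
    also have "\<dots> = of_real (1 / sqrt (2 * r)) * exp (- (of_real pi * z * of_real w ^ 2) + of_real pi * (- z * of_real w)\<^sup>2 / of_real (2 * r))"
      using r by (subst gauss_const_of_real) (simp_all add: mult_exp_exp)
    also have "- (of_real pi * z * of_real w ^ 2) + of_real pi * (- z * of_real w)\<^sup>2 / of_real (2 * r)
      = - (of_real pi * of_real ((norm z)\<^sup>2 / (2 * r)) * of_real w ^ 2)"
    proof -
      have "z + cnj z = 2 * of_real r" by (simp add: r_def complex_add_cnj)
      then have "cnj z = 2 * of_real r - z" by (simp add: algebra_simps)
      then have cz: "of_real ((norm z)\<^sup>2) = z * (2 * of_real r - z)"
        by (simp only: complex_norm_square)
      show ?thesis using r unfolding of_real_divide cz by (simp add: field_simps power2_eq_square)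
    qed
    finally show "(LINT s|lborel. F s w) = of_real (1 / sqrt (2 * r)) * exp (- (of_real pi * of_real ((norm z)\<^sup>2 / (2 * r)) * of_real w ^ 2))" .
  qed
  also have "\<dots> = of_real (1 / sqrt (2 * r)) * gauss_const (of_real ((norm z)\<^sup>2 / (2 * r)))"
    by (simp add: gauss_const_def)
  also have "\<dots> = of_real (1 / norm z)"
    using r by (subst gauss_const_of_real) (simp_all add: real_sqrt_divide flip: of_real_mult)
  finally show ?thesis using of_real_eq_iff by blast
qed

section \<open>The Gaussian multiplier\<close>

lemma L2_Cauchy_Schwarz:
  fixes f :: "'a \<Rightarrow> 'b::{banach, second_countable_topology}" and g :: "'a \<Rightarrow> 'c::{banach, second_countable_topology}"
  assumes [measurable]: "f \<in> borel_measurable M" "g \<in> borel_measurable M"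
    and f: "integrable M (\<lambda>x. (norm (f x))\<^sup>2)" and g: "integrable M (\<lambda>x. (norm (g x))\<^sup>2)"
  shows "integrable M (\<lambda>x. norm (f x) * norm (g x))"
    and "(LINT x|M. norm (f x) * norm (g x)) \<le> sqrt (LINT x|M. (norm (f x))\<^sup>2) * sqrt (LINT x|M. (norm (g x))\<^sup>2)"
proof -
  show fg: "integrable M (\<lambda>x. norm (f x) * norm (g x))"
  proof (rule Bochner_Integration.integrable_bound)
    show "integrable M (\<lambda>x. (norm (f x))\<^sup>2 + (norm (g x))\<^sup>2)" using f g by simp
    have "norm (f x) * norm (g x) \<le> (norm (f x))\<^sup>2 + (norm (g x))\<^sup>2" for x
    proof -
      have "0 \<le> norm (f x) * norm (g x)" by simp
      moreover have "2 * (norm (f x) * norm (g x)) \<le> (norm (f x))\<^sup>2 + (norm (g x))\<^sup>2"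
        using sum_squares_bound[of "norm (f x)" "norm (g x)"] by (simp only: mult.assoc)
      ultimately show ?thesis by linarith
    qed
    then show "AE x in M. norm (norm (f x) * norm (g x)) \<le> norm ((norm (f x))\<^sup>2 + (norm (g x))\<^sup>2)"
      by simp
  qed measurable
  define A B C where "A = (LINT x|M. (norm (f x))\<^sup>2)" and "B = (LINT x|M. (norm (g x))\<^sup>2)"
    and "C = (LINT x|M. norm (f x) * norm (g x))"
  have nn: "A \<ge> 0" "B \<ge> 0" "C \<ge> 0" by (auto simp: A_def B_def C_def)
  have q: "0 \<le> A - 2 * t * C + t\<^sup>2 * B" for t
  proof -
    have "0 \<le> (LINT x|M. (norm (f x) - t * norm (g x))\<^sup>2)" by simp
    also have "\<dots> = (LINT x|M. (norm (f x))\<^sup>2 - 2 * t * (norm (f x) * norm (g x)) + t\<^sup>2 * (norm (g x))\<^sup>2)"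
      by (intro Bochner_Integration.integral_cong) (auto simp: power2_eq_square algebra_simps)
    also have "\<dots> = A - 2 * t * C + t\<^sup>2 * B"
      using f g fg by (simp add: A_def B_def C_def)
    finally show ?thesis .
  qed
  have "C\<^sup>2 \<le> A * B"
  proof (cases "B = 0")
    case True
    \<comment> \<open>With \<open>B = 0\<close> the expression in \<open>q\<close> is affine in
      \<open>t\<close> and stays nonnegative only if \<open>C\<close> vanishes.\<close>
    have "C = 0"
    proof (rule ccontr)
      assume "C \<noteq> 0" with nn have "C > 0" by simp
      then have "2 * ((A + 1) / C) * C = 2 * (A + 1)" by simp
      with q[of "(A + 1) / C"] True nn show False by simp
    qed
    then show ?thesis using nn by simp
  next
    case False
    with nn have "B > 0" by simp
    have "0 \<le> B * (A - 2 * (C / B) * C + (C / B)\<^sup>2 * B)" using q[of "C / B"] nn by (intro mult_nonneg_nonneg) auto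
    also have "\<dots> = A * B - C\<^sup>2" using \<open>B > 0\<close> by (simp add: field_simps power2_eq_square)
    finally show ?thesis by simp
  qed
  then have "C \<le> sqrt (A * B)" by (rule real_le_rsqrt)
  then show "C \<le> sqrt A * sqrt B" by (simp add: real_sqrt_mult)
qed

lemma lborel_integral_shift:
  fixes f :: "real \<Rightarrow> 'a::{banach, second_countable_topology}"
  shows "(LINT x|lborel. f (x + c)) = (LINT x|lborel. f x)"
    and "(LINT x|lborel. f (c + x)) = (LINT x|lborel. f x)"
    and "(LINT x|lborel. f (x - c)) = (LINT x|lborel. f x)"
    and "(LINT x|lborel. f (c - x)) = (LINT x|lborel. f x)"
  using lborel_integral_real_affine[of 1 f c] lborel_integral_real_affine[of 1 f "-c"]
    lborel_integral_real_affine[of "-1" f c]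
  by (simp_all add: add.commute)

lemma lborel_integrable_shift:
  fixes f :: "real \<Rightarrow> 'a::{banach, second_countable_topology}"
  shows "integrable lborel (\<lambda>x. f (x + c)) \<longleftrightarrow> integrable lborel f"
    and "integrable lborel (\<lambda>x. f (c + x)) \<longleftrightarrow> integrable lborel f"
    and "integrable lborel (\<lambda>x. f (x - c)) \<longleftrightarrow> integrable lborel f"
    and "integrable lborel (\<lambda>x. f (c - x)) \<longleftrightarrow> integrable lborel f"
  using lborel_integrable_real_affine_iff[of 1 f c] lborel_integrable_real_affine_iff[of 1 f "-c"]
    lborel_integrable_real_affine_iff[of "-1" f c]
  by (simp_all add: add.commute)

text \<open>The map from \<open>(a, c)\<close> to \<open>(a, a - c)\<close> preserves the measure.
  It reorganises a double integral over \<open>a\<close> and \<open>b\<close> by the difference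
  \<open>c = a - b\<close>, the variable in which the doubled form is estimated.\<close>

lemma shear_integral:
  fixes D :: "real \<times> real \<Rightarrow> 'a::{banach, second_countable_topology}"
  assumes D: "integrable (lborel \<Otimes>\<^sub>M lborel) D"
  shows "integrable lborel (\<lambda>c. LINT a|lborel. D (a, a - c))"
    and "(LINT c|lborel. LINT a|lborel. D (a, a - c)) = integral\<^sup>L (lborel \<Otimes>\<^sub>M lborel) D"
    and "integrable (lborel \<Otimes>\<^sub>M lborel) (\<lambda>(a, c). D (a, a - c))"
proof -
  have [measurable]: "D \<in> borel_measurable (lborel \<Otimes>\<^sub>M lborel)" using D by auto
  show I: "integrable (lborel \<Otimes>\<^sub>M lborel) (\<lambda>(a, c). D (a, a - c))"
  proof (rule lborel_pair.Fubini_integrable)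
    show "(\<lambda>(a, c). D (a, a - c)) \<in> borel_measurable (lborel \<Otimes>\<^sub>M lborel)"
      by measurable
    have eq: "(LINT c|lborel. norm (D (a, a - c))) = (LINT b|lborel. norm (D (a, b)))" for a
      by (rule lborel_integral_shift(4))
    show "integrable lborel (\<lambda>a. LINT c|lborel. norm (case (a, c) of (a, c) \<Rightarrow> D (a, a - c)))"
      unfolding prod.case eq by (rule lborel_pair.integrable_fst'[OF integrable_norm[OF D]])
    have "AE a in lborel. integrable lborel (\<lambda>b. D (a, b))"
      using D by (rule lborel_pair.AE_integrable_fst')
    then show "AE a in lborel. integrable lborel (\<lambda>c. case (a, c) of (a, c) \<Rightarrow> D (a, a - c))"
    proof eventually_elim
      case (elim a)
      then show ?case unfolding prod.case lborel_integrable_shift(4)[of "\<lambda>b. D (a, b)" a] .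
    qed
  qed
  show "integrable lborel (\<lambda>c. LINT a|lborel. D (a, a - c))"
    by (rule lborel_pair.integrable_snd[OF I])
  have "(LINT c|lborel. LINT a|lborel. D (a, a - c)) = (LINT a|lborel. LINT c|lborel. D (a, a - c))"
    by (rule lborel_pair.Fubini_integral[OF I])
  also have "\<dots> = (LINT a|lborel. LINT b|lborel. D (a, b))"
    by (intro Bochner_Integration.integral_cong refl lborel_integral_shift(4))
  also have "\<dots> = integral\<^sup>L (lborel \<Otimes>\<^sub>M lborel) D"
    using D by (rule lborel_pair.integral_fst')
  finally show "(LINT c|lborel. LINT a|lborel. D (a, a - c)) = integral\<^sup>L (lborel \<Otimes>\<^sub>M lborel) D" .
qed

section \<open>The multiplier and its size\<close>

text \<open>The multiplier \<open>m\<close> with \<open>z = 1 - 2 \<i> a\<close>;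
  \<open>gmult_eq_integral\<close> recovers the oscillatory integral. The closed form serves as
  definition because products of such factors are again Gaussians.\<close>

definition gmult :: "real \<Rightarrow> real \<Rightarrow> complex" where
  "gmult a \<xi> = gauss_const (Complex 1 (-2 * a)) * exp (- (of_real (pi * \<xi>\<^sup>2) / Complex 1 (-2 * a)))"

lemma gmult_eq_integral:
  "gmult a \<xi> = (LINT t|lborel. of_real (exp (- (pi * t\<^sup>2))) * cis (2 * pi * (a * t\<^sup>2 + \<xi> * t)))"
proof -
  have "of_real (exp (- (pi * t\<^sup>2))) * cis (2 * pi * (a * t\<^sup>2 + \<xi> * t)) =
    exp (- (of_real pi * Complex 1 (-2 * a) * of_real t ^ 2) + 2 * of_real pi * (\<i> * of_real \<xi>) * of_real t)" for t :: real
    unfolding cis_conv_exp exp_of_real[symmetric] mult_exp_exp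
    by (rule arg_cong[where f=exp]) (simp add: complex_eq_iff power2_eq_square algebra_simps)
  then show ?thesis
    using gauss_integral(2)[of "Complex 1 (-2 * a)" "\<i> * of_real \<xi>"]
    by (simp add: gmult_def power_mult_distrib)
qed

lemma norm_gmult_sq:
  "(cmod (gmult a \<xi>))\<^sup>2 = exp (- (2 * pi * \<xi>\<^sup>2 / (1 + 4 * a\<^sup>2))) / sqrt (1 + 4 * a\<^sup>2)"
proof -
  have "Re (of_real (pi * \<xi>\<^sup>2) / Complex 1 (-2 * a)) = pi * \<xi>\<^sup>2 / (1 + 4 * a\<^sup>2)"
    by (simp add: Re_divide power2_eq_square)
  then have 1: "(cmod (exp (- (of_real (pi * \<xi>\<^sup>2) / Complex 1 (-2 * a)))))\<^sup>2 = exp (- (2 * pi * \<xi>\<^sup>2 / (1 + 4 * a\<^sup>2)))"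
    by (simp add: exp_double[symmetric])
  have 2: "(cmod (gauss_const (Complex 1 (-2 * a))))\<^sup>2 = 1 / sqrt (1 + 4 * a\<^sup>2)"
    by (subst norm_gauss_const) (simp_all add: cmod_def power_mult_distrib)
  show ?thesis
    unfolding gmult_def norm_mult power_mult_distrib 1 2 by simp
qed

text \<open>The first bound gives majorants integrable in \<open>\<xi>\<close>, with a width growing
  with \<open>a\<close>; the second serves where size is irrelevant; the third is the decay due to
  the quadratic phase \<open>a * t\<^sup>2\<close>, the source of the gain for small differences of
  frequencies.\<close>

lemma norm_gmult_le:
  "cmod (gmult a \<xi>) \<le> exp (- (pi * \<xi>\<^sup>2 / (1 + 4 * a\<^sup>2)))"
  "cmod (gmult a \<xi>) \<le> 1"
  "a \<noteq> 0 \<Longrightarrow> (cmod (gmult a \<xi>))\<^sup>2 \<le> 1 / (2 * \<bar>a\<bar>)"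
proof -
  have p: "1 + 4 * a\<^sup>2 \<ge> 1" by simp
  have "(cmod (gmult a \<xi>))\<^sup>2 \<le> exp (- (2 * pi * \<xi>\<^sup>2 / (1 + 4 * a\<^sup>2)))"
    unfolding norm_gmult_sq using divide_left_mono[of 1 "sqrt (1 + 4 * a\<^sup>2)" "exp (- (2 * pi * \<xi>\<^sup>2 / (1 + 4 * a\<^sup>2)))"] p
    by simp
  also have "\<dots> = (exp (- (pi * \<xi>\<^sup>2 / (1 + 4 * a\<^sup>2))))\<^sup>2"
    by (simp add: exp_double[symmetric])
  finally show 1: "cmod (gmult a \<xi>) \<le> exp (- (pi * \<xi>\<^sup>2 / (1 + 4 * a\<^sup>2)))"
    by (rule power2_le_imp_le) simp
  show "cmod (gmult a \<xi>) \<le> 1" 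
    by (rule order_trans[OF 1]) simp
  assume a: "a \<noteq> 0"
  have "2 * \<bar>a\<bar> = sqrt (4 * a\<^sup>2)" by (simp add: real_sqrt_mult)
  also have "\<dots> \<le> sqrt (1 + 4 * a\<^sup>2)" by simp
  finally have s: "2 * \<bar>a\<bar> \<le> sqrt (1 + 4 * a\<^sup>2)" .
  have "(cmod (gmult a \<xi>))\<^sup>2 \<le> 1 / sqrt (1 + 4 * a\<^sup>2)"
    unfolding norm_gmult_sq using p by (intro divide_right_mono) auto
  also have "\<dots> \<le> 1 / (2 * \<bar>a\<bar>)"
  proof -
    have "0 < 2 * \<bar>a\<bar>" using a by simp
    then show ?thesis using s by (intro divide_left_mono mult_pos_pos) linarith+
  qed
  finally show "(cmod (gmult a \<xi>))\<^sup>2 \<le> 1 / (2 * \<bar>a\<bar>)" .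
qed

lemma borel_measurable_gauss_const [measurable]: "gauss_const \<in> borel_measurable borel"
  unfolding gauss_const_def by measurable

lemma borel_measurable_gmult [measurable]: "(\<lambda>x. gmult (fst x) (snd x)) \<in> borel_measurable (borel \<Otimes>\<^sub>M borel)"
proof -
  have [measurable]: "(\<lambda>a. Complex 1 (-2 * a)) \<in> borel_measurable borel"
    by (intro borel_measurable_continuous_onI) (auto simp: Complex_eq intro!: continuous_intros)
  show ?thesis unfolding gmult_def by measurable
qed

lemma borel_measurable_gmult' [measurable (raw)]:
  assumes [measurable]: "f \<in> borel_measurable M" "g \<in> borel_measurable M"
  shows "(\<lambda>x. gmult (f x) (g x)) \<in> borel_measurable M"
  using measurable_compose[OF measurable_Pair[OF assms] borel_measurable_gmult] by simp

lemma borel_measurable_cnj [measurable (raw)]: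
  assumes [measurable]: "f \<in> borel_measurable M"
  shows "(\<lambda>x. cnj (f x)) \<in> borel_measurable M"
  using measurable_compose[OF assms borel_measurable_continuous_onI[OF continuous_on_cnj[OF continuous_on_id]]]
  by simp

text \<open>The kernel of the form obtained by expanding the square of \<open>\<integral> g(a) \<phi>(a + \<xi>) m(a, \<xi>) da\<close> and
  substituting \<open>b = a - \<zeta>\<close>, \<open>u = a + \<xi>\<close>.\<close>

definition gkernel :: "real \<Rightarrow> real \<Rightarrow> real \<Rightarrow> complex" where
  "gkernel \<zeta> a u = gmult a (u - a) * cnj (gmult (a - \<zeta>) (u - a))"

lemma borel_measurable_gkernel [measurable (raw)]:
  assumes [measurable]: "f \<in> borel_measurable M" "g \<in> borel_measurable M" "h \<in> borel_measurable M"
  shows "(\<lambda>x. gkernel (f x) (g x) (h x)) \<in> borel_measurable M"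
  unfolding gkernel_def by measurable

text \<open>The integrand is a Gaussian in \<open>v = u - a\<close>, so the integral is explicit.
  Its squared modulus is at most \<open>1 / cmod (p * q * p' * q' * z)\<close>, whose denominator is
  a polynomial in the frequencies and is bounded below by its imaginary part. The product form of
  the claim avoids a case split where this imaginary part vanishes.\<close>

lemma gkernel_TT:
  fixes a a' \<zeta> :: real
  defines "b \<equiv> a - \<zeta>" and "b' \<equiv> a' - \<zeta>"
  shows "(cmod (LINT u|lborel. gkernel \<zeta> a u * cnj (gkernel \<zeta> a' u)))\<^sup>2 * \<bar>8 * \<zeta> * (a * b - a' * b')\<bar> \<le> 1"
proof -
  define p q p' q' where "p = Complex 1 (-2 * a)" and "q = Complex 1 (2 * b)"
    and "p' = Complex 1 (2 * a')" and "q' = Complex 1 (-2 * b')"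
  have Re: "Re p > 0" "Re q > 0" "Re p' > 0" "Re q' > 0" by (simp_all add: p_def q_def p'_def q'_def)
  then have n0: "p \<noteq> 0" "q \<noteq> 0" "p' \<noteq> 0" "q' \<noteq> 0" by auto
  \<comment> \<open>\<open>\<kappa>\<close> collects the two factors centred at
    \<open>u = a\<close>, and \<open>\<kappa>'\<close> the two factors centred at
    \<open>u = a'\<close>; \<open>\<Delta>\<close> will be the offset of the centres.\<close>
  define \<kappa> \<kappa>' where "\<kappa> = 1 / p + 1 / q" and "\<kappa>' = 1 / p' + 1 / q'"
  have Rinv: "Re (1 / w) > 0" if "Re w > 0" for w :: complex
    using that by (simp add: Re_divide sum_power2_gt_zero_iff)
  have Rk: "Re \<kappa> > 0" "Re \<kappa>' > 0" using Re[THEN Rinv] by (simp_all add: \<kappa>_def \<kappa>'_def)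
  then have k0: "\<kappa> \<noteq> 0" "\<kappa>' \<noteq> 0" by auto
  define z where "z = \<kappa> + \<kappa>'"
  have Rz: "Re z > 0" using Rk by (simp add: z_def)
  then have z0: "z \<noteq> 0" by auto
  define \<Delta> where "\<Delta> = a - a'"
  define C where "C = gauss_const p * cnj (gauss_const (cnj q)) * (cnj (gauss_const (cnj p')) * gauss_const q')"
  have e: "gkernel \<zeta> a (a + v) * cnj (gkernel \<zeta> a' (a + v)) =
    C * exp (- (of_real pi * \<kappa>' * of_real \<Delta> ^ 2)) *
      exp (- (of_real pi * z * of_real v ^ 2) + 2 * of_real pi * (- \<kappa>' * of_real \<Delta>) * of_real v)" for v
  proof -
    have cc: "Complex 1 (- 2 * (a - \<zeta>)) = cnj q" "Complex 1 (- 2 * a') = cnj p'" 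
      "Complex 1 (- 2 * (a' - \<zeta>)) = q'" "Complex 1 (- 2 * a) = p"
      by (simp_all add: q_def p'_def q'_def p_def b_def b'_def complex_eq_iff)
    have g: "gmult a (a + v - a) = gauss_const p * exp (- (of_real (pi * v\<^sup>2) / p))"
      "cnj (gmult (a - \<zeta>) (a + v - a)) = cnj (gauss_const (cnj q)) * exp (- (of_real (pi * v\<^sup>2) / q))"
      "cnj (gmult a' (a + v - a')) = cnj (gauss_const (cnj p')) * exp (- (of_real (pi * (v + \<Delta>)\<^sup>2) / p'))"
      "gmult (a' - \<zeta>) (a + v - a') = gauss_const q' * exp (- (of_real (pi * (v + \<Delta>)\<^sup>2) / q'))"
      unfolding gmult_def cc \<Delta>_def by (simp_all add: exp_cnj add.commute add_diff_eq)
    have "gkernel \<zeta> a (a + v) * cnj (gkernel \<zeta> a' (a + v)) = C *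
      (exp (- (of_real (pi * v\<^sup>2) / p)) * exp (- (of_real (pi * v\<^sup>2) / q)) *
       (exp (- (of_real (pi * (v + \<Delta>)\<^sup>2) / p')) * exp (- (of_real (pi * (v + \<Delta>)\<^sup>2) / q'))))"
      unfolding gkernel_def complex_cnj_mult complex_cnj_cnj g C_def by (simp only: mult_ac)
    also have "\<dots> = C * (exp (- (of_real pi * \<kappa>' * of_real \<Delta> ^ 2)) *
      exp (- (of_real pi * z * of_real v ^ 2) + 2 * of_real pi * (- \<kappa>' * of_real \<Delta>) * of_real v))"
    proof -
      define ip iq ip' iq' where "ip = inverse p" and "iq = inverse q" and "ip' = inverse p'" and "iq' = inverse q'"
      show ?thesis
        unfolding mult_exp_exp z_def \<kappa>_def \<kappa>'_def divide_inverse ip_def[symmetric] iq_def[symmetric] ip'_def[symmetric] iq'_def[symmetric]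
        by (rule arg_cong[where f="\<lambda>w. C * exp w"]) (simp add: power2_eq_square algebra_simps)
    qed
    finally show ?thesis by (simp only: mult.assoc)
  qed
  have "(LINT u|lborel. gkernel \<zeta> a u * cnj (gkernel \<zeta> a' u)) =
    (LINT v|lborel. gkernel \<zeta> a (a + v) * cnj (gkernel \<zeta> a' (a + v)))"
    using lborel_integral_shift(2)[of "\<lambda>u. gkernel \<zeta> a u * cnj (gkernel \<zeta> a' u)" a] by simp
  also have "\<dots> = C * exp (- (of_real pi * \<kappa>' * of_real \<Delta> ^ 2)) * (exp (of_real pi * (- \<kappa>' * of_real \<Delta>)\<^sup>2 / z) * gauss_const z)"
    unfolding e integral_mult_right_zero by (subst gauss_integral(2)[OF Rz]) simp
  \<comment> \<open>What survives of completing the square is the harmonic sum of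
    \<open>\<kappa>\<close> and \<open>\<kappa>'\<close>. Its real part is positive, hence this
    exponential has modulus at most 1.\<close>
  also have "\<dots> = C * gauss_const z * exp (- (of_real (pi * \<Delta>\<^sup>2) * (1 / (1 / \<kappa> + 1 / \<kappa>'))))"
  proof -
    have "1 / (1 / \<kappa> + 1 / \<kappa>') = \<kappa> * \<kappa>' / z" using k0 by (simp add: z_def field_simps)
    also have "\<dots> = \<kappa>' - \<kappa>'\<^sup>2 / z" using z0 by (simp add: field_simps) (simp add: z_def power2_eq_square algebra_simps)
    finally have eq: "1 / (1 / \<kappa> + 1 / \<kappa>') = \<kappa>' - \<kappa>'\<^sup>2 / z" .
    have "exp (- (of_real (pi * \<Delta>\<^sup>2) * (1 / (1 / \<kappa> + 1 / \<kappa>')))) =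
       exp (- (of_real pi * \<kappa>' * of_real \<Delta> ^ 2)) * exp (of_real pi * (- \<kappa>' * of_real \<Delta>)\<^sup>2 / z)"
      unfolding mult_exp_exp eq by (intro arg_cong[where f=exp]) (simp add: power_mult_distrib algebra_simps)
    then show ?thesis by simp
  qed
  finally have "cmod (LINT u|lborel. gkernel \<zeta> a u * cnj (gkernel \<zeta> a' u)) =
    cmod C * cmod (gauss_const z) * exp (- (pi * \<Delta>\<^sup>2 * Re (1 / (1 / \<kappa> + 1 / \<kappa>'))))"
    by (simp only: norm_mult norm_exp_eq_Re Re_complex_of_real times_complex.sel uminus_complex.sel
         Im_complex_of_real mult_zero_left diff_zero)
  also have "\<dots> \<le> cmod C * cmod (gauss_const z) * 1"
    using Rinv[of "1 / \<kappa> + 1 / \<kappa>'"] Rinv[OF Rk(1)] Rinv[OF Rk(2)]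
    by (intro mult_left_mono) auto
  finally have "(cmod (LINT u|lborel. gkernel \<zeta> a u * cnj (gkernel \<zeta> a' u)))\<^sup>2 \<le> (cmod C * cmod (gauss_const z))\<^sup>2"
    by (simp add: power_mono)
  also have "\<dots> = 1 / cmod (p * q * p' * q' * z)"
    using Re Rz by (simp add: C_def norm_mult power_mult_distrib norm_gauss_const)
  finally have 1: "(cmod (LINT u|lborel. gkernel \<zeta> a u * cnj (gkernel \<zeta> a' u)))\<^sup>2 \<le> 1 / cmod (p * q * p' * q' * z)" .
  \<comment> \<open>Multiplying out clears all reciprocals. As
    \<open>p + q = 2 - 2 \<i> \<zeta>\<close> and \<open>p' + q' = 2 + 2 \<i> \<zeta>\<close>, the
    terms free of \<open>a * b\<close> and \<open>a' * b'\<close> cancel in the imaginary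
    part.\<close>
  have "p * q * p' * q' * z = (p + q) * (p' * q') + (p' + q') * (p * q)"
    using n0 by (simp add: z_def \<kappa>_def \<kappa>'_def field_simps)
  also have "Im \<dots> = 8 * \<zeta> * (a * b - a' * b')"
    by (simp add: p_def q_def p'_def q'_def b_def b'_def algebra_simps)
  finally have "\<bar>8 * \<zeta> * (a * b - a' * b')\<bar> \<le> cmod (p * q * p' * q' * z)"
    by (metis abs_Im_le_cmod)
  moreover have "cmod (p * q * p' * q' * z) > 0" using n0 z0 by simp
  ultimately show ?thesis
    using mult_mono[OF 1, of "\<bar>8 * \<zeta> * (a * b - a' * b')\<bar>" "cmod (p * q * p' * q' * z)"] by simp
qed

lemma nn_integral_lborel_shift:
  fixes f :: "real \<Rightarrow> ennreal"
  assumes [measurable]: "f \<in> borel_measurable borel"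
  shows "(\<integral>\<^sup>+x. f (x - c) \<partial>lborel) = (\<integral>\<^sup>+x. f x \<partial>lborel)"
    and "(\<integral>\<^sup>+x. f (c - x) \<partial>lborel) = (\<integral>\<^sup>+x. f x \<partial>lborel)"
    and "(\<integral>\<^sup>+x. f (x + c) \<partial>lborel) = (\<integral>\<^sup>+x. f x \<partial>lborel)"
  using nn_integral_real_affine[OF assms, of 1 "-c"] nn_integral_real_affine[OF assms, of "-1" c]
   nn_integral_real_affine[OF assms, of 1 c]
  by (simp_all add: add.commute)

lemma nn_integral_inverse_sqrt_abs:
  assumes N: "N \<ge> 0"
  shows "(\<integral>\<^sup>+x. ennreal (indicator {-N..N} x / sqrt \<bar>x\<bar>) \<partial>lborel) = ennreal (4 * sqrt N)"
proof -
  let ?f = "\<lambda>x::real. ennreal (indicator {0..N} x / sqrt \<bar>x\<bar>)"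
  have 1: "(\<integral>\<^sup>+x. ?f x \<partial>lborel) = ennreal (2 * sqrt N)"
  proof -
    have "((\<lambda>x. x powr (-1/2)) has_integral (2 * sqrt N)) {0..N}"
      using has_integral_powr_from_0[of "-1/2" N] N by (simp add: powr_half_sqrt mult.commute)
    then have "((\<lambda>x. indicator {0..N} x * x powr (-1/2)) has_integral (2 * sqrt N)) UNIV"
    proof -
      have "indicator {0..N} x * x powr (-1/2) = (if x \<in> {0..N} then x powr (-1/2) else 0)" for x
        by (simp add: indicator_def)
      with \<open>((\<lambda>x. x powr (-1/2)) has_integral (2 * sqrt N)) {0..N}\<close> show ?thesis
        by (simp only: has_integral_restrict_UNIV)
    qed
    then have "(\<integral>\<^sup>+x. ennreal (indicator {0..N} x * x powr (-1/2)) \<partial>lborel) = ennreal (2 * sqrt N)"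
      by (intro nn_integral_has_integral_lborel) auto
    moreover have "?f x = ennreal (indicator {0..N} x * x powr (-1/2))" for x
    proof -
      have "x powr (-1/2) = 1 / sqrt \<bar>x\<bar>" if "x \<ge> 0"
        using that by (cases "x = 0") (simp_all add: powr_minus_divide powr_half_sqrt)
      then show ?thesis by (auto simp: indicator_def)
    qed
    ultimately show ?thesis by simp
  qed
  \<comment> \<open>The two halves overlap at 0 only, where division by zero makes every term
    0.\<close>
  have "(\<integral>\<^sup>+x. ennreal (indicator {-N..N} x / sqrt \<bar>x\<bar>) \<partial>lborel) = (\<integral>\<^sup>+x. ?f x + ?f (0 - x) \<partial>lborel)"
    by (intro nn_integral_cong) (auto simp: indicator_def)
  also have "\<dots> = (\<integral>\<^sup>+x. ?f x \<partial>lborel) + (\<integral>\<^sup>+x. ?f (0 - x) \<partial>lborel)"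
    by (rule nn_integral_add) auto
  also have "(\<integral>\<^sup>+x. ?f (0 - x) \<partial>lborel) = (\<integral>\<^sup>+x. ?f x \<partial>lborel)"
    by (rule nn_integral_lborel_shift) simp
  finally show ?thesis unfolding 1 using N by (simp flip: ennreal_plus)
qed

lemma integral_pair_mult:
  fixes f :: "real \<Rightarrow> complex" and g :: "real \<Rightarrow> complex"
  assumes f: "integrable lborel f" and g: "integrable lborel g"
  shows "integrable lborel (\<lambda>z. f (fst z) * g (snd z))"
    and "(LINT z|lborel. f (fst z) * g (snd z)) = (LINT x|lborel. f x) * (LINT y|lborel. g y)"
proof -
  have [measurable]: "f \<in> borel_measurable lborel" "g \<in> borel_measurable lborel" using f g by auto
  have I: "integrable (lborel \<Otimes>\<^sub>M lborel) (\<lambda>z. f (fst z) * g (snd z))"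
    by (rule lborel_pair.integrable_pair_bound[where f="\<lambda>x. norm (f x)" and g="\<lambda>x. norm (g x)"])
      (use f g in \<open>auto simp: norm_mult\<close>)
  then show "integrable lborel (\<lambda>z. f (fst z) * g (snd z))" unfolding lborel_prod .
  show "(LINT z|lborel. f (fst z) * g (snd z)) = (LINT x|lborel. f x) * (LINT y|lborel. g y)"
    using lborel_pair.integral_fst'[OF I] by (simp add: lborel_prod)
qed

text \<open>Domination in \<open>u\<close>, uniform over the frequencies in use, as Fubini requires.
  The crude dependence on \<open>N\<close> disappears from the estimates, since the majorant only
  certifies integrability.\<close>

lemma gkernel_majorant:
  assumes "\<bar>a\<bar> \<le> 2 * N"
  shows "cmod (gkernel \<zeta> a u) \<le> exp (pi * (4 * N\<^sup>2)) * exp (- (pi / (2 * (1 + 16 * N\<^sup>2)) * u\<^sup>2))"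
    and "cmod (gkernel \<zeta> a u) \<le> 1"
proof -
  define M where "M = 1 + 16 * N\<^sup>2"
  have M: "M \<ge> 1" by (simp add: M_def)
  have k: "cmod (gkernel \<zeta> a u) \<le> cmod (gmult a (u - a))"
    using mult_left_mono[OF norm_gmult_le(2)[of "a - \<zeta>" "u - a"], of "cmod (gmult a (u - a))"]
    by (simp add: gkernel_def norm_mult)
  also note norm_gmult_le(2)
  finally show "cmod (gkernel \<zeta> a u) \<le> 1" .
  note k
  also note norm_gmult_le(1)
  finally have 1: "cmod (gkernel \<zeta> a u) \<le> exp (- (pi * (u - a)\<^sup>2 / (1 + 4 * a\<^sup>2)))" .
  have "\<bar>a\<bar>\<^sup>2 \<le> (2 * N)\<^sup>2" using assms by (intro power_mono) auto
  then have a2: "a\<^sup>2 \<le> 4 * N\<^sup>2" by (simp add: power_mult_distrib)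
  have "0 \<le> (u / 2 - a)\<^sup>2 * 2" by simp
  then have "u\<^sup>2 / 2 - a\<^sup>2 \<le> (u - a)\<^sup>2" by (simp add: power2_eq_square algebra_simps)
  then have "u\<^sup>2 / 2 - 4 * N\<^sup>2 \<le> (u - a)\<^sup>2" using a2 by simp
  then have "(u\<^sup>2 / 2 - 4 * N\<^sup>2) / M \<le> (u - a)\<^sup>2 / M" using M by (intro divide_right_mono) auto
  also have "\<dots> \<le> (u - a)\<^sup>2 / (1 + 4 * a\<^sup>2)" using a2
    by (intro divide_left_mono mult_pos_pos) (auto simp: M_def add_pos_nonneg)
  finally have "(u - a)\<^sup>2 / (1 + 4 * a\<^sup>2) \<ge> u\<^sup>2 / (2 * M) - 4 * N\<^sup>2 / M"
    by (simp add: diff_divide_distrib)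
  moreover have "4 * N\<^sup>2 / M \<le> 4 * N\<^sup>2 / 1" using M by (intro divide_left_mono) auto
  ultimately have "u\<^sup>2 / (2 * M) - 4 * N\<^sup>2 \<le> (u - a)\<^sup>2 / (1 + 4 * a\<^sup>2)" by simp
  then have "pi * (u\<^sup>2 / (2 * M) - 4 * N\<^sup>2) \<le> pi * ((u - a)\<^sup>2 / (1 + 4 * a\<^sup>2))"
    by (intro mult_left_mono) auto
  then have "exp (- (pi * ((u - a)\<^sup>2 / (1 + 4 * a\<^sup>2)))) \<le> exp (- (pi * (u\<^sup>2 / (2 * M) - 4 * N\<^sup>2)))" by simp
  also have "\<dots> = exp (pi * (4 * N\<^sup>2)) * exp (- (pi / (2 * M) * u\<^sup>2))"
    unfolding mult_exp_exp by (simp add: algebra_simps)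
  finally show "cmod (gkernel \<zeta> a u) \<le> exp (pi * (4 * N\<^sup>2)) * exp (- (pi / (2 * (1 + 16 * N\<^sup>2)) * u\<^sup>2))"
    using 1 unfolding M_def by simp
qed

text \<open>The factor \<open>a + a' - \<zeta>\<close> is the sum of \<open>a\<close> and
  \<open>a' - \<zeta>\<close>, two numbers of the same sign and of size at least \<open>N\<close>.
  The 4 is the root of \<open>8 * 2\<close>.\<close>

lemma gkernel_TT_bound:
  fixes a a' \<zeta> s N :: real
  assumes s: "\<bar>s\<bar> = 1" and N: "N > 0" and z: "\<zeta> \<noteq> 0"
    and a: "N \<le> s * a" and b: "N \<le> s * (a' - \<zeta>)" and ne: "a \<noteq> a'"
  shows "cmod (LINT u|lborel. gkernel \<zeta> a u * cnj (gkernel \<zeta> a' u)) \<le> 1 / (4 * sqrt (N * \<bar>\<zeta>\<bar>) * sqrt \<bar>a - a'\<bar>)"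
proof -
  define I where "I = cmod (LINT u|lborel. gkernel \<zeta> a u * cnj (gkernel \<zeta> a' u))"
  have "2 * N \<le> s * (a + a' - \<zeta>)" using a b by (simp add: algebra_simps)
  also have "\<dots> \<le> \<bar>s * (a + a' - \<zeta>)\<bar>" by simp
  finally have "2 * N \<le> \<bar>a + a' - \<zeta>\<bar>" using s by (simp add: abs_mult)
  then have "8 * \<bar>\<zeta>\<bar> * \<bar>a - a'\<bar> * (2 * N) \<le> 8 * \<bar>\<zeta>\<bar> * \<bar>a - a'\<bar> * \<bar>a + a' - \<zeta>\<bar>"
    by (intro mult_left_mono) auto
  also have "\<dots> = \<bar>8 * \<zeta> * ((a - a') * (a + a' - \<zeta>))\<bar>" by (simp add: abs_mult)
  also have "(a - a') * (a + a' - \<zeta>) = a * (a - \<zeta>) - a' * (a' - \<zeta>)" by (simp add: algebra_simps)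
  finally have "I\<^sup>2 * (16 * (N * \<bar>\<zeta>\<bar> * \<bar>a - a'\<bar>)) \<le> I\<^sup>2 * \<bar>8 * \<zeta> * (a * (a - \<zeta>) - a' * (a' - \<zeta>))\<bar>"
    by (intro mult_left_mono) (auto simp: mult_ac)
  also have "\<dots> \<le> 1" unfolding I_def by (rule gkernel_TT)
  finally have "(I * (4 * sqrt (N * \<bar>\<zeta>\<bar>) * sqrt \<bar>a - a'\<bar>))\<^sup>2 \<le> 1\<^sup>2"
    using N by (simp add: power_mult_distrib mult_ac real_sqrt_mult)
  then have "I * (4 * sqrt (N * \<bar>\<zeta>\<bar>) * sqrt \<bar>a - a'\<bar>) \<le> 1" by (rule power2_le_imp_le) simp
  moreover have "4 * sqrt (N * \<bar>\<zeta>\<bar>) * sqrt \<bar>a - a'\<bar> > 0" using N z ne by simp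
  ultimately show ?thesis unfolding I_def[symmetric] by (simp add: pos_le_divide_eq)
qed

text \<open>Schur's test for the kernel \<open>R\<close> of the squared operator: by
  \<open>gkernel_TT_bound\<close> it is dominated, on the support of \<open>\<Gamma>\<close>, by a
  function of \<open>a - a'\<close> whose integral does not depend on \<open>N\<close>. The inverse
  square root is integrable because the support lies in one dyadic interval.\<close>

lemma gkernel_L2_bound:
  fixes \<Gamma> :: "real \<Rightarrow> complex" and s N \<zeta> :: real
  assumes s: "\<bar>s\<bar> = 1" and N: "N > 0" and z: "\<zeta> \<noteq> 0"
    and \<Gamma>: "integrable lborel \<Gamma>" and \<Gamma>2: "integrable lborel (\<lambda>a. (cmod (\<Gamma> a))\<^sup>2)"
    and supp: "\<And>a. \<Gamma> a \<noteq> 0 \<Longrightarrow> N \<le> s * a \<and> s * a \<le> 2 * N \<and> N \<le> s * (a - \<zeta>)"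
  defines "S \<equiv> \<lambda>u. LINT a|lborel. \<Gamma> a * gkernel \<zeta> a u"
  shows "integrable lborel (\<lambda>u. (cmod (S u))\<^sup>2)"
    and "(LINT u|lborel. (cmod (S u))\<^sup>2) \<le> 1 / sqrt \<bar>\<zeta>\<bar> * (LINT a|lborel. (cmod (\<Gamma> a))\<^sup>2)"
proof -
  have [measurable]: "\<Gamma> \<in> borel_measurable borel" using \<Gamma> by auto
  define c where "c = pi / (2 * (1 + 16 * N\<^sup>2))"
  have c: "c > 0" by (simp add: c_def add_pos_nonneg)
  define G where "G u = exp (pi * (4 * N\<^sup>2)) * exp (- (c * u\<^sup>2))" for u :: real
  have G: "integrable lborel G" unfolding G_def using c by (intro integrable_mult_right gaussian_integrable_real)
  have absa: "\<bar>a\<bar> \<le> 2 * N" if "\<Gamma> a \<noteq> 0" for a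
  proof -
    have "\<bar>a\<bar> = \<bar>s * a\<bar>" using s by (simp add: abs_mult)
    then show ?thesis using supp[OF that] N by linarith
  qed
  have kG: "cmod (gkernel \<zeta> a u) \<le> G u" "cmod (gkernel \<zeta> a u) \<le> 1" if "\<Gamma> a \<noteq> 0" for a u
    using gkernel_majorant[OF absa[OF that], of \<zeta> u] by (simp_all add: G_def c_def)
  have \<Gamma>k: "integrable lborel (\<lambda>a. \<Gamma> a * gkernel \<zeta> a u)" for u
  proof (rule Bochner_Integration.integrable_bound[OF \<Gamma>])
    have "cmod (\<Gamma> a * gkernel \<zeta> a u) \<le> cmod (\<Gamma> a)" for a
      using mult_left_mono[OF kG(2)[of a u], of "cmod (\<Gamma> a)"] by (cases "\<Gamma> a = 0") (auto simp: norm_mult)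
    then show "AE a in lborel. cmod (\<Gamma> a * gkernel \<zeta> a u) \<le> cmod (\<Gamma> a)" by simp
  qed measurable
  define H where "H = (\<lambda>(u, p). (\<Gamma> (fst p) * gkernel \<zeta> (fst p) u) * cnj (\<Gamma> (snd p) * gkernel \<zeta> (snd p) u))"
  have [measurable]: "H \<in> borel_measurable (lborel \<Otimes>\<^sub>M lborel)"
    unfolding H_def lborel_prod[symmetric] by measurable
  have SH: "of_real ((cmod (S u))\<^sup>2) = (LINT p|lborel. H (u, p))" for u
  proof -
    have "of_real ((cmod (S u))\<^sup>2) = S u * cnj (S u)" by (simp only: complex_norm_square)
    also have "cnj (S u) = (LINT a|lborel. cnj (\<Gamma> a * gkernel \<zeta> a u))"
      unfolding S_def by (rule Bochner_Integration.integral_cnj[symmetric])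
    also have "S u * \<dots> = (LINT p|lborel. (\<Gamma> (fst p) * gkernel \<zeta> (fst p) u) * cnj (\<Gamma> (snd p) * gkernel \<zeta> (snd p) u))"
      unfolding S_def by (rule integral_pair_mult(2)[symmetric, OF \<Gamma>k integrable_cnj[OF \<Gamma>k]])
    finally show ?thesis unfolding H_def prod.case .
  qed
  have intH: "integrable (lborel \<Otimes>\<^sub>M lborel) H"
  proof (rule lborel_pair.integrable_pair_bound[OF _ G])
    show "integrable lborel (\<lambda>p. cmod (\<Gamma> (fst p) * \<Gamma> (snd p)))"
      by (rule integrable_norm[OF integral_pair_mult(1)[OF \<Gamma> \<Gamma>]])
    show "cmod (H (u, p)) \<le> G u * cmod (\<Gamma> (fst p) * \<Gamma> (snd p))" for u p
    proof (cases "\<Gamma> (fst p) = 0 \<or> \<Gamma> (snd p) = 0")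
      case False
      have "cmod (H (u, p)) = cmod (\<Gamma> (fst p) * \<Gamma> (snd p)) * (cmod (gkernel \<zeta> (fst p) u) * cmod (gkernel \<zeta> (snd p) u))"
        by (simp add: H_def norm_mult)
      also have "\<dots> \<le> cmod (\<Gamma> (fst p) * \<Gamma> (snd p)) * (G u * 1)"
        using False by (intro mult_left_mono mult_mono kG) (auto simp: G_def)
      finally show ?thesis by (simp add: mult.commute)
    qed (auto simp: H_def)
  qed measurable
  have int1: "integrable lborel (\<lambda>u. LINT p|lborel. H (u, p))"
    using lborel_pair.integrable_fst'[OF intH] .
  then show "integrable lborel (\<lambda>u. (cmod (S u))\<^sup>2)"
    unfolding SH[symmetric] complex_of_real_integrable_eq .
  define R where "R a a' = (LINT u|lborel. gkernel \<zeta> a u * cnj (gkernel \<zeta> a' u))" for a a'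
  \<comment> \<open>Half of the bound for \<open>R\<close>, because it is used once for each of the
    two terms of the test. The truncation is justified by the support: \<open>s * a\<close> and
    \<open>s * a'\<close> both lie between \<open>N\<close> and \<open>2 * N\<close>.\<close>
  define \<rho> where "\<rho> x = 1 / (8 * sqrt (N * \<bar>\<zeta>\<bar>)) * (indicator {-N..N} x / sqrt \<bar>x\<bar>)" for x :: real
  have \<rho>0: "\<rho> x \<ge> 0" for x using N by (simp add: \<rho>_def)
  have [measurable]: "\<rho> \<in> borel_measurable borel" unfolding \<rho>_def by measurable
  have \<rho>i: "(\<integral>\<^sup>+x. ennreal (\<rho> x) \<partial>lborel) = ennreal (1 / (2 * sqrt \<bar>\<zeta>\<bar>))"
  proof -
    have "(\<integral>\<^sup>+x. ennreal (\<rho> x) \<partial>lborel) = (\<integral>\<^sup>+x. ennreal (1 / (8 * sqrt (N * \<bar>\<zeta>\<bar>))) * ennreal (indicator {-N..N} x / sqrt \<bar>x\<bar>) \<partial>lborel)"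
      unfolding \<rho>_def using N by (intro nn_integral_cong ennreal_mult') auto
    also have "\<dots> = ennreal (1 / (8 * sqrt (N * \<bar>\<zeta>\<bar>))) * ennreal (4 * sqrt N)"
      using N by (subst nn_integral_cmult) (auto simp: nn_integral_inverse_sqrt_abs)
    also have "\<dots> = ennreal (1 / (2 * sqrt \<bar>\<zeta>\<bar>))"
      using N z by (subst ennreal_mult'[symmetric]) (auto simp: real_sqrt_mult)
    finally show ?thesis .
  qed
  have HR: "(LINT u|lborel. H (u, p)) = \<Gamma> (fst p) * cnj (\<Gamma> (snd p)) * R (fst p) (snd p)" for p
  proof -
    have "H (u, p) = (\<Gamma> (fst p) * cnj (\<Gamma> (snd p))) * (gkernel \<zeta> (fst p) u * cnj (gkernel \<zeta> (snd p) u))" for u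
      by (simp add: H_def mult_ac)
    then show ?thesis by (simp add: R_def)
  qed
  have HRb: "cmod (\<Gamma> a * cnj (\<Gamma> a') * R a a') \<le> (cmod (\<Gamma> a))\<^sup>2 * \<rho> (a - a') + (cmod (\<Gamma> a'))\<^sup>2 * \<rho> (a - a')"
    if "a \<noteq> a'" for a a'
  proof (cases "\<Gamma> a = 0 \<or> \<Gamma> a' = 0")
    case False
    have "\<bar>a - a'\<bar> = \<bar>s * (a - a')\<bar>" using s by (simp add: abs_mult)
    also have "\<dots> \<le> N" using supp[of a] supp[of a'] False by (auto simp: algebra_simps abs_le_iff)
    finally have "2 * \<rho> (a - a') = 1 / (4 * sqrt (N * \<bar>\<zeta>\<bar>) * sqrt \<bar>a - a'\<bar>)"
      by (auto simp: \<rho>_def indicator_def)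
    then have "cmod (R a a') \<le> 2 * \<rho> (a - a')"
      unfolding R_def using gkernel_TT_bound[OF s N z _ _ that] supp[of a] supp[of a'] False by auto
    then have "cmod (\<Gamma> a * cnj (\<Gamma> a') * R a a') \<le> (cmod (\<Gamma> a) * cmod (\<Gamma> a')) * (2 * \<rho> (a - a'))"
      by (auto simp: norm_mult intro!: mult_left_mono)
    also have "\<dots> \<le> (((cmod (\<Gamma> a))\<^sup>2 + (cmod (\<Gamma> a'))\<^sup>2) / 2) * (2 * \<rho> (a - a'))"
      using sum_squares_bound[of "cmod (\<Gamma> a)" "cmod (\<Gamma> a')"] \<rho>0 by (intro mult_right_mono) auto
    finally show ?thesis by (simp add: algebra_simps)
  qed (use \<rho>0 in auto)
  have "of_real (LINT u|lborel. (cmod (S u))\<^sup>2) = (LINT u|lborel. LINT p|lborel. H (u, p))"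
    unfolding SH[symmetric] by (simp only: integral_complex_of_real)
  also have "\<dots> = (LINT p|lborel. LINT u|lborel. H (u, p))"
    using lborel_pair.Fubini_integral[of "\<lambda>u p. H (u, p)"] intH by simp
  finally have eq: "of_real (LINT u|lborel. (cmod (S u))\<^sup>2) = (LINT p|lborel. LINT u|lborel. H (u, p))" .
  have "(LINT u|lborel. (cmod (S u))\<^sup>2) = cmod (of_real (LINT u|lborel. (cmod (S u))\<^sup>2))"
    unfolding norm_of_real by simp
  also note eq
  finally have "(LINT u|lborel. (cmod (S u))\<^sup>2) = cmod (LINT p|lborel. LINT u|lborel. H (u, p))" .
  \<comment> \<open>From here on the integrals are extended nonnegative ones, for which Tonelli asks
    for no integrability of the majorant.\<close>
  then have "ennreal (LINT u|lborel. (cmod (S u))\<^sup>2) \<le> (\<integral>\<^sup>+p. ennreal (cmod (LINT u|lborel. H (u, p))) \<partial>lborel)"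
    using integral_norm_bound_ennreal[OF lborel_pair.integrable_snd[of "\<lambda>u p. H (u, p)"]] intH by simp
  also have "\<dots> = (\<integral>\<^sup>+p. ennreal (cmod (\<Gamma> (fst p) * cnj (\<Gamma> (snd p)) * R (fst p) (snd p))) \<partial>(lborel \<Otimes>\<^sub>M lborel))"
    unfolding HR lborel_prod ..
  also have "\<dots> = (\<integral>\<^sup>+a. \<integral>\<^sup>+a'. ennreal (cmod (\<Gamma> a * cnj (\<Gamma> a') * R a a')) \<partial>lborel \<partial>lborel)"
    by (subst lborel.nn_integral_fst[symmetric]) (simp_all add: R_def)
  also have "\<dots> \<le> (\<integral>\<^sup>+a. \<integral>\<^sup>+a'. ennreal ((cmod (\<Gamma> a))\<^sup>2 * \<rho> (a - a') + (cmod (\<Gamma> a'))\<^sup>2 * \<rho> (a - a')) \<partial>lborel \<partial>lborel)"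
  proof (rule nn_integral_mono, rule nn_integral_mono_AE)
    fix a :: real
    \<comment> \<open>At \<open>a' = a\<close> the function \<open>\<rho>\<close> is 0 by the
      convention for division and the pointwise bound may fail; this is one point for each
      \<open>a\<close>.\<close>
    have "AE a' in lborel. a' \<noteq> a" by (rule AE_lborel_singleton)
    then show "AE a' in lborel. ennreal (cmod (\<Gamma> a * cnj (\<Gamma> a') * R a a')) \<le>
       ennreal ((cmod (\<Gamma> a))\<^sup>2 * \<rho> (a - a') + (cmod (\<Gamma> a'))\<^sup>2 * \<rho> (a - a'))"
      by eventually_elim (auto intro!: ennreal_leI HRb)
  qed
  also have "\<dots> = (\<integral>\<^sup>+a. \<integral>\<^sup>+a'. (ennreal ((cmod (\<Gamma> a))\<^sup>2) * ennreal (\<rho> (a - a')) + ennreal ((cmod (\<Gamma> a'))\<^sup>2) * ennreal (\<rho> (a - a'))) \<partial>lborel \<partial>lborel)"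
    using \<rho>0 by (intro nn_integral_cong) (simp add: ennreal_mult' ennreal_plus)
  also have "\<dots> = (\<integral>\<^sup>+a. \<integral>\<^sup>+a'. ennreal ((cmod (\<Gamma> a))\<^sup>2) * ennreal (\<rho> (a - a')) \<partial>lborel \<partial>lborel) +
      (\<integral>\<^sup>+a. \<integral>\<^sup>+a'. ennreal ((cmod (\<Gamma> a'))\<^sup>2) * ennreal (\<rho> (a - a')) \<partial>lborel \<partial>lborel)"
    by (simp add: nn_integral_add)
  also have "(\<integral>\<^sup>+a. \<integral>\<^sup>+a'. ennreal ((cmod (\<Gamma> a'))\<^sup>2) * ennreal (\<rho> (a - a')) \<partial>lborel \<partial>lborel)
    = (\<integral>\<^sup>+a'. \<integral>\<^sup>+a. ennreal ((cmod (\<Gamma> a'))\<^sup>2) * ennreal (\<rho> (a - a')) \<partial>lborel \<partial>lborel)"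
    by (rule lborel_pair.Fubini') measurable
  also have "(\<integral>\<^sup>+a. \<integral>\<^sup>+a'. ennreal ((cmod (\<Gamma> a))\<^sup>2) * ennreal (\<rho> (a - a')) \<partial>lborel \<partial>lborel)
     = (\<integral>\<^sup>+a. ennreal ((cmod (\<Gamma> a))\<^sup>2) * ennreal (1 / (2 * sqrt \<bar>\<zeta>\<bar>)) \<partial>lborel)"
    by (simp add: nn_integral_cmult nn_integral_lborel_shift(2)[of "\<lambda>x. ennreal (\<rho> x)"] \<rho>i)
  also have "(\<integral>\<^sup>+a'. \<integral>\<^sup>+a. ennreal ((cmod (\<Gamma> a'))\<^sup>2) * ennreal (\<rho> (a - a')) \<partial>lborel \<partial>lborel)
     = (\<integral>\<^sup>+a. ennreal ((cmod (\<Gamma> a))\<^sup>2) * ennreal (1 / (2 * sqrt \<bar>\<zeta>\<bar>)) \<partial>lborel)"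
    by (simp add: nn_integral_cmult nn_integral_lborel_shift(1)[of "\<lambda>x. ennreal (\<rho> x)"] \<rho>i)
  also have "(\<integral>\<^sup>+a. ennreal ((cmod (\<Gamma> a))\<^sup>2) * ennreal (1 / (2 * sqrt \<bar>\<zeta>\<bar>)) \<partial>lborel) + (\<integral>\<^sup>+a. ennreal ((cmod (\<Gamma> a))\<^sup>2) * ennreal (1 / (2 * sqrt \<bar>\<zeta>\<bar>)) \<partial>lborel)
    = (\<integral>\<^sup>+a. ennreal (1 / sqrt \<bar>\<zeta>\<bar> * (cmod (\<Gamma> a))\<^sup>2) \<partial>lborel)"
  proof (subst nn_integral_add[symmetric])
    have "ennreal x * ennreal (1 / (2 * q)) + ennreal x * ennreal (1 / (2 * q)) = ennreal (1 / q * x)"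
      if "x \<ge> 0" "q > 0" for x q :: real
      using that by (simp flip: ennreal_mult' ennreal_plus)
    then show "(\<integral>\<^sup>+a. ennreal ((cmod (\<Gamma> a))\<^sup>2) * ennreal (1 / (2 * sqrt \<bar>\<zeta>\<bar>)) + ennreal ((cmod (\<Gamma> a))\<^sup>2) * ennreal (1 / (2 * sqrt \<bar>\<zeta>\<bar>)) \<partial>lborel)
      = (\<integral>\<^sup>+a. ennreal (1 / sqrt \<bar>\<zeta>\<bar> * (cmod (\<Gamma> a))\<^sup>2) \<partial>lborel)"
      using z by (intro nn_integral_cong) simp
  qed measurable
  also have "\<dots> = ennreal (1 / sqrt \<bar>\<zeta>\<bar> * (LINT a|lborel. (cmod (\<Gamma> a))\<^sup>2))"
    using \<Gamma>2 by (subst nn_integral_eq_integral) auto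
  finally show "(LINT u|lborel. (cmod (S u))\<^sup>2) \<le> 1 / sqrt \<bar>\<zeta>\<bar> * (LINT a|lborel. (cmod (\<Gamma> a))\<^sup>2)"
    by (subst (asm) ennreal_le_iff) auto
qed

section \<open>The estimate for one frequency scale\<close>

text \<open>The shear separates the variables in the last integral, which makes that identity exact.
  The bound \<open>B\<close> ensures square integrability for every \<open>z\<close>, not merely for
  almost every one, and does not appear in the norms obtained.\<close>

lemma autocorrelation:
  fixes f :: "real \<Rightarrow> complex"
  assumes [measurable]: "f \<in> borel_measurable borel" and f2: "integrable lborel (\<lambda>x. (cmod (f x))\<^sup>2)"
    and B: "\<And>x. cmod (f x) \<le> B"
  shows "integrable lborel (\<lambda>a. f a * cnj (f (a - z)))"
    and "(LINT a|lborel. cmod (f a * cnj (f (a - z)))) \<le> (LINT x|lborel. (cmod (f x))\<^sup>2)"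
    and "integrable lborel (\<lambda>a. (cmod (f a * cnj (f (a - z))))\<^sup>2)"
    and "integrable lborel (\<lambda>z. LINT a|lborel. (cmod (f a * cnj (f (a - z))))\<^sup>2)"
    and "(LINT z|lborel. LINT a|lborel. (cmod (f a * cnj (f (a - z))))\<^sup>2) = (LINT x|lborel. (cmod (f x))\<^sup>2)\<^sup>2"
proof -
  have f2': "integrable lborel (\<lambda>a. (cmod (f (a - z)))\<^sup>2)"
    using f2 by (subst lborel_integrable_shift(3))
  have m: "f \<in> borel_measurable lborel" "(\<lambda>a. f (a - z)) \<in> borel_measurable lborel" by measurable
  note CS = L2_Cauchy_Schwarz[OF m f2 f2']
  show "integrable lborel (\<lambda>a. f a * cnj (f (a - z)))"
    by (rule Bochner_Integration.integrable_bound[OF CS(1)]) (auto simp: norm_mult)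
  have "(LINT a|lborel. (cmod (f (a - z)))\<^sup>2) = (LINT x|lborel. (cmod (f x))\<^sup>2)"
    by (rule lborel_integral_shift(3))
  then show "(LINT a|lborel. cmod (f a * cnj (f (a - z)))) \<le> (LINT x|lborel. (cmod (f x))\<^sup>2)"
    using CS(2) by (simp add: norm_mult)
  have B0: "B \<ge> 0" using norm_ge_zero B order_trans by blast
  show "integrable lborel (\<lambda>a. (cmod (f a * cnj (f (a - z))))\<^sup>2)"
  proof (rule Bochner_Integration.integrable_bound)
    show "integrable lborel (\<lambda>a. (cmod (f a))\<^sup>2 * B\<^sup>2)" using f2 by simp
    show "AE a in lborel. norm ((cmod (f a * cnj (f (a - z))))\<^sup>2) \<le> norm ((cmod (f a))\<^sup>2 * B\<^sup>2)"
      using B by (auto simp: norm_mult power_mult_distrib intro!: mult_left_mono power_mono)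
  qed measurable
  define D where "D p = (cmod (f (fst p)))\<^sup>2 * (cmod (f (snd p)))\<^sup>2" for p :: "real \<times> real"
  have D: "integrable (lborel \<Otimes>\<^sub>M lborel) D"
    by (rule lborel_pair.integrable_pair_bound[OF _ f2 f2]) (auto simp: D_def[abs_def])
  have eq: "(cmod (f a * cnj (f (a - z))))\<^sup>2 = D (a, a - z)" for a z
    by (simp add: D_def norm_mult power_mult_distrib)
  show "integrable lborel (\<lambda>z. LINT a|lborel. (cmod (f a * cnj (f (a - z))))\<^sup>2)"
    unfolding eq by (rule shear_integral(1)[OF D])
  have "(LINT z|lborel. LINT a|lborel. (cmod (f a * cnj (f (a - z))))\<^sup>2) = integral\<^sup>L (lborel \<Otimes>\<^sub>M lborel) D"
    unfolding eq by (rule shear_integral(2)[OF D])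
  also have "\<dots> = (LINT a|lborel. LINT b|lborel. D (a, b))"
    by (rule lborel_pair.integral_fst'[OF D, symmetric])
  also have "\<dots> = (LINT x|lborel. (cmod (f x))\<^sup>2)\<^sup>2"
    by (simp add: D_def power2_eq_square)
  finally show "(LINT z|lborel. LINT a|lborel. (cmod (f a * cnj (f (a - z))))\<^sup>2) = (LINT x|lborel. (cmod (f x))\<^sup>2)\<^sup>2" .
qed

text \<open>One dyadic block: \<open>s\<close> is the sign of its frequencies and \<open>N\<close>
  their size. The bound \<open>B\<close> secures absolute convergence; the estimate in
  \<open>mult_form_L2\<close> is free of it.\<close>

locale frequency_piece =
  fixes g \<phi> :: "real \<Rightarrow> complex" and s N B :: real
  assumes s: "\<bar>s\<bar> = 1" and N: "N \<ge> 1"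
    and g: "integrable lborel g" and g2: "integrable lborel (\<lambda>x. (cmod (g x))\<^sup>2)" and gB: "\<And>x. cmod (g x) \<le> B"
    and supp: "\<And>a. g a \<noteq> 0 \<Longrightarrow> N \<le> s * a \<and> s * a \<le> 2 * N"
    and \<phi>m: "\<phi> \<in> borel_measurable borel" and \<phi>2: "integrable lborel (\<lambda>x. (cmod (\<phi> x))\<^sup>2)" and \<phi>B: "\<And>x. cmod (\<phi> x) \<le> B"
begin

lemma gm [measurable]: "g \<in> borel_measurable borel" using g by auto
lemma pm [measurable]: "\<phi> \<in> borel_measurable borel" by (rule \<phi>m)

definition "\<Gamma> z a = g a * cnj (g (a - z))"
definition "\<Phi> z u = \<phi> u * cnj (\<phi> (u - z))"
text \<open>The contribution of the difference \<open>z\<close> of two frequencies to the squared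
  norm of \<open>S\<close>; the identity is \<open>S_H\<close>.\<close>

definition "H z = (LINT u|lborel. \<Phi> z u * (LINT a|lborel. \<Gamma> z a * gkernel z a u))"
definition "G2 = (LINT x|lborel. (cmod (g x))\<^sup>2)"
definition "P2 = (LINT x|lborel. (cmod (\<phi> x))\<^sup>2)"

lemmas \<Gamma>_facts = autocorrelation[OF gm g2 gB, folded \<Gamma>_def G2_def]
lemmas \<Phi>_facts = autocorrelation[OF pm \<phi>2 \<phi>B, folded \<Phi>_def P2_def]

lemma mGP [measurable (raw)]:
  assumes [measurable]: "f \<in> borel_measurable M" "h \<in> borel_measurable M"
  shows "(\<lambda>x. \<Gamma> (f x) (h x)) \<in> borel_measurable M" "(\<lambda>x. \<Phi> (f x) (h x)) \<in> borel_measurable M"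
  unfolding \<Gamma>_def \<Phi>_def by measurable

lemma nonneg: "G2 \<ge> 0" "P2 \<ge> 0" by (simp_all add: G2_def P2_def)

lemma \<Gamma>_supp: "\<Gamma> z a \<noteq> 0 \<Longrightarrow> N \<le> s * a \<and> s * a \<le> 2 * N \<and> N \<le> s * (a - z)"
  using supp[of a] supp[of "a - z"] by (auto simp: \<Gamma>_def)

lemma abs_supp: "g a \<noteq> 0 \<Longrightarrow> N \<le> \<bar>a\<bar> \<and> \<bar>a\<bar> \<le> 2 * N"
proof -
  assume "g a \<noteq> 0"
  moreover have "\<bar>a\<bar> = \<bar>s * a\<bar>" using s by (simp add: abs_mult)
  ultimately show ?thesis using supp[of a] N by linarith
qed

section \<open>Two bounds for a fixed difference of frequencies\<close>

lemma kernel_small: 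
  assumes "\<Gamma> z a \<noteq> 0" shows "cmod (gkernel z a u) \<le> 1 / (2 * N)"
proof -
  have a: "N \<le> \<bar>a\<bar>" "N \<le> \<bar>a - z\<bar>"
    using assms abs_supp[of a] abs_supp[of "a - z"] by (auto simp: \<Gamma>_def)
  have 1: "(cmod (gmult b \<xi>))\<^sup>2 \<le> 1 / (2 * N)" if "N \<le> \<bar>b\<bar>" for b \<xi>
  proof -
    have "(cmod (gmult b \<xi>))\<^sup>2 \<le> 1 / (2 * \<bar>b\<bar>)" using that N by (intro norm_gmult_le(3)) auto
    also have "\<dots> \<le> 1 / (2 * N)" using that N by (intro divide_left_mono) auto
    finally show ?thesis .
  qed
  have "2 * cmod (gmult a (u - a)) * cmod (gmult (a - z) (u - a)) \<le> 1 / (2 * N) + 1 / (2 * N)"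
    using sum_squares_bound[of "cmod (gmult a (u - a))" "cmod (gmult (a - z) (u - a))"]
      1[OF a(1), of "u - a"] 1[OF a(2), of "u - a"] by linarith
  then show ?thesis by (simp add: gkernel_def norm_mult)
qed

lemma \<Gamma>k_int: "integrable lborel (\<lambda>a. \<Gamma> z a * gkernel z a u)"
  "cmod (LINT a|lborel. \<Gamma> z a * gkernel z a u) \<le> 1 / (2 * N) * G2"
proof -
  have le: "cmod (\<Gamma> z a * gkernel z a u) \<le> 1 / (2 * N) * cmod (\<Gamma> z a)" for a
    using mult_left_mono[OF kernel_small[of z a u], of "cmod (\<Gamma> z a)"] by (cases "\<Gamma> z a = 0") (auto simp: norm_mult)
  have i: "integrable lborel (\<lambda>a. 1 / (2 * N) * cmod (\<Gamma> z a))"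
    using \<Gamma>_facts(1)[of z] by (intro integrable_mult_right integrable_norm)
  show I: "integrable lborel (\<lambda>a. \<Gamma> z a * gkernel z a u)"
    by (rule Bochner_Integration.integrable_bound[OF i])
      (simp, rule AE_I2, rule order_trans[OF le], simp only: real_norm_def abs_ge_self)
  have "cmod (LINT a|lborel. \<Gamma> z a * gkernel z a u) \<le> (LINT a|lborel. cmod (\<Gamma> z a * gkernel z a u))"
    by simp
  also have "\<dots> \<le> (LINT a|lborel. 1 / (2 * N) * cmod (\<Gamma> z a))"
    using I i le by (intro integral_mono) auto
  also have "\<dots> \<le> 1 / (2 * N) * G2"
    using \<Gamma>_facts(2)[of z] N by (simp add: divide_right_mono)
  finally show "cmod (LINT a|lborel. \<Gamma> z a * gkernel z a u) \<le> 1 / (2 * N) * G2" .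
qed

lemma mS [measurable]: "(\<lambda>u. LINT a|lborel. \<Gamma> z a * gkernel z a u) \<in> borel_measurable borel"
  by measurable

text \<open>The sup bound for the kernel meets the \<open>L\<^sup>1\<close> norms of both
  autocorrelations. Nothing decays in \<open>z\<close>, so this will be integrated over a bounded
  range only.\<close>

lemma H_small: "cmod (H z) \<le> 1 / (2 * N) * G2 * P2"
proof -
  have le: "cmod (\<Phi> z u * (LINT a|lborel. \<Gamma> z a * gkernel z a u)) \<le> 1 / (2 * N) * G2 * cmod (\<Phi> z u)" for u
    using mult_left_mono[OF \<Gamma>k_int(2)[of z u], of "cmod (\<Phi> z u)"] by (simp add: norm_mult mult_ac)
  have i: "integrable lborel (\<lambda>u. 1 / (2 * N) * G2 * cmod (\<Phi> z u))"
    using \<Phi>_facts(1)[of z] by (intro integrable_mult_right integrable_norm)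
  have I: "integrable lborel (\<lambda>u. \<Phi> z u * (LINT a|lborel. \<Gamma> z a * gkernel z a u))"
    by (rule Bochner_Integration.integrable_bound[OF i])
      (simp, rule AE_I2, rule order_trans[OF le], simp only: real_norm_def abs_ge_self)
  have "cmod (H z) \<le> (LINT u|lborel. cmod (\<Phi> z u * (LINT a|lborel. \<Gamma> z a * gkernel z a u)))"
    unfolding H_def by simp
  also have "\<dots> \<le> (LINT u|lborel. 1 / (2 * N) * G2 * cmod (\<Phi> z u))"
    using I i le by (intro integral_mono) auto
  also have "\<dots> \<le> 1 / (2 * N) * G2 * P2"
    using \<Phi>_facts(2)[of z] N nonneg
    unfolding integral_mult_right_zero by (intro mult_left_mono) auto
  finally show ?thesis .
qed

text \<open>Cauchy-Schwarz in \<open>u\<close> separates \<open>\<Phi>\<close> from the inner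
  integral, which \<open>gkernel_L2_bound\<close> controls; the root turns the power -1/2 of
  \<open>\<bar>z\<bar>\<close> into -1/4. The remaining norms are kept, since their product is
  integrable in \<open>z\<close>.\<close>

lemma H_large:
  assumes z: "z \<noteq> 0"
  shows "cmod (H z) \<le> (1 / sqrt (sqrt \<bar>z\<bar>)) * (sqrt (LINT u|lborel. (cmod (\<Phi> z u))\<^sup>2) * sqrt (LINT a|lborel. (cmod (\<Gamma> z a))\<^sup>2))"
proof -
  have N0: "0 < N" using N by simp
  let ?S = "\<lambda>u. LINT a|lborel. \<Gamma> z a * gkernel z a u"
  have S: "integrable lborel (\<lambda>u. (cmod (?S u))\<^sup>2)"
    "(LINT u|lborel. (cmod (?S u))\<^sup>2) \<le> 1 / sqrt \<bar>z\<bar> * (LINT a|lborel. (cmod (\<Gamma> z a))\<^sup>2)"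
    using gkernel_L2_bound[OF s N0 z \<Gamma>_facts(1)[of z] \<Gamma>_facts(3)[of z]] \<Gamma>_supp by blast+
  have m: "\<Phi> z \<in> borel_measurable lborel" "?S \<in> borel_measurable lborel" by simp_all
  note CS = L2_Cauchy_Schwarz[OF m \<Phi>_facts(3)[of z] S(1)]
  have "cmod (H z) \<le> (LINT u|lborel. cmod (\<Phi> z u * ?S u))"
    unfolding H_def by simp
  also have "\<dots> \<le> sqrt (LINT u|lborel. (cmod (\<Phi> z u))\<^sup>2) * sqrt (LINT u|lborel. (cmod (?S u))\<^sup>2)"
    using CS(2) by (simp only: norm_mult)
  also have "\<dots> \<le> sqrt (LINT u|lborel. (cmod (\<Phi> z u))\<^sup>2) * sqrt (1 / sqrt \<bar>z\<bar> * (LINT a|lborel. (cmod (\<Gamma> z a))\<^sup>2))"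
    using S(2) by (intro mult_left_mono real_sqrt_le_mono) auto
  finally show ?thesis by (simp add: real_sqrt_mult real_sqrt_divide mult_ac)
qed

section \<open>The squared form as an integral over differences of frequencies\<close>

definition "S \<xi> = (LINT a|lborel. g a * \<phi> (a + \<xi>) * gmult a \<xi>)"
definition "F \<xi> p = (g (fst p) * \<phi> (fst p + \<xi>) * gmult (fst p) \<xi>) * cnj (g (snd p) * \<phi> (snd p + \<xi>) * gmult (snd p) \<xi>)"

lemma B0: "B \<ge> 0" using norm_ge_zero gB order_trans by blast

text \<open>The width of the Gaussian bound for \<open>gmult\<close> is replaced by its largest
  value on the block.\<close>

lemma gp_le: "cmod (g a * \<phi> (a + \<xi>) * gmult a \<xi>) \<le> B * cmod (g a) * exp (- (pi / (1 + 16 * N\<^sup>2) * \<xi>\<^sup>2))"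
proof (cases "g a = 0")
  case False
  have "a\<^sup>2 \<le> (2 * N)\<^sup>2" using abs_supp[OF False] N by (intro abs_le_square_iff[THEN iffD1]) auto
  then have "pi * \<xi>\<^sup>2 / (1 + 16 * N\<^sup>2) \<le> pi * \<xi>\<^sup>2 / (1 + 4 * a\<^sup>2)"
    by (intro divide_left_mono mult_pos_pos) (auto simp: add_pos_nonneg power_mult_distrib)
  then have 1: "exp (- (pi * \<xi>\<^sup>2 / (1 + 4 * a\<^sup>2))) \<le> exp (- (pi / (1 + 16 * N\<^sup>2) * \<xi>\<^sup>2))"
    by simp
  have 2: "cmod (gmult a \<xi>) \<le> exp (- (pi / (1 + 16 * N\<^sup>2) * \<xi>\<^sup>2))"
    by (rule order_trans[OF norm_gmult_le(1) 1])
  have "cmod (g a * \<phi> (a + \<xi>) * gmult a \<xi>) \<le> cmod (g a) * B * exp (- (pi / (1 + 16 * N\<^sup>2) * \<xi>\<^sup>2))"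
    unfolding norm_mult using B0 by (intro mult_mono \<phi>B 2) auto
  then show ?thesis by (simp add: mult_ac)
qed simp

lemma gp_int: "integrable lborel (\<lambda>a. g a * \<phi> (a + \<xi>) * gmult a \<xi>)"
proof (rule Bochner_Integration.integrable_bound)
  show "integrable lborel (\<lambda>a. B * cmod (g a) * exp (- (pi / (1 + 16 * N\<^sup>2) * \<xi>\<^sup>2)))"
    using g by (intro integrable_mult_left integrable_mult_right integrable_norm)
qed (simp, rule AE_I2, rule order_trans[OF gp_le], simp only: real_norm_def abs_ge_self)

lemma F_int: "integrable (lborel \<Otimes>\<^sub>M lborel) (\<lambda>(\<xi>, p). F \<xi> p)"
proof (rule lborel_pair.integrable_pair_bound)
  show "(\<lambda>(\<xi>, p). F \<xi> p) \<in> borel_measurable (lborel \<Otimes>\<^sub>M lborel)"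
    unfolding F_def lborel_prod[symmetric] by measurable
  show "integrable lborel (\<lambda>\<xi>. B\<^sup>2 * exp (- (pi / (1 + 16 * N\<^sup>2) * \<xi>\<^sup>2)))"
    by (intro integrable_mult_right gaussian_integrable_real) (simp add: add_pos_nonneg)
  show "integrable lborel (\<lambda>p. cmod (g (fst p) * g (snd p)))"
    by (rule integrable_norm[OF integral_pair_mult(1)[OF g g]])
  show "cmod (case (\<xi>, p) of (\<xi>, p) \<Rightarrow> F \<xi> p) \<le> B\<^sup>2 * exp (- (pi / (1 + 16 * N\<^sup>2) * \<xi>\<^sup>2)) * cmod (g (fst p) * g (snd p))" for \<xi> p
  proof -
    \<comment> \<open>Decay in \<open>\<xi>\<close> is taken from one factor only; in the other the
      exponential is replaced by 1.\<close>
    have 2: "cmod (g (snd p) * \<phi> (snd p + \<xi>) * gmult (snd p) \<xi>) \<le> B * cmod (g (snd p)) * 1"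
      by (rule order_trans[OF gp_le], intro mult_left_mono) (use B0 in auto)
    have "cmod (F \<xi> p) \<le> (B * cmod (g (fst p)) * exp (- (pi / (1 + 16 * N\<^sup>2) * \<xi>\<^sup>2))) * (B * cmod (g (snd p)) * 1)"
      unfolding F_def norm_mult[of "_ * _ * gmult _ _" "cnj _"] complex_mod_cnj
      by (rule mult_mono[OF gp_le 2]) (use B0 in auto)
    then show ?thesis by (simp add: norm_mult power2_eq_square mult_ac)
  qed
qed

lemma S_F: "of_real ((cmod (S \<xi>))\<^sup>2) = (LINT p|lborel. F \<xi> p)"
proof -
  have "of_real ((cmod (S \<xi>))\<^sup>2) = S \<xi> * cnj (S \<xi>)" by (simp only: complex_norm_square)
  also have "cnj (S \<xi>) = (LINT a|lborel. cnj (g a * \<phi> (a + \<xi>) * gmult a \<xi>))"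
    unfolding S_def by (rule Bochner_Integration.integral_cnj[symmetric])
  also have "S \<xi> * \<dots> = (LINT p|lborel. F \<xi> p)"
    unfolding S_def F_def by (rule integral_pair_mult(2)[symmetric, OF gp_int integrable_cnj[OF gp_int]])
  finally show ?thesis .
qed

lemma S_int: "integrable lborel (\<lambda>\<xi>. (cmod (S \<xi>))\<^sup>2)"
proof -
  have "integrable lborel (\<lambda>\<xi>. complex_of_real ((cmod (S \<xi>))\<^sup>2))"
    unfolding S_F using lborel_pair.integrable_fst'[OF F_int] by simp
  then show ?thesis by (simp only: complex_of_real_integrable_eq)
qed

text \<open>For fixed frequencies the integral in \<open>\<xi>\<close> comes first; the shear passes
  to their difference \<open>z\<close>, and the substitution \<open>u = a + \<xi>\<close> regroups
  the factors as \<open>\<Gamma>\<close>, \<open>\<Phi>\<close> and \<open>gkernel\<close>. A final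
  exchange puts the integral over \<open>a\<close> inside, where \<open>gkernel_L2_bound\<close>
  applies.\<close>

lemma S_H: "of_real (LINT \<xi>|lborel. (cmod (S \<xi>))\<^sup>2) = (LINT z|lborel. H z)"
proof -
  define D where "D p = (LINT \<xi>|lborel. F \<xi> p)" for p
  have D: "integrable (lborel \<Otimes>\<^sub>M lborel) D"
    using lborel_pair.integrable_snd[OF F_int] unfolding D_def[symmetric] lborel_prod .
  have DH: "(LINT a|lborel. D (a, a - z)) = H z" for z
  proof -
    have "D (a, a - z) = (LINT u|lborel. \<Gamma> z a * \<Phi> z u * gkernel z a u)" for a
    proof -
      have "D (a, a - z) = (LINT u|lborel. F (u - a) (a, a - z))"
        unfolding D_def by (rule lborel_integral_shift(3)[symmetric])
      also have "\<dots> = (LINT u|lborel. \<Gamma> z a * \<Phi> z u * gkernel z a u)"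
        by (intro Bochner_Integration.integral_cong refl)
          (simp add: F_def \<Gamma>_def \<Phi>_def gkernel_def mult_ac diff_add_eq_diff_diff_swap[symmetric] add_diff_eq diff_add_eq)
      finally show ?thesis .
    qed
    then have "(LINT a|lborel. D (a, a - z)) = (LINT a|lborel. LINT u|lborel. \<Gamma> z a * \<Phi> z u * gkernel z a u)"
      by simp
    also have "\<dots> = (LINT u|lborel. LINT a|lborel. \<Gamma> z a * \<Phi> z u * gkernel z a u)"
    proof (rule lborel_pair.Fubini_integral[symmetric])
      have le1: "cmod (gkernel z a u) \<le> 1" for a u
        using mult_mono[OF norm_gmult_le(2)[of a "u - a"] norm_gmult_le(2)[of "a - z" "u - a"]]
        by (simp add: gkernel_def norm_mult)
      show "integrable (lborel \<Otimes>\<^sub>M lborel) (\<lambda>(a, u). \<Gamma> z a * \<Phi> z u * gkernel z a u)"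
        by (rule lborel_pair.integrable_pair_bound[OF _ integrable_norm[OF \<Gamma>_facts(1)[of z]] integrable_norm[OF \<Phi>_facts(1)[of z]]])
          (use le1 in \<open>auto simp: norm_mult intro!: mult_left_le\<close>)
    qed
    also have "\<dots> = H z"
      unfolding H_def integral_mult_right_zero[symmetric] by (simp add: mult_ac)
    finally show ?thesis .
  qed
  have "of_real (LINT \<xi>|lborel. (cmod (S \<xi>))\<^sup>2) = (LINT \<xi>|lborel. complex_of_real ((cmod (S \<xi>))\<^sup>2))"
    by (simp only: integral_complex_of_real)
  also have "\<dots> = (LINT \<xi>|lborel. LINT p|lborel. F \<xi> p)"
    by (simp only: S_F)
  also have "\<dots> = (LINT p|lborel. D p)"
    unfolding D_def by (rule lborel_pair.Fubini_integral[OF F_int, symmetric])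
  also have "\<dots> = (LINT z|lborel. LINT a|lborel. D (a, a - z))"
    using shear_integral(2)[OF D] unfolding lborel_prod by (rule sym)
  finally show ?thesis unfolding DH .
qed

lemma mult_form_L2:
  shows "integrable lborel (\<lambda>\<xi>. (cmod (LINT a|lborel. g a * \<phi> (a + \<xi>) * gmult a \<xi>))\<^sup>2)"
    and "(LINT \<xi>|lborel. (cmod (LINT a|lborel. g a * \<phi> (a + \<xi>) * gmult a \<xi>))\<^sup>2)
      \<le> 2 * N powr (-1/8) * (LINT x|lborel. (cmod (g x))\<^sup>2) * (LINT x|lborel. (cmod (\<phi> x))\<^sup>2)"
proof -
  show "integrable lborel (\<lambda>\<xi>. (cmod (LINT a|lborel. g a * \<phi> (a + \<xi>) * gmult a \<xi>))\<^sup>2)"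
    using S_int unfolding S_def .
  define X where "X z = sqrt (LINT u|lborel. (cmod (\<Phi> z u))\<^sup>2)" for z
  define Y where "Y z = sqrt (LINT a|lborel. (cmod (\<Gamma> z a))\<^sup>2)" for z
  have X2: "(norm (X z))\<^sup>2 = (LINT u|lborel. (cmod (\<Phi> z u))\<^sup>2)"
    and Y2: "(norm (Y z))\<^sup>2 = (LINT a|lborel. (cmod (\<Gamma> z a))\<^sup>2)" for z
    by (simp_all add: X_def Y_def)
  have m: "X \<in> borel_measurable lborel" "Y \<in> borel_measurable lborel"
    using borel_measurable_integrable[OF \<Gamma>_facts(4)] borel_measurable_integrable[OF \<Phi>_facts(4)] unfolding X_def[abs_def] Y_def[abs_def] by simp_all
  \<comment> \<open>Cauchy-Schwarz in \<open>z\<close>; by the exact identity for autocorrelations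
    the total mass of \<open>X z * Y z\<close> is at most \<open>P2 * G2\<close>.\<close>
  note XY = L2_Cauchy_Schwarz[OF m, unfolded X2 Y2, OF \<Phi>_facts(4) \<Gamma>_facts(4), unfolded \<Phi>_facts(5) \<Gamma>_facts(5)]
  \<comment> \<open>the threshold between \<open>H_small\<close> and \<open>H_large\<close>\<close>
  define \<zeta> where "\<zeta> = sqrt N"
  have z: "\<zeta> \<ge> 1" using N by (simp add: \<zeta>_def)
  define c1 where "c1 = 1 / (2 * N) * G2 * P2"
  define c2 where "c2 = 1 / sqrt (sqrt \<zeta>)"
  have c: "c1 \<ge> 0" "c2 \<ge> 0" using N nonneg z by (auto simp: c1_def c2_def)
  have Hb: "cmod (H z) \<le> c1 * indicator {-\<zeta>..\<zeta>} z + c2 * (norm (X z) * norm (Y z))" for z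
  proof (cases "z \<in> {-\<zeta>..\<zeta>}")
    case True
    then show ?thesis using H_small[of z] c by (simp add: c1_def add_increasing2)
  next
    case False
    then have "\<zeta> \<le> \<bar>z\<bar>" by auto
    then have "1 / sqrt (sqrt \<bar>z\<bar>) \<le> c2" unfolding c2_def using z by (intro divide_left_mono) auto
    then have "cmod (H z) \<le> c2 * (X z * Y z)"
      using H_large[of z] \<open>\<zeta> \<le> \<bar>z\<bar>\<close> z unfolding X_def[symmetric] Y_def[symmetric]
      by (intro order_trans[OF H_large mult_right_mono, folded X_def Y_def]) (auto simp: X_def Y_def)
    then show ?thesis using False by (simp add: X_def Y_def)
  qed
  have i1: "integrable lborel (\<lambda>z. c1 * indicator {-\<zeta>..\<zeta>} z :: real)"
    by (intro integrable_mult_right integrable_real_indicator) (auto simp: emeasure_lborel_Icc_eq)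
  have i: "integrable lborel (\<lambda>z. c1 * indicator {-\<zeta>..\<zeta>} z + c2 * (norm (X z) * norm (Y z)))"
    by (rule Bochner_Integration.integrable_add[OF i1 integrable_mult_right[OF XY(1)]])
  have S0: "(LINT \<xi>|lborel. (cmod (S \<xi>))\<^sup>2) \<ge> 0" by simp
  then have "(LINT \<xi>|lborel. (cmod (S \<xi>))\<^sup>2) = cmod (LINT z|lborel. H z)"
    unfolding S_H[symmetric] norm_of_real by simp
  also have "\<dots> \<le> (LINT z|lborel. c1 * indicator {-\<zeta>..\<zeta>} z + c2 * (norm (X z) * norm (Y z)))"
  proof (rule Bochner_Integration.integral_norm_bound_integral[OF _ i])
    show "cmod (H z) \<le> c1 * indicator {-\<zeta>..\<zeta>} z + c2 * (norm (X z) * norm (Y z))" for z by (rule Hb)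
    have "H \<in> borel_measurable lborel" unfolding H_def[abs_def] by measurable
    then show "integrable lborel H"
      by (rule Bochner_Integration.integrable_bound[OF i]) (rule AE_I2, rule order_trans[OF Hb], simp only: real_norm_def abs_ge_self)
  qed
  also have "\<dots> = c1 * (2 * \<zeta>) + c2 * (LINT z|lborel. norm (X z) * norm (Y z))"
    using i1 XY(1) z by (subst Bochner_Integration.integral_add) auto
  also have "\<dots> \<le> c1 * (2 * \<zeta>) + c2 * (P2 * G2)"
    using XY(2) c nonneg by (intro add_left_mono mult_left_mono) auto
  also have "\<dots> = (\<zeta> / N + c2) * G2 * P2" using N by (simp add: c1_def field_simps)
  \<comment> \<open>The range of small differences yields the better power -1/2 of \<open>N\<close>;
    it is weakened to the power -1/8 of the other range, whence the factor 2.\<close>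
  also have "\<dots> \<le> (2 * N powr (-1/8)) * G2 * P2"
  proof -
    have s1: "\<zeta> = N powr (1/2)" using N by (simp add: \<zeta>_def powr_half_sqrt)
    have "sqrt (sqrt \<zeta>) = N powr (1/8)" using N z by (simp add: s1 powr_half_sqrt[symmetric] powr_powr)
    then have s2: "c2 = N powr (-1/8)" using N by (simp add: c2_def powr_minus_divide)
    have "\<zeta> / N = N powr (1/2 - 1)" using N unfolding s1 by (subst powr_diff) auto
    also have "\<dots> \<le> N powr (-1/8)" using N by (intro powr_mono) auto
    finally show ?thesis using s2 nonneg by (intro mult_right_mono) auto
  qed
  finally show "(LINT \<xi>|lborel. (cmod (LINT a|lborel. g a * \<phi> (a + \<xi>) * gmult a \<xi>))\<^sup>2)
      \<le> 2 * N powr (-1/8) * (LINT x|lborel. (cmod (g x))\<^sup>2) * (LINT x|lborel. (cmod (\<phi> x))\<^sup>2)"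
    unfolding S_def G2_def P2_def .
qed

end

section \<open>The Fourier transform of integrable functions\<close>

lemma borel_measurable_cis [measurable (raw)]:
  assumes [measurable]: "f \<in> borel_measurable M"
  shows "(\<lambda>x. cis (f x)) \<in> borel_measurable M"
  using measurable_compose[OF assms borel_measurable_continuous_onI[OF continuous_on_cis[OF continuous_on_id]]]
  by simp

text \<open>Fubini in the form used throughout: a factor given by an inverse Fourier integral is
  exchanged for its spectrum \<open>G\<close>. Domain and phase \<open>\<rho>\<close> are general
  because on pairs \<open>(x, t)\<close> it is applied with the phases \<open>t\<close>,
  \<open>x + t\<close> and \<open>x + t\<^sup>2\<close>.\<close>

lemma fourier_swap:
  fixes k :: "'a::euclidean_space \<Rightarrow> complex" and \<rho> :: "'a \<Rightarrow> real" and G :: "real \<Rightarrow> complex"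
  assumes k: "integrable lborel k" and G: "integrable lborel G" and [measurable]: "\<rho> \<in> borel_measurable borel"
  shows "integrable lborel (\<lambda>\<xi>. G \<xi> * (LINT w|lborel. k w * cis (2 * pi * \<rho> w * \<xi>)))"
    and "(LINT w|lborel. k w * (LINT \<xi>|lborel. G \<xi> * cis (2 * pi * \<rho> w * \<xi>)))
       = (LINT \<xi>|lborel. G \<xi> * (LINT w|lborel. k w * cis (2 * pi * \<rho> w * \<xi>)))"
proof -
  have [measurable]: "k \<in> borel_measurable borel" "G \<in> borel_measurable borel" using k G by auto
  have I: "integrable (lborel \<Otimes>\<^sub>M lborel) (\<lambda>(w, \<xi>). k w * (G \<xi> * cis (2 * pi * \<rho> w * \<xi>)))"
    by (rule lborel_pair.integrable_pair_bound[OF _ integrable_norm[OF k] integrable_norm[OF G]])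
      (auto simp: norm_mult)
  have eq: "(LINT w|lborel. k w * (G \<xi> * cis (2 * pi * \<rho> w * \<xi>))) = G \<xi> * (LINT w|lborel. k w * cis (2 * pi * \<rho> w * \<xi>))" for \<xi>
    unfolding integral_mult_right_zero[symmetric] by (simp add: mult_ac)
  show "integrable lborel (\<lambda>\<xi>. G \<xi> * (LINT w|lborel. k w * cis (2 * pi * \<rho> w * \<xi>)))"
    unfolding eq[symmetric] using lborel_pair.integrable_snd[OF I] .
  show "(LINT w|lborel. k w * (LINT \<xi>|lborel. G \<xi> * cis (2 * pi * \<rho> w * \<xi>)))
       = (LINT \<xi>|lborel. G \<xi> * (LINT w|lborel. k w * cis (2 * pi * \<rho> w * \<xi>)))"
  proof -
    have eq2: "k w * (LINT \<xi>|lborel. G \<xi> * cis (2 * pi * \<rho> w * \<xi>)) = (LINT \<xi>|lborel. k w * (G \<xi> * cis (2 * pi * \<rho> w * \<xi>)))" for w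
      by simp
    show ?thesis unfolding eq2 eq[symmetric] by (rule lborel_pair.Fubini_integral[OF I, symmetric])
  qed
qed

text \<open>The transform \<open>fourier\<close> with the Borel measure and \<open>cis\<close>,
  which keeps measurability on products automatic; \<open>fourier_borel\<close> identifies the
  two.\<close>

definition FT :: "(real \<Rightarrow> complex) \<Rightarrow> real \<Rightarrow> complex" where
  "FT f \<xi> = (LINT x|lborel. f x * cis (- (2 * pi * x * \<xi>)))"

lemma borel_measurable_FT [measurable]:
  assumes [measurable]: "f \<in> borel_measurable borel"
  shows "FT f \<in> borel_measurable borel"
  unfolding FT_def[abs_def] by measurable

lemma integrable_mult_cis:
  assumes f: "integrable M f" and [measurable]: "\<theta> \<in> borel_measurable M"
  shows "integrable M (\<lambda>x. f x * cis (\<theta> x))"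
proof -
  have [measurable]: "f \<in> borel_measurable M" using f by auto
  show ?thesis by (rule Bochner_Integration.integrable_bound[OF f]) (auto simp: norm_mult)
qed

lemma norm_FT_le: "cmod (FT f \<xi>) \<le> (LINT x|lborel. cmod (f x))"
proof -
  have "cmod (FT f \<xi>) \<le> (LINT x|lborel. cmod (f x * cis (- (2 * pi * x * \<xi>))))"
    unfolding FT_def by (rule integral_norm_bound)
  then show ?thesis by (simp add: norm_mult)
qed

lemma gauss_FT:
  assumes "\<epsilon> > 0"
  shows "(LINT \<xi>|lborel. of_real (exp (- (pi * \<epsilon>\<^sup>2 * \<xi>\<^sup>2))) * cis (2 * pi * u * \<xi>))
    = of_real (1 / \<epsilon> * exp (- (pi * (u / \<epsilon>)\<^sup>2)))"
proof -
  have "of_real (exp (- (pi * \<epsilon>\<^sup>2 * \<xi>\<^sup>2))) * cis (2 * pi * u * \<xi>) =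
    exp (- (of_real pi * of_real (\<epsilon>\<^sup>2) * of_real \<xi> ^ 2) + 2 * of_real pi * (\<i> * of_real u) * of_real \<xi>)" for \<xi>
    unfolding cis_conv_exp exp_of_real[symmetric] mult_exp_exp
    by (rule arg_cong[where f=exp]) (simp add: algebra_simps)
  then have "(LINT \<xi>|lborel. of_real (exp (- (pi * \<epsilon>\<^sup>2 * \<xi>\<^sup>2))) * cis (2 * pi * u * \<xi>)) =
     exp (of_real pi * (\<i> * of_real u)\<^sup>2 / of_real (\<epsilon>\<^sup>2)) * gauss_const (of_real (\<epsilon>\<^sup>2))"
    using gauss_integral(2)[of "of_real (\<epsilon>\<^sup>2)" "\<i> * of_real u"] assms by simp
  also have "of_real pi * (\<i> * of_real u)\<^sup>2 / of_real (\<epsilon>\<^sup>2) = complex_of_real (- (pi * (u / \<epsilon>)\<^sup>2))"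
    by (simp add: power_mult_distrib power_divide)
  finally show ?thesis using gauss_const_of_real[of "\<epsilon>\<^sup>2"] assms by (simp add: exp_of_real[symmetric])
qed

lemma gauss_integrable_pi: "\<epsilon> \<noteq> 0 \<Longrightarrow> integrable lborel (\<lambda>\<xi>::real. exp (- (pi * \<epsilon>\<^sup>2 * \<xi>\<^sup>2)))"
  by (rule gaussian_integrable_real) simp

lemma gauss_integrable_one: "integrable lborel (\<lambda>v::real. exp (- (pi * v\<^sup>2)))" "(LINT v|lborel. exp (- (pi * v\<^sup>2))) = 1"
  using gaussian_integrable_real[of pi] by simp_all

definition gauss_cutoff :: "real \<Rightarrow> (real \<Rightarrow> complex) \<Rightarrow> real \<Rightarrow> complex" where
  "gauss_cutoff \<epsilon> h \<xi> = FT h \<xi> * of_real (exp (- (pi * \<epsilon>\<^sup>2 * \<xi>\<^sup>2)))"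

text \<open>Convolution with a Gaussian of width \<open>\<epsilon>\<close>, rescaled so that
  \<open>\<epsilon>\<close> sits in the argument of \<open>f\<close>: bounds and limits then involve
  one fixed probability density. For integrable \<open>f\<close> the spectrum is
  \<open>gauss_cutoff\<close>, by \<open>mollify_eq\<close>.\<close>

definition mollify :: "real \<Rightarrow> (real \<Rightarrow> complex) \<Rightarrow> real \<Rightarrow> complex" where
  "mollify \<epsilon> f x = (LINT v|lborel. of_real (exp (- (pi * v\<^sup>2))) * f (x + \<epsilon> * v))"

lemma gauss_cutoff_integrable:
  assumes h: "integrable lborel h" and e: "\<epsilon> > 0"
  shows "integrable lborel (gauss_cutoff \<epsilon> h)"
proof (rule Bochner_Integration.integrable_bound)
  have [measurable]: "h \<in> borel_measurable borel" using h by auto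
  show "gauss_cutoff \<epsilon> h \<in> borel_measurable lborel" unfolding gauss_cutoff_def[abs_def] by measurable
  show "integrable lborel (\<lambda>\<xi>. (LINT x|lborel. cmod (h x)) * exp (- (pi * \<epsilon>\<^sup>2 * \<xi>\<^sup>2)))"
    using e by (intro integrable_mult_right gauss_integrable_pi) simp
  show "AE \<xi> in lborel. cmod (gauss_cutoff \<epsilon> h \<xi>) \<le> norm ((LINT x|lborel. cmod (h x)) * exp (- (pi * \<epsilon>\<^sup>2 * \<xi>\<^sup>2)))"
    using norm_FT_le[of h] by (intro AE_I2) (auto simp: gauss_cutoff_def norm_mult abs_mult intro!: mult_mono)
qed

text \<open>Gaussian summation of the Fourier integral: after Fubini the inner integral is the
  transform of a Gaussian. It holds at every point for every integrable \<open>h\<close>, whose own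
  inversion integral may diverge.\<close>

lemma mollify_eq:
  assumes h: "integrable lborel h" and e: "\<epsilon> > 0"
  shows "mollify \<epsilon> h x = (LINT \<xi>|lborel. gauss_cutoff \<epsilon> h \<xi> * cis (2 * pi * x * \<xi>))"
proof -
  let ?k = "\<lambda>\<xi>. complex_of_real (exp (- (pi * \<epsilon>\<^sup>2 * \<xi>\<^sup>2))) * cis (2 * pi * x * \<xi>)"
  have k: "integrable lborel ?k"
    using e by (intro integrable_mult_cis) (auto simp: complex_of_real_integrable_eq gauss_integrable_pi)
  have "(LINT \<xi>|lborel. gauss_cutoff \<epsilon> h \<xi> * cis (2 * pi * x * \<xi>)) =
     (LINT \<xi>|lborel. ?k \<xi> * (LINT y|lborel. h y * cis (2 * pi * (- \<xi>) * y)))"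
    by (intro Bochner_Integration.integral_cong refl) (simp add: gauss_cutoff_def FT_def mult_ac)
  also have "\<dots> = (LINT y|lborel. h y * (LINT \<xi>|lborel. ?k \<xi> * cis (2 * pi * (- \<xi>) * y)))"
    by (rule fourier_swap(2)[OF k h]) simp
  also have "\<dots> = (LINT y|lborel. h y * of_real (1 / \<epsilon> * exp (- (pi * ((x - y) / \<epsilon>)\<^sup>2))))"
  proof (intro Bochner_Integration.integral_cong refl)
    fix y
    have eq: "?k \<xi> * cis (2 * pi * (- \<xi>) * y) = of_real (exp (- (pi * \<epsilon>\<^sup>2 * \<xi>\<^sup>2))) * cis (2 * pi * (x - y) * \<xi>)" for \<xi>
      by (simp add: mult.assoc cis_mult algebra_simps)
    show "h y * (LINT \<xi>|lborel. ?k \<xi> * cis (2 * pi * (- \<xi>) * y)) = h y * of_real (1 / \<epsilon> * exp (- (pi * ((x - y) / \<epsilon>)\<^sup>2)))"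
      by (simp only: eq gauss_FT[OF e])
  qed
  \<comment> \<open>The substitution \<open>y = x + \<epsilon> * v\<close>, whose Jacobian cancels
    the factor \<open>1 / \<epsilon>\<close>.\<close>
  also have "\<dots> = \<bar>\<epsilon>\<bar> *\<^sub>R (LINT v|lborel. h (x + \<epsilon> * v) * of_real (1 / \<epsilon> * exp (- (pi * ((x - (x + \<epsilon> * v)) / \<epsilon>)\<^sup>2))))"
    using e by (intro lborel_integral_real_affine) simp
  also have "\<dots> = (LINT v|lborel. \<bar>\<epsilon>\<bar> *\<^sub>R (h (x + \<epsilon> * v) * of_real (1 / \<epsilon> * exp (- (pi * ((x - (x + \<epsilon> * v)) / \<epsilon>)\<^sup>2)))))"
    by simp
  also have "\<dots> = mollify \<epsilon> h x"
    unfolding mollify_def using e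
    by (intro Bochner_Integration.integral_cong refl) (simp add: scaleR_conv_of_real)
  finally show ?thesis ..
qed

lemma norm_mollify_le:
  assumes "\<And>x. cmod (f x) \<le> B"
  shows "cmod (mollify \<epsilon> f x) \<le> B"
proof -
  have B: "B \<ge> 0" using assms norm_ge_zero order_trans by blast
  have "cmod (mollify \<epsilon> f x) \<le> (LINT v|lborel. cmod (of_real (exp (- (pi * v\<^sup>2))) * f (x + \<epsilon> * v)))"
    unfolding mollify_def by (rule integral_norm_bound)
  also have "\<dots> \<le> (LINT v|lborel. exp (- (pi * v\<^sup>2)) * B)"
    using assms B gauss_integrable_one(1)
    by (intro integral_mono') (auto simp: norm_mult intro!: mult_left_mono)
  also have "\<dots> = B" by (simp add: gauss_integrable_one(2))
  finally show ?thesis .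
qed

lemma mollify_tendsto:
  assumes f: "continuous_on UNIV f" and B: "\<And>x. cmod (f x) \<le> B" and e: "\<epsilon> \<longlonglongrightarrow> 0"
  shows "(\<lambda>n. mollify (\<epsilon> n) f x) \<longlonglongrightarrow> f x"
proof -
  have [measurable]: "f \<in> borel_measurable borel" using f by (rule borel_measurable_continuous_onI)
  have "(\<lambda>n. mollify (\<epsilon> n) f x) \<longlonglongrightarrow> (LINT v|lborel. of_real (exp (- (pi * v\<^sup>2))) * f x)"
    unfolding mollify_def
  proof (rule integral_dominated_convergence[where w="\<lambda>v. exp (- (pi * v\<^sup>2)) * B"])
    show "integrable lborel (\<lambda>v::real. exp (- (pi * v\<^sup>2)) * B)" using gauss_integrable_one(1) by simp
    show "AE v in lborel. (\<lambda>n. of_real (exp (- (pi * v\<^sup>2))) * f (x + \<epsilon> n * v)) \<longlonglongrightarrow> of_real (exp (- (pi * v\<^sup>2))) * f x"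
    proof (rule AE_I2)
      fix v :: real
      have "(\<lambda>n. x + \<epsilon> n * v) \<longlonglongrightarrow> x + 0 * v" by (intro tendsto_intros e)
      then have "(\<lambda>n. f (x + \<epsilon> n * v)) \<longlonglongrightarrow> f x"
        by (intro continuous_on_tendsto_compose[OF f]) auto
      then show "(\<lambda>n. of_real (exp (- (pi * v\<^sup>2))) * f (x + \<epsilon> n * v)) \<longlonglongrightarrow> of_real (exp (- (pi * v\<^sup>2))) * f x"
        by (intro tendsto_intros)
    qed
    show "AE v in lborel. cmod (of_real (exp (- (pi * v\<^sup>2))) * f (x + \<epsilon> n * v)) \<le> exp (- (pi * v\<^sup>2)) * B" for n
      using B by (auto simp: norm_mult intro!: mult_left_mono)
  qed measurable
  also have "(LINT v|lborel. of_real (exp (- (pi * v\<^sup>2))) * f x) = f x"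
  proof -
    have "(LINT v|lborel. complex_of_real (exp (- (pi * v\<^sup>2)))) = 1"
      using gauss_integrable_one(2) by (simp only: integral_complex_of_real of_real_1)
    then show ?thesis by (simp only: integral_mult_left_zero mult_1_left)
  qed
  finally show ?thesis .
qed

section \<open>The Plancherel inequality and Fourier inversion\<close>

text \<open>Weighted by a Gaussian, the squared norm of \<open>FT f\<close> is the pairing of
  \<open>f\<close> with its mollification. This is at most the squared norm of \<open>f\<close>,
  since a mollification averages translates, and Fatou removes the weight.\<close>

lemma Bessel:
  assumes f: "integrable lborel f" and f2: "integrable lborel (\<lambda>x. (cmod (f x))\<^sup>2)"
  shows "integrable lborel (\<lambda>\<xi>. (cmod (FT f \<xi>))\<^sup>2)"
    and "(LINT \<xi>|lborel. (cmod (FT f \<xi>))\<^sup>2) \<le> (LINT x|lborel. (cmod (f x))\<^sup>2)"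
proof -
  have [measurable]: "f \<in> borel_measurable borel" using f by auto
  define F2 where "F2 = (LINT x|lborel. (cmod (f x))\<^sup>2)"
  have nnF2: "(\<integral>\<^sup>+x. ennreal ((cmod (f x))\<^sup>2) \<partial>lborel) = ennreal F2"
    unfolding F2_def using f2 by (rule nn_integral_eq_integral) simp
  have reg: "(\<integral>\<^sup>+\<xi>. ennreal ((cmod (FT f \<xi>))\<^sup>2 * exp (- (pi * \<epsilon>\<^sup>2 * \<xi>\<^sup>2))) \<partial>lborel) \<le> ennreal F2" if e: "\<epsilon> > 0" for \<epsilon>
  proof -
    let ?J = "\<lambda>\<xi>. (cmod (FT f \<xi>))\<^sup>2 * exp (- (pi * \<epsilon>\<^sup>2 * \<xi>\<^sup>2))"
    note gi = gauss_cutoff_integrable[OF f e]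
    have cf: "integrable lborel (\<lambda>x. cnj (f x))" using f by simp
    have J: "complex_of_real (?J \<xi>) = gauss_cutoff \<epsilon> f \<xi> * (LINT x|lborel. cnj (f x) * cis (2 * pi * \<xi> * x))" for \<xi>
    proof -
      have "(LINT x|lborel. cnj (f x) * cis (2 * pi * \<xi> * x)) = (LINT x|lborel. cnj (f x * cis (- (2 * pi * x * \<xi>))))"
        by (intro Bochner_Integration.integral_cong refl) (simp add: cis_cnj mult_ac)
      also have "\<dots> = cnj (FT f \<xi>)" unfolding FT_def by (rule Bochner_Integration.integral_cnj)
      finally show ?thesis
        using complex_norm_square[of "FT f \<xi>"] by (simp add: gauss_cutoff_def mult_ac)
    qed
    have Ji: "integrable lborel ?J"
    proof (rule Bochner_Integration.integrable_bound)
      show "integrable lborel (\<lambda>\<xi>. (LINT x|lborel. cmod (f x)) * cmod (gauss_cutoff \<epsilon> f \<xi>))"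
        using gi by (intro integrable_mult_right integrable_norm)
      have "?J \<xi> \<le> (LINT x|lborel. cmod (f x)) * cmod (gauss_cutoff \<epsilon> f \<xi>)" for \<xi>
        using norm_FT_le[of f \<xi>] by (simp add: gauss_cutoff_def norm_mult power2_eq_square mult.assoc mult_right_mono)
      then show "AE \<xi> in lborel. norm (?J \<xi>) \<le> norm ((LINT x|lborel. cmod (f x)) * cmod (gauss_cutoff \<epsilon> f \<xi>))"
        by (intro AE_I2) (auto intro: order_trans[OF _ abs_ge_self])
    qed measurable
    have J0: "(LINT \<xi>|lborel. ?J \<xi>) \<ge> 0" by (intro integral_nonneg_AE) auto
    have "complex_of_real (LINT \<xi>|lborel. ?J \<xi>) = (LINT \<xi>|lborel. complex_of_real (?J \<xi>))"
      by (simp only: integral_complex_of_real)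
    also have "\<dots> = (LINT x|lborel. cnj (f x) * (LINT \<xi>|lborel. gauss_cutoff \<epsilon> f \<xi> * cis (2 * pi * \<xi> * x)))"
      unfolding J by (rule fourier_swap(2)[OF gi cf]) simp
    also have "\<dots> = (LINT x|lborel. cnj (f x) * mollify \<epsilon> f x)"
      unfolding mollify_eq[OF f e] by (simp add: mult_ac)
    finally have eq: "complex_of_real (LINT \<xi>|lborel. ?J \<xi>) = (LINT x|lborel. cnj (f x) * mollify \<epsilon> f x)" .
    have "(\<integral>\<^sup>+\<xi>. ennreal (?J \<xi>) \<partial>lborel) = ennreal (LINT \<xi>|lborel. ?J \<xi>)"
      using Ji by (rule nn_integral_eq_integral) auto
    also have "(LINT \<xi>|lborel. ?J \<xi>) = cmod (complex_of_real (LINT \<xi>|lborel. ?J \<xi>))"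
      unfolding norm_of_real using J0 by simp
    \<comment> \<open>Integrability is not established here: a nonintegrable function has integral
      0, for which the bound is trivial.\<close>
    also have "ennreal \<dots> \<le> (\<integral>\<^sup>+x. ennreal (cmod (cnj (f x) * mollify \<epsilon> f x)) \<partial>lborel)"
    proof (cases "integrable lborel (\<lambda>x. cnj (f x) * mollify \<epsilon> f x)")
      case True then show ?thesis unfolding eq by (rule integral_norm_bound_ennreal)
    next
      case False then show ?thesis unfolding eq by (simp add: not_integrable_integral_eq)
    qed
    also have "\<dots> \<le> (\<integral>\<^sup>+x. \<integral>\<^sup>+v. ennreal (cmod (f x)) * (ennreal (exp (- (pi * v\<^sup>2))) * ennreal (cmod (f (x + \<epsilon> * v)))) \<partial>lborel \<partial>lborel)"
    proof (rule nn_integral_mono)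
      fix x
      have "ennreal (cmod (mollify \<epsilon> f x)) \<le> (\<integral>\<^sup>+v. ennreal (exp (- (pi * v\<^sup>2))) * ennreal (cmod (f (x + \<epsilon> * v))) \<partial>lborel)"
      proof (cases "integrable lborel (\<lambda>v. of_real (exp (- (pi * v\<^sup>2))) * f (x + \<epsilon> * v))")
        case True
        then show ?thesis using integral_norm_bound_ennreal[OF True]
          by (simp add: mollify_def norm_mult ennreal_mult')
      next
        case False then show ?thesis by (simp add: mollify_def not_integrable_integral_eq)
      qed
      then show "ennreal (cmod (cnj (f x) * mollify \<epsilon> f x)) \<le>
        (\<integral>\<^sup>+v. ennreal (cmod (f x)) * (ennreal (exp (- (pi * v\<^sup>2))) * ennreal (cmod (f (x + \<epsilon> * v)))) \<partial>lborel)"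
        by (subst nn_integral_cmult) (auto simp: norm_mult ennreal_mult' intro!: mult_left_mono)
    qed
    also have "\<dots> = (\<integral>\<^sup>+v. \<integral>\<^sup>+x. ennreal (cmod (f x)) * (ennreal (exp (- (pi * v\<^sup>2))) * ennreal (cmod (f (x + \<epsilon> * v)))) \<partial>lborel \<partial>lborel)"
      by (rule lborel_pair.Fubini') measurable
    also have "\<dots> \<le> (\<integral>\<^sup>+v. ennreal (exp (- (pi * v\<^sup>2))) * ennreal F2 \<partial>lborel)"
    proof (rule nn_integral_mono)
      fix v :: real
      have "(\<integral>\<^sup>+x. ennreal (cmod (f x)) * (ennreal (exp (- (pi * v\<^sup>2))) * ennreal (cmod (f (x + \<epsilon> * v)))) \<partial>lborel)
        \<le> (\<integral>\<^sup>+x. ennreal (exp (- (pi * v\<^sup>2)) / 2) * (ennreal ((cmod (f x))\<^sup>2) + ennreal ((cmod (f (x + \<epsilon> * v)))\<^sup>2)) \<partial>lborel)"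
      proof (rule nn_integral_mono)
        fix x
        \<comment> \<open>The product of \<open>f\<close> and a translate is split by the inequality
          of the means, so that translation invariance finishes.\<close>
        have "cmod (f x) * (exp (- (pi * v\<^sup>2)) * cmod (f (x + \<epsilon> * v))) \<le> exp (- (pi * v\<^sup>2)) / 2 * ((cmod (f x))\<^sup>2 + (cmod (f (x + \<epsilon> * v)))\<^sup>2)"
          using mult_left_mono[OF sum_squares_bound[of "cmod (f x)" "cmod (f (x + \<epsilon> * v))"], of "exp (- (pi * v\<^sup>2)) / 2"]
          by (simp add: mult_ac)
        then show "ennreal (cmod (f x)) * (ennreal (exp (- (pi * v\<^sup>2))) * ennreal (cmod (f (x + \<epsilon> * v))))
          \<le> ennreal (exp (- (pi * v\<^sup>2)) / 2) * (ennreal ((cmod (f x))\<^sup>2) + ennreal ((cmod (f (x + \<epsilon> * v)))\<^sup>2))"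
          by (simp add: ennreal_mult'[symmetric] ennreal_plus[symmetric] ennreal_leI del: ennreal_plus)
      qed
      also have "\<dots> = ennreal (exp (- (pi * v\<^sup>2)) / 2) * (ennreal F2 + ennreal F2)"
        using nn_integral_lborel_shift(3)[of "\<lambda>x. ennreal ((cmod (f x))\<^sup>2)" "\<epsilon> * v"]
        by (subst nn_integral_cmult) (auto simp: nn_integral_add nnF2)
      also have "\<dots> = ennreal (exp (- (pi * v\<^sup>2))) * ennreal F2"
      proof -
        have "F2 \<ge> 0" by (simp add: F2_def)
        then show ?thesis by (simp add: ennreal_mult'[symmetric] ennreal_plus[symmetric] del: ennreal_plus)
      qed
      finally show "(\<integral>\<^sup>+x. ennreal (cmod (f x)) * (ennreal (exp (- (pi * v\<^sup>2))) * ennreal (cmod (f (x + \<epsilon> * v)))) \<partial>lborel)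
        \<le> ennreal (exp (- (pi * v\<^sup>2))) * ennreal F2" .
    qed
    also have "\<dots> = ennreal F2"
      by (subst nn_integral_multc) (auto simp: nn_integral_eq_integral[OF gauss_integrable_one(1)] gauss_integrable_one(2))
    finally show ?thesis .
  qed
  have "(\<integral>\<^sup>+\<xi>. ennreal ((cmod (FT f \<xi>))\<^sup>2) \<partial>lborel)
    = (\<integral>\<^sup>+\<xi>. liminf (\<lambda>n. ennreal ((cmod (FT f \<xi>))\<^sup>2 * exp (- (pi * (1 / Suc n)\<^sup>2 * \<xi>\<^sup>2)))) \<partial>lborel)"
  proof (rule nn_integral_cong)
    fix \<xi> :: real
    have "(\<lambda>n. (cmod (FT f \<xi>))\<^sup>2 * exp (- (pi * (1 / Suc n)\<^sup>2 * \<xi>\<^sup>2))) \<longlonglongrightarrow> (cmod (FT f \<xi>))\<^sup>2 * exp (- (pi * 0\<^sup>2 * \<xi>\<^sup>2))"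
      using LIMSEQ_inverse_real_of_nat by (intro tendsto_intros) (simp add: inverse_eq_divide)
    then have "(\<lambda>n. ennreal ((cmod (FT f \<xi>))\<^sup>2 * exp (- (pi * (1 / Suc n)\<^sup>2 * \<xi>\<^sup>2)))) \<longlonglongrightarrow> ennreal ((cmod (FT f \<xi>))\<^sup>2)"
      by (intro tendsto_ennrealI) simp
    then show "ennreal ((cmod (FT f \<xi>))\<^sup>2) = liminf (\<lambda>n. ennreal ((cmod (FT f \<xi>))\<^sup>2 * exp (- (pi * (1 / Suc n)\<^sup>2 * \<xi>\<^sup>2))))"
      by (rule lim_imp_Liminf[OF sequentially_bot, symmetric])
  qed
  also have "\<dots> \<le> liminf (\<lambda>n. \<integral>\<^sup>+\<xi>. ennreal ((cmod (FT f \<xi>))\<^sup>2 * exp (- (pi * (1 / Suc n)\<^sup>2 * \<xi>\<^sup>2))) \<partial>lborel)"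
    by (rule nn_integral_liminf) measurable
  also have "\<dots> \<le> liminf (\<lambda>n::nat. ennreal F2)"
    by (intro Liminf_mono always_eventually allI reg) simp
  also have "\<dots> = ennreal F2" by (simp add: Liminf_const)
  finally have le: "(\<integral>\<^sup>+\<xi>. ennreal ((cmod (FT f \<xi>))\<^sup>2) \<partial>lborel) \<le> ennreal F2" .
  show i: "integrable lborel (\<lambda>\<xi>. (cmod (FT f \<xi>))\<^sup>2)"
    by (rule integrableI_bounded) (use le in \<open>auto intro: le_less_trans\<close>)
  show "(LINT \<xi>|lborel. (cmod (FT f \<xi>))\<^sup>2) \<le> (LINT x|lborel. (cmod (f x))\<^sup>2)"
    using le nn_integral_eq_integral[OF i] unfolding F2_def by (simp add: ennreal_le_iff)
qed

text \<open>The mollifications converge to \<open>f x\<close> by continuity of \<open>f\<close>, and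
  to the inversion integral by dominated convergence in frequency.\<close>

lemma FT_inversion:
  assumes f: "continuous_on UNIV f" "integrable lborel f" and B: "\<And>x. cmod (f x) \<le> B"
    and F: "integrable lborel (FT f)"
  shows "f x = (LINT \<xi>|lborel. FT f \<xi> * cis (2 * pi * x * \<xi>))"
proof (rule LIMSEQ_unique)
  define \<epsilon> where "\<epsilon> n = 1 / real (Suc n)" for n
  have e: "\<epsilon> \<longlonglongrightarrow> 0" unfolding \<epsilon>_def using LIMSEQ_inverse_real_of_nat by (simp add: inverse_eq_divide)
  have e0: "\<epsilon> n > 0" for n by (simp add: \<epsilon>_def)
  show "(\<lambda>n. mollify (\<epsilon> n) f x) \<longlonglongrightarrow> f x" by (rule mollify_tendsto[OF f(1) B e])
  have [measurable]: "f \<in> borel_measurable borel" using f by auto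
  show "(\<lambda>n. mollify (\<epsilon> n) f x) \<longlonglongrightarrow> (LINT \<xi>|lborel. FT f \<xi> * cis (2 * pi * x * \<xi>))"
    unfolding mollify_eq[OF f(2) e0]
  proof (rule integral_dominated_convergence[where w="\<lambda>\<xi>. cmod (FT f \<xi>)"])
    show "AE \<xi> in lborel. (\<lambda>n. gauss_cutoff (\<epsilon> n) f \<xi> * cis (2 * pi * x * \<xi>)) \<longlonglongrightarrow> FT f \<xi> * cis (2 * pi * x * \<xi>)"
    proof (rule AE_I2)
      fix \<xi>
      have "(\<lambda>n. FT f \<xi> * of_real (exp (- (pi * (\<epsilon> n)\<^sup>2 * \<xi>\<^sup>2))) * cis (2 * pi * x * \<xi>)) \<longlonglongrightarrow>
         FT f \<xi> * of_real (exp (- (pi * 0\<^sup>2 * \<xi>\<^sup>2))) * cis (2 * pi * x * \<xi>)"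
        by (intro tendsto_intros e)
      then show "(\<lambda>n. gauss_cutoff (\<epsilon> n) f \<xi> * cis (2 * pi * x * \<xi>)) \<longlonglongrightarrow> FT f \<xi> * cis (2 * pi * x * \<xi>)"
        by (simp add: gauss_cutoff_def)
    qed
    show "AE \<xi> in lborel. cmod (gauss_cutoff (\<epsilon> n) f \<xi> * cis (2 * pi * x * \<xi>)) \<le> cmod (FT f \<xi>)" for n
      by (auto simp: gauss_cutoff_def norm_mult intro!: mult_left_le)
  qed (use F in \<open>auto simp: gauss_cutoff_def\<close>)
qed

section \<open>Summation over frequency scales\<close>

text \<open>The gain at frequency \<open>N\<close> is \<open>N powr (-1/16)\<close>, so any exponent less than \<open>1/16\<close> would do.\<close>

definition sobolev_weight :: "real \<Rightarrow> real" where
  "sobolev_weight \<xi> = (1 + \<xi>\<^sup>2) powr (- (1 / 32))"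

lemma sobolev_weight_bounds: "0 < sobolev_weight \<xi>" "sobolev_weight \<xi> \<le> 1"
proof -
  have p: "1 + \<xi>\<^sup>2 \<ge> 1" by simp
  then have "1 + \<xi>\<^sup>2 \<noteq> 0" by linarith
  then show "0 < sobolev_weight \<xi>" by (simp add: sobolev_weight_def)
  show "sobolev_weight \<xi> \<le> 1" using powr_mono[OF _ p, of "- (1/32)" 0] p by (simp add: sobolev_weight_def)
qed

lemma borel_measurable_sobolev_weight [measurable]: "sobolev_weight \<in> borel_measurable borel"
  unfolding sobolev_weight_def[abs_def] by measurable

text \<open>This trades the plain norm over a bounded set of frequencies for the weighted
  one.\<close>

lemma sobolev_weight_ge:
  assumes "\<xi>\<^sup>2 \<le> M" "M \<ge> 0"
  shows "1 \<le> (1 + M) powr (1/32) * sobolev_weight \<xi>"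
proof -
  have p: "0 < 1 + \<xi>\<^sup>2" by (simp add: add_pos_nonneg)
  have "1 = (1 + \<xi>\<^sup>2) powr (1/32) * sobolev_weight \<xi>"
    using p by (simp add: sobolev_weight_def powr_add[symmetric])
  also have "\<dots> \<le> (1 + M) powr (1/32) * sobolev_weight \<xi>"
    using assms p sobolev_weight_bounds(1)[of \<xi>] by (intro mult_right_mono powr_mono2) auto
  finally show ?thesis .
qed

locale multiplier_data =
  fixes g1 \<phi> :: "real \<Rightarrow> complex" and B :: real
  assumes g1: "integrable lborel g1" and g12: "integrable lborel (\<lambda>x. (cmod (g1 x))\<^sup>2)"
    and \<phi>m [measurable]: "\<phi> \<in> borel_measurable borel" and \<phi>2: "integrable lborel (\<lambda>x. (cmod (\<phi> x))\<^sup>2)"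
    and \<phi>B: "\<And>x. cmod (\<phi> x) \<le> B"
begin

lemma g1m [measurable]: "g1 \<in> borel_measurable borel" using g1 by auto

text \<open>The form is \<open>\<integral> g(a) L(a) da\<close>. As \<open>L\<close> does not depend
  on \<open>g\<close>, cutting \<open>g\<close> into dyadic blocks is a matter of linearity.\<close>

definition L :: "real \<Rightarrow> complex" where
  "L a = (LINT \<xi>|lborel. g1 \<xi> * \<phi> (a + \<xi>) * gmult a \<xi>)"

definition Q :: real where
  "Q = sqrt (LINT x|lborel. (cmod (g1 x))\<^sup>2) * sqrt (LINT x|lborel. (cmod (\<phi> x))\<^sup>2)"

lemma Lm [measurable]: "L \<in> borel_measurable borel" unfolding L_def[abs_def] by measurable

lemma Q_nonneg: "Q \<ge> 0" by (simp add: Q_def)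

lemma B_nonneg: "B \<ge> 0" using norm_ge_zero \<phi>B order_trans by blast

text \<open>Plain Cauchy-Schwarz, with the multiplier bounded by 1. It handles the frequencies below
  1, where nothing is gained, and dominates the limit of the dyadic sums.\<close>

lemma L_le: "cmod (L a) \<le> Q"
proof -
  have \<phi>2': "integrable lborel (\<lambda>x. (cmod (\<phi> (a + x)))\<^sup>2)" using \<phi>2 by (subst lborel_integrable_shift(2))
  have eq: "(LINT x|lborel. (cmod (\<phi> (a + x)))\<^sup>2) = (LINT x|lborel. (cmod (\<phi> x))\<^sup>2)" by (rule lborel_integral_shift(2))
  have m: "g1 \<in> borel_measurable lborel" "(\<lambda>x. \<phi> (a + x)) \<in> borel_measurable lborel" by measurable
  note CS = L2_Cauchy_Schwarz[OF m g12 \<phi>2', unfolded eq, folded Q_def]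
  have le: "cmod (g1 \<xi> * \<phi> (a + \<xi>) * gmult a \<xi>) \<le> cmod (g1 \<xi>) * cmod (\<phi> (a + \<xi>))" for \<xi>
    unfolding norm_mult by (rule mult_left_le) (auto intro: norm_gmult_le)
  have "cmod (L a) \<le> (LINT \<xi>|lborel. cmod (g1 \<xi>) * cmod (\<phi> (a + \<xi>)))"
    unfolding L_def
    by (rule Bochner_Integration.integral_norm_bound_integral[OF _ CS(1) le],
        rule Bochner_Integration.integrable_bound[OF CS(1)])
      (use le in \<open>auto intro: order_trans[OF _ abs_ge_self]\<close>)
  also note CS(2)
  finally show ?thesis .
qed

text \<open>With the order of integration reversed, Cauchy-Schwarz in \<open>\<xi>\<close>
  eliminates \<open>g1\<close>; the root of the bound in \<open>mult_form_L2\<close> halves the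
  exponent 1/8.\<close>

lemma piece_bound:
  assumes fp: "frequency_piece g \<phi> s N B"
  shows "cmod (LINT a|lborel. g a * L a) \<le> sqrt 2 * N powr (-1/16) * sqrt (LINT x|lborel. (cmod (g x))\<^sup>2) * Q"
proof -
  interpret P: frequency_piece g \<phi> s N B by (rule fp)
  have [measurable]: "g \<in> borel_measurable borel" by (rule P.gm)
  let ?S = "\<lambda>\<xi>. LINT a|lborel. g a * \<phi> (a + \<xi>) * gmult a \<xi>"
  have I: "integrable (lborel \<Otimes>\<^sub>M lborel) (\<lambda>(a, \<xi>). g a * (g1 \<xi> * \<phi> (a + \<xi>) * gmult a \<xi>))"
  proof (rule lborel_pair.integrable_pair_bound[OF _ integrable_norm[OF P.g]])
    show "integrable lborel (\<lambda>\<xi>. cmod (g1 \<xi>) * B)" using g1 by simp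
    show "cmod (case (a, \<xi>) of (a, \<xi>) \<Rightarrow> g a * (g1 \<xi> * \<phi> (a + \<xi>) * gmult a \<xi>)) \<le> cmod (g a) * (cmod (g1 \<xi>) * B)" for a \<xi>
      using mult_mono[OF \<phi>B[of "a + \<xi>"] norm_gmult_le(2)[of a \<xi>] B_nonneg norm_ge_zero]
      by (auto simp: norm_mult mult.assoc intro!: mult_left_mono)
  qed measurable
  have "(LINT a|lborel. g a * L a) = (LINT a|lborel. LINT \<xi>|lborel. g a * (g1 \<xi> * \<phi> (a + \<xi>) * gmult a \<xi>))"
    by (simp add: L_def)
  also have "\<dots> = (LINT \<xi>|lborel. LINT a|lborel. g a * (g1 \<xi> * \<phi> (a + \<xi>) * gmult a \<xi>))"
    by (rule lborel_pair.Fubini_integral[OF I, symmetric])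
  also have "\<dots> = (LINT \<xi>|lborel. g1 \<xi> * ?S \<xi>)"
    unfolding integral_mult_right_zero[symmetric] by (simp add: mult_ac)
  finally have eq: "(LINT a|lborel. g a * L a) = (LINT \<xi>|lborel. g1 \<xi> * ?S \<xi>)" .
  have m: "g1 \<in> borel_measurable lborel" "?S \<in> borel_measurable lborel" by measurable
  note CS = L2_Cauchy_Schwarz[OF m g12 P.mult_form_L2(1)]
  have "cmod (LINT a|lborel. g a * L a) \<le> (LINT \<xi>|lborel. cmod (g1 \<xi> * ?S \<xi>))"
    unfolding eq by (rule integral_norm_bound)
  also have "\<dots> \<le> sqrt (LINT x|lborel. (cmod (g1 x))\<^sup>2) * sqrt (LINT \<xi>|lborel. (cmod (?S \<xi>))\<^sup>2)"
    using CS(2) by (simp only: norm_mult)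
  also have "\<dots> \<le> sqrt (LINT x|lborel. (cmod (g1 x))\<^sup>2) *
      sqrt (2 * N powr (-1/8) * (LINT x|lborel. (cmod (g x))\<^sup>2) * (LINT x|lborel. (cmod (\<phi> x))\<^sup>2))"
    by (intro mult_left_mono real_sqrt_le_mono P.mult_form_L2(2)) simp
  also have "\<dots> = sqrt 2 * N powr (-1/16) * sqrt (LINT x|lborel. (cmod (g x))\<^sup>2) * Q"
    using P.N by (simp add: real_sqrt_mult Q_def powr_half_sqrt[symmetric] powr_powr)
  finally show ?thesis .
qed

text \<open>On a block of size \<open>2 ^ k\<close> the plain norm is at most
  \<open>2 * 2 powr (k / 32)\<close> times the weighted one, against a gain of
  \<open>2 powr (- k / 16)\<close>. The product is of order \<open>r ^ k\<close>, summable. In the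
  constant, 2 comes from the frequencies below 1 and 6 from a factor 3 for each sign.\<close>

lemma dyadic_bound:
  fixes g :: "real \<Rightarrow> complex"
  assumes g: "integrable lborel g" and g2: "integrable lborel (\<lambda>x. (cmod (g x))\<^sup>2)" and gB: "\<And>x. cmod (g x) \<le> B"
  defines "W \<equiv> sqrt (LINT x|lborel. (cmod (g x))\<^sup>2 * sobolev_weight x)"
  shows "cmod (LINT a|lborel. g a * L a) \<le> (2 + 6 / (1 - 2 powr (-1/32))) * W * Q"
proof -
  have gm [measurable]: "g \<in> borel_measurable borel" using g by auto
  define r :: real where "r = 2 powr (-1/32)"
  have r: "0 < r" "r < 1" using powr_less_mono[of "-1/32" 0 "2::real"] by (auto simp: r_def)
  have Wi: "integrable lborel (\<lambda>x. (cmod (g x))\<^sup>2 * sobolev_weight x)"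
  proof (rule Bochner_Integration.integrable_bound[OF g2])
    show "AE x in lborel. norm ((cmod (g x))\<^sup>2 * sobolev_weight x) \<le> norm ((cmod (g x))\<^sup>2)"
      using sobolev_weight_bounds by (auto simp: abs_mult less_imp_le intro!: mult_left_le)
  qed measurable
  have W0: "W \<ge> 0" unfolding W_def using sobolev_weight_bounds(1)
    by (intro real_sqrt_ge_zero integral_nonneg_AE) (auto simp: less_imp_le)
  have gA: "integrable lborel (\<lambda>a. g a * indicator A a)" "integrable lborel (\<lambda>a. (cmod (g a * indicator A a))\<^sup>2)"
    "integrable lborel (\<lambda>a. g a * indicator A a * L a)" "cmod (g a * indicator A a) \<le> B"
    if [measurable]: "A \<in> sets borel" for A a
  proof -
    show gi: "integrable lborel (\<lambda>a. g a * indicator A a)"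
      by (rule Bochner_Integration.integrable_bound[OF g]) (auto simp: norm_mult indicator_def)
    show "integrable lborel (\<lambda>a. (cmod (g a * indicator A a))\<^sup>2)"
      by (rule Bochner_Integration.integrable_bound[OF g2]) (auto simp: norm_mult indicator_def)
    have i: "integrable lborel (\<lambda>a. cmod (g a * indicator A a) * Q)" using gi by simp
    show "integrable lborel (\<lambda>a. g a * indicator A a * L a)"
      using L_le Q_nonneg
      by (intro Bochner_Integration.integrable_bound[OF i]) (auto simp: norm_mult abs_mult intro!: mult_left_mono)
    show "cmod (g a * indicator A a) \<le> B" using gB[of a] B_nonneg by (auto simp: indicator_def)
  qed
  \<comment> \<open>The exponent 1/64 is half of 1/32, because of the root in
    \<open>W\<close>.\<close>
  have WA: "sqrt (LINT a|lborel. (cmod (g a * indicator A a))\<^sup>2) \<le> (1 + M) powr (1/64) * W"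
    if A [measurable]: "A \<in> sets borel" and M: "M \<ge> 0" and le: "\<And>a. a \<in> A \<Longrightarrow> a\<^sup>2 \<le> M" for A M
  proof -
    have "(LINT a|lborel. (cmod (g a * indicator A a))\<^sup>2) \<le> (LINT a|lborel. (1 + M) powr (1/32) * ((cmod (g a))\<^sup>2 * sobolev_weight a))"
    proof (rule integral_mono)
      fix a
      have "(cmod (g a * indicator A a))\<^sup>2 \<le> (cmod (g a))\<^sup>2 * ((1 + M) powr (1/32) * sobolev_weight a)"
      proof (cases "a \<in> A")
        case True
        then show ?thesis using mult_left_mono[OF sobolev_weight_ge[OF le M], of a "(cmod (g a))\<^sup>2"] by simp
      qed (use sobolev_weight_bounds(1)[of a] in simp)
      then show "(cmod (g a * indicator A a))\<^sup>2 \<le> (1 + M) powr (1/32) * ((cmod (g a))\<^sup>2 * sobolev_weight a)"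
        by (simp add: mult_ac)
    qed (use gA(2)[OF A] Wi in auto)
    also have "\<dots> = (1 + M) powr (1/32) * (LINT a|lborel. (cmod (g a))\<^sup>2 * sobolev_weight a)" by simp
    finally have "sqrt (LINT a|lborel. (cmod (g a * indicator A a))\<^sup>2) \<le>
       sqrt ((1 + M) powr (1/32) * (LINT a|lborel. (cmod (g a))\<^sup>2 * sobolev_weight a))" by simp
    also have "\<dots> = (1 + M) powr (1/64) * W"
      using M by (simp add: real_sqrt_mult W_def powr_half_sqrt[symmetric] powr_powr)
    finally show ?thesis .
  qed
  \<comment> \<open>With \<open>Lo\<close> open and the blocks half-open, \<open>Lo (Suc K)\<close>
    is the disjoint union of \<open>Lo K\<close> and the blocks of both signs at level
    \<open>K\<close>.\<close>
  define Lo where "Lo K = {a::real. \<bar>a\<bar> < 2 ^ K}" for K :: nat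
  define E where "E s k = {a::real. 2 ^ k \<le> s * a \<and> s * a < 2 * 2 ^ k}" for s :: real and k :: nat
  have [measurable]: "Lo K \<in> sets borel" "E s k \<in> sets borel" for K s k
    unfolding Lo_def E_def by measurable
  have low: "cmod (LINT a|lborel. g a * indicator (Lo 0) a * L a) \<le> 2 * W * Q"
  proof -
    have m: "(\<lambda>a. g a * indicator (Lo 0) a) \<in> borel_measurable lborel" "(\<lambda>a. indicator (Lo 0) a :: real) \<in> borel_measurable lborel"
      by measurable
    have Lo0: "Lo 0 = {-1<..<1}" by (auto simp: Lo_def)
    have i2: "integrable lborel (\<lambda>a. (norm (indicator (Lo 0) a :: real))\<^sup>2)"
      and v2: "(LINT a|lborel. (norm (indicator (Lo 0) a :: real))\<^sup>2) = 2"
    proof -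
      have "(norm (indicator (Lo 0) a :: real))\<^sup>2 = indicator (Lo 0) a" for a by (simp add: indicator_def)
      then show "integrable lborel (\<lambda>a. (norm (indicator (Lo 0) a :: real))\<^sup>2)" "(LINT a|lborel. (norm (indicator (Lo 0) a :: real))\<^sup>2) = 2"
        unfolding Lo0 by (auto simp: integrable_real_indicator)
    qed
    note CS = L2_Cauchy_Schwarz[OF m gA(2) i2]
    have le: "cmod (g a * indicator (Lo 0) a * L a) \<le> cmod (g a * indicator (Lo 0) a) * norm (indicator (Lo 0) a :: real) * Q" for a
      using L_le[of a] by (auto simp: norm_mult indicator_def intro!: mult_left_mono)
    have "cmod (LINT a|lborel. g a * indicator (Lo 0) a * L a) \<le> (LINT a|lborel. cmod (g a * indicator (Lo 0) a) * norm (indicator (Lo 0) a :: real) * Q)"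
      using CS(1) by (intro Bochner_Integration.integral_norm_bound_integral gA(3) le) auto
    also have "\<dots> = (LINT a|lborel. cmod (g a * indicator (Lo 0) a) * norm (indicator (Lo 0) a :: real)) * Q" by simp
    also have "\<dots> \<le> sqrt (LINT a|lborel. (cmod (g a * indicator (Lo 0) a))\<^sup>2) * sqrt 2 * Q"
      using CS(2) unfolding v2 by (intro mult_right_mono Q_nonneg) auto
    also have "\<dots> \<le> ((1 + 1) powr (1/64) * W) * sqrt 2 * Q"
    proof (intro mult_right_mono WA Q_nonneg)
      show "a\<^sup>2 \<le> 1" if "a \<in> Lo 0" for a using that by (simp add: Lo_def abs_square_le_1)
    qed auto
    also have "\<dots> \<le> 2 * W * Q"
    proof -
      have "(2::real) powr (1/64) \<le> 2 powr (1/2)" by (intro powr_mono) auto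
      then have "(2::real) powr (1/64) * sqrt 2 \<le> sqrt 2 * sqrt 2"
        by (intro mult_right_mono) (auto simp: powr_half_sqrt)
      then have "((2::real) powr (1/64) * sqrt 2) * (W * Q) \<le> 2 * (W * Q)"
        using W0 Q_nonneg by (intro mult_right_mono) auto
      then show ?thesis by (simp add: mult_ac)
    qed
    finally show ?thesis .
  qed
  have piece: "cmod (LINT a|lborel. g a * indicator (E s k) a * L a) \<le> 3 * r ^ k * W * Q" if s: "\<bar>s\<bar> = 1" for s k
  proof -
    have fp: "frequency_piece (\<lambda>a. g a * indicator (E s k) a) \<phi> s (2 ^ k) B"
    proof
      show "2 ^ k \<le> s * a \<and> s * a \<le> 2 * 2 ^ k" if "g a * indicator (E s k) a \<noteq> 0" for a
        using that by (auto simp: E_def indicator_def split: if_splits)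
    qed (use s gA \<phi>2 \<phi>B in auto)
    have "sqrt (LINT a|lborel. (cmod (g a * indicator (E s k) a))\<^sup>2) \<le> (1 + 4 * 4 ^ k) powr (1/64) * W"
    proof (rule WA)
      fix a assume a: "a \<in> E s k"
      have "\<bar>a\<bar> = \<bar>s * a\<bar>" using s by (simp add: abs_mult)
      also have "\<dots> \<le> 2 * 2 ^ k" using a by (auto simp: E_def abs_le_iff intro: order_trans[of _ 0])
      finally have "\<bar>a\<bar>\<^sup>2 \<le> (2 * 2 ^ k)\<^sup>2" by (intro power_mono) auto
      then show "a\<^sup>2 \<le> 4 * 4 ^ k" by (simp add: power_mult_distrib power_mult[symmetric] power2_eq_square power_mult_distrib[symmetric])
    qed auto
    also have "\<dots> \<le> (2 * 2 powr (k / 32)) * W"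
    proof (rule mult_right_mono[OF _ W0])
      \<comment> \<open>A generous constant, chosen because its 64th root is 2.\<close>
      have "(1 + 4 * 4 ^ k :: real) \<le> 2 powr 64 * 4 ^ k"
      proof -
        have "(1::real) \<le> 4 ^ k" by simp
        then have "(1 + 4 * 4 ^ k :: real) \<le> 5 * 4 ^ k" by linarith
        also have "\<dots> \<le> 2 powr 64 * 4 ^ k" by (intro mult_right_mono) (auto simp: powr_numeral)
        finally show ?thesis .
      qed
      then have "(1 + 4 * 4 ^ k :: real) powr (1/64) \<le> (2 powr 64 * 4 ^ k) powr (1/64)"
        by (intro powr_mono2) auto
      also have "(2 powr 64 * 4 ^ k) powr (1/64) = (2 * 2 powr (k / 32) :: real)"
      proof -
        have "(4::real) ^ k = 2 ^ (2 * k)" by (simp add: power_mult)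
        also have "\<dots> = 2 powr real (2 * k)" by (rule powr_realpow[symmetric]) simp
        finally have "(4::real) ^ k = 2 powr real (2 * k)" .
        then show ?thesis by (simp only: powr_mult powr_powr) (simp add: powr_powr)
      qed
      finally show "(1 + 4 * 4 ^ k :: real) powr (1/64) \<le> 2 * 2 powr (k / 32)" .
    qed
    finally have g2: "sqrt (LINT a|lborel. (cmod (g a * indicator (E s k) a))\<^sup>2) \<le> (2 * 2 powr (k / 32)) * W" .
    have "cmod (LINT a|lborel. g a * indicator (E s k) a * L a) \<le>
       sqrt 2 * (2 ^ k) powr (-1/16) * sqrt (LINT a|lborel. (cmod (g a * indicator (E s k) a))\<^sup>2) * Q"
      by (rule piece_bound[OF fp])
    also have "\<dots> \<le> sqrt 2 * (2 ^ k) powr (-1/16) * ((2 * 2 powr (k / 32)) * W) * Q"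
      by (intro mult_right_mono mult_left_mono g2 Q_nonneg) auto
    also have "\<dots> = (2 * sqrt 2) * ((2 ^ k) powr (-1/16) * 2 powr (k / 32)) * W * Q"
      by (simp add: mult_ac)
    also have "((2::real) ^ k) powr (-1/16) * 2 powr (k / 32) = r ^ k"
      by (simp add: r_def powr_realpow[symmetric] powr_powr powr_add[symmetric])
    also have "(2 * sqrt 2) * r ^ k * W * Q \<le> 3 * r ^ k * W * Q"
    proof -
      have "2 * sqrt 2 = sqrt (8::real)" using real_sqrt_mult[of 4 2] by simp
      also have "\<dots> \<le> 3" by (rule real_le_lsqrt) auto
      finally show ?thesis using r W0 Q_nonneg by (intro mult_right_mono) auto
    qed
    finally show ?thesis .
  qed
  have sum: "cmod (LINT a|lborel. g a * indicator (Lo K) a * L a) \<le> (2 + 6 * (\<Sum>k<K. r ^ k)) * W * Q" for K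
  proof (induction K)
    case 0 then show ?case using low by simp
  next
    case (Suc K)
    have split: "g a * indicator (Lo (Suc K)) a * L a = g a * indicator (Lo K) a * L a +
       (g a * indicator (E 1 K) a * L a + g a * indicator (E (-1) K) a * L a)" for a
    proof -
      have "0 < (2::real) ^ K" by simp
      then have "indicator (Lo (Suc K)) a = (indicator (Lo K) a + (indicator (E 1 K) a + indicator (E (-1) K) a) :: complex)"
      proof -
        consider "\<bar>a\<bar> < 2 ^ K" | "2 ^ K \<le> a" | "2 ^ K \<le> - a" by linarith
        then show ?thesis
        proof cases
          case 1
          then have "a \<in> Lo (Suc K)" "a \<in> Lo K" "a \<notin> E 1 K" "a \<notin> E (-1) K"
            unfolding Lo_def E_def mem_Collect_eq power_Suc by linarith+
          then show ?thesis by simp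
        next
          case 2
          with \<open>0 < (2::real) ^ K\<close> have "\<bar>a\<bar> = a" by linarith
          with 2 \<open>0 < (2::real) ^ K\<close> have "a \<notin> Lo K" "a \<notin> E (-1) K" "a \<in> Lo (Suc K) \<longleftrightarrow> a \<in> E 1 K"
            by (simp_all add: Lo_def E_def)
          then show ?thesis by (simp add: indicator_def)
        next
          case 3
          with \<open>0 < (2::real) ^ K\<close> have "\<bar>a\<bar> = - a" by linarith
          with 3 \<open>0 < (2::real) ^ K\<close> have "a \<notin> Lo K" "a \<notin> E 1 K" "a \<in> Lo (Suc K) \<longleftrightarrow> a \<in> E (-1) K"
            by (simp_all add: Lo_def E_def)
          then show ?thesis by (simp add: indicator_def)
        qed
      qed
      then show ?thesis by (simp add: algebra_simps)
    qed
    have eq: "(LINT a|lborel. g a * indicator (Lo (Suc K)) a * L a) = (LINT a|lborel. g a * indicator (Lo K) a * L a) +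
       ((LINT a|lborel. g a * indicator (E 1 K) a * L a) + (LINT a|lborel. g a * indicator (E (-1) K) a * L a))"
      unfolding split by (simp add: gA(3))
    have "cmod (LINT a|lborel. g a * indicator (Lo (Suc K)) a * L a) \<le> (2 + 6 * (\<Sum>k<K. r ^ k)) * W * Q + (3 * r ^ K * W * Q + 3 * r ^ K * W * Q)"
      unfolding eq by (rule order_trans[OF norm_triangle_ineq add_mono[OF Suc
            order_trans[OF norm_triangle_ineq add_mono[OF piece piece]]]]) simp_all
    also have "\<dots> = (2 + 6 * (\<Sum>k<Suc K. r ^ k)) * W * Q" by (simp add: algebra_simps)
    finally show ?case .
  qed
  have sum': "cmod (LINT a|lborel. g a * indicator (Lo K) a * L a) \<le> (2 + 6 / (1 - r)) * W * Q" for K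
  proof -
    have "(\<Sum>k<K. r ^ k) = (1 - r ^ K) / (1 - r)" using r by (simp add: sum_gp_strict)
    also have "\<dots> \<le> 1 / (1 - r)" using r by (intro divide_right_mono) auto
    finally have "(2 + 6 * (\<Sum>k<K. r ^ k)) * W * Q \<le> (2 + 6 / (1 - r)) * W * Q"
      using W0 Q_nonneg by (intro mult_right_mono) auto
    with sum[of K] show ?thesis by (rule order_trans)
  qed
  have "(\<lambda>K. LINT a|lborel. g a * indicator (Lo K) a * L a) \<longlonglongrightarrow> (LINT a|lborel. g a * L a)"
  proof (rule integral_dominated_convergence[where w="\<lambda>a. cmod (g a) * Q"])
    show "integrable lborel (\<lambda>a. cmod (g a) * Q)" using g by simp
    show "AE a in lborel. (\<lambda>K. g a * indicator (Lo K) a * L a) \<longlonglongrightarrow> g a * L a"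
    proof (rule AE_I2, rule tendsto_eventually)
      fix a :: real
      obtain K0 where K0: "\<bar>a\<bar> < 2 ^ K0" using real_arch_pow[of 2 "\<bar>a\<bar>"] by auto
      show "\<forall>\<^sub>F K in sequentially. g a * indicator (Lo K) a * L a = g a * L a"
      proof (rule eventually_sequentiallyI[of K0])
        fix K assume "K \<ge> K0"
        then have "(2::real) ^ K0 \<le> 2 ^ K" by (intro power_increasing) auto
        with K0 have "\<bar>a\<bar> < 2 ^ K" by linarith
        then have "a \<in> Lo K" by (simp add: Lo_def)
        then show "g a * indicator (Lo K) a * L a = g a * L a" by simp
      qed
    qed
    show "AE a in lborel. cmod (g a * indicator (Lo K) a * L a) \<le> cmod (g a) * Q" for K
      using L_le Q_nonneg by (auto simp: norm_mult indicator_def intro!: mult_left_mono)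
  qed measurable
  then have "(\<lambda>K. cmod (LINT a|lborel. g a * indicator (Lo K) a * L a)) \<longlonglongrightarrow> cmod (LINT a|lborel. g a * L a)"
    by (rule tendsto_norm)
  then show ?thesis
    unfolding r_def[symmetric] by (rule Lim_bounded) (use sum' in auto)
qed

end

section \<open>Fourier representation of the cutoff\<close>

text \<open>The function vanishes on an open set, so its derivative vanishes there too, and the
  fundamental theorem on an interval reaching beyond the support has no boundary terms.\<close>

lemma integral_deriv_compact_support:
  fixes F F' :: "real \<Rightarrow> complex"
  assumes F: "\<And>x. (F has_vector_derivative F' x) (at x)" and F': "continuous_on UNIV F'"
    and zero: "\<And>x. R < \<bar>x\<bar> \<Longrightarrow> F x = 0"
  shows "\<And>x. R < \<bar>x\<bar> \<Longrightarrow> F' x = 0" and "integrable lborel F'" and "(LINT x|lborel. F' x) = 0"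
proof -
  show z: "F' x = 0" if x: "R < \<bar>x\<bar>" for x
  proof -
    have "open {x::real. R < \<bar>x\<bar>}" by (rule open_Collect_less[OF continuous_on_const continuous_on_rabs[OF continuous_on_id]])
    then have "((\<lambda>x. 0) has_vector_derivative F' x) (at x)"
      using zero x by (intro has_vector_derivative_transform_within_open[OF F[of x]]) auto
    then show ?thesis
      using vector_derivative_unique_at[OF _ has_vector_derivative_const] by metis
  qed
  \<comment> \<open>\<open>R\<close> may be negative, hence the absolute value; the added 1 puts the
    endpoints strictly outside.\<close>
  define M where "M = \<bar>R\<bar> + 1"
  have eq: "indicator {-M..M} x *\<^sub>R F' x = F' x" for x
  proof (cases "x \<in> {-M..M}")
    case False
    then have "R < \<bar>x\<bar>" by (auto simp: M_def)
    then show ?thesis using z False by simp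
  qed simp
  have c: "continuous_on {-M..M} F'" using F' by (rule continuous_on_subset) simp
  have M: "-M \<le> M" by (simp add: M_def)
  have h: "has_bochner_integral lborel (\<lambda>x. indicator {-M..M} x *\<^sub>R F' x) (F M - F (-M))"
    by (rule has_bochner_integral_FTC_Icc[OF M _ c]) (rule has_vector_derivative_at_within[OF F])
  have RM: "R < \<bar>M\<bar>" "R < \<bar>- M\<bar>"
    using abs_ge_self[of R] abs_ge_self[of M] unfolding abs_minus_cancel M_def by linarith+
  have "has_bochner_integral lborel F' (F M - F (-M))" using h unfolding eq .
  then have h0: "has_bochner_integral lborel F' 0" unfolding zero[OF RM(1)] zero[OF RM(2)] diff_self .
  show "integrable lborel F'" using h0 by (rule integrable.intros)
  show "(LINT x|lborel. F' x) = 0" using h0 by (rule has_bochner_integral_integral_eq)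
qed

lemma compact_support_integrable:
  fixes F :: "real \<Rightarrow> complex"
  assumes F: "continuous_on UNIV F" and zero: "\<And>x. R < \<bar>x\<bar> \<Longrightarrow> F x = 0"
  shows "integrable lborel F" and "integrable lborel (\<lambda>x. (cmod (F x))\<^sup>2)" and "\<exists>B. \<forall>x. cmod (F x) \<le> B"
proof -
  have m [measurable]: "F \<in> borel_measurable borel" using F by (rule borel_measurable_continuous_onI)
  have "compact (F ` {-\<bar>R\<bar>..\<bar>R\<bar>})"
    by (intro compact_continuous_image continuous_on_subset[OF F]) auto
  then obtain B where B: "\<And>x. x \<in> {-\<bar>R\<bar>..\<bar>R\<bar>} \<Longrightarrow> cmod (F x) \<le> B"
    using compact_imp_bounded bounded_iff by (metis image_eqI)
  have B0: "B \<ge> 0" using B[of 0] norm_ge_zero[of "F 0"] by (simp add: order_trans[OF norm_ge_zero])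
  have out: "F x = 0" if "x \<notin> {-\<bar>R\<bar>..\<bar>R\<bar>}" for x using that by (intro zero) auto
  have le: "cmod (F x) \<le> B * indicator {-\<bar>R\<bar>..\<bar>R\<bar>} x" for x
    using B[of x] out[of x] by (cases "x \<in> {-\<bar>R\<bar>..\<bar>R\<bar>}") auto
  have i: "integrable lborel (\<lambda>x. c * indicator {-\<bar>R\<bar>..\<bar>R\<bar>} x :: real)" for c
    by (intro integrable_mult_right integrable_real_indicator) (auto simp: emeasure_lborel_Icc_eq)
  show "integrable lborel F"
    by (rule Bochner_Integration.integrable_bound[OF i[of B]]) (use le in \<open>auto intro: order_trans[OF _ abs_ge_self]\<close>)
  have le2: "(cmod (F x))\<^sup>2 \<le> B\<^sup>2 * indicator {-\<bar>R\<bar>..\<bar>R\<bar>} x" for x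
    using B[of x] out[of x] by (cases "x \<in> {-\<bar>R\<bar>..\<bar>R\<bar>}") (auto intro!: power_mono)
  show "integrable lborel (\<lambda>x. (cmod (F x))\<^sup>2)"
    by (rule Bochner_Integration.integrable_bound[OF i[of "B\<^sup>2"]]) (use le2 in \<open>auto intro: order_trans[OF _ abs_ge_self]\<close>)
  show "\<exists>B. \<forall>x. cmod (F x) \<le> B"
    using B out B0 by (metis norm_zero)
qed

text \<open>Integration by parts: the derivative of \<open>f\<close> times the character has
  integral 0.\<close>

lemma FT_deriv:
  assumes f: "\<And>x. (f has_vector_derivative f' x) (at x)" and f': "continuous_on UNIV f'"
    and zero: "\<And>x. R < \<bar>x\<bar> \<Longrightarrow> f x = 0"
  shows "FT f' \<xi> = 2 * of_real pi * \<i> * of_real \<xi> * FT f \<xi>"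
proof -
  have fc: "continuous_on UNIV f"
    using f by (intro continuous_at_imp_continuous_on ballI has_vector_derivative_continuous) auto
  have zero': "f' x = 0" if "R < \<bar>x\<bar>" for x by (rule integral_deriv_compact_support(1)[OF f f' zero that])
  define c where "c = - (2 * of_real pi * \<i> * of_real \<xi>)"
  let ?e = "\<lambda>x. cis (- (2 * pi * x * \<xi>))"
  have de: "(?e has_vector_derivative c * ?e x) (at x)" for x
  proof -
    have "((\<lambda>z. exp (c * z)) has_field_derivative c * exp (c * of_real x)) (at (of_real x))"
      by (auto intro!: derivative_eq_intros)
    then have "((\<lambda>x. exp (c * of_real x)) has_vector_derivative c * exp (c * of_real x)) (at x)"
      by (rule has_vector_derivative_real_field)
    then show ?thesis by (simp add: cis_conv_exp c_def mult_ac)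
  qed
  have d: "((\<lambda>x. f x * ?e x) has_vector_derivative f x * (c * ?e x) + f' x * ?e x) (at x)" for x
    by (rule has_vector_derivative_mult[OF f de])
  have ce: "continuous_on UNIV ?e" by (intro continuous_intros)
  have cc: "continuous_on UNIV (\<lambda>x. f x * (c * ?e x) + f' x * ?e x)"
    by (intro continuous_intros fc f' ce)
  have z: "f x * ?e x = 0" if "R < \<bar>x\<bar>" for x using zero that by simp
  have i1: "integrable lborel (\<lambda>x. f x * (c * ?e x))"
    by (rule compact_support_integrable(1)[where R=R]) (use zero in \<open>auto intro!: continuous_intros fc\<close>)
  have i2: "integrable lborel (\<lambda>x. f' x * ?e x)"
    by (rule compact_support_integrable(1)[where R=R]) (use zero' in \<open>auto intro!: continuous_intros f'\<close>)
  have "0 = (LINT x|lborel. f x * (c * ?e x) + f' x * ?e x)"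
    by (rule integral_deriv_compact_support(3)[OF d cc z, symmetric])
  also have "\<dots> = c * FT f \<xi> + FT f' \<xi>"
  proof -
    have "(LINT x|lborel. f x * (c * ?e x)) = (LINT x|lborel. c * (f x * ?e x))" by (simp add: mult_ac)
    then show ?thesis unfolding FT_def using i1 i2 by simp
  qed
  finally show ?thesis by (simp add: c_def add_eq_0_iff)
qed

lemma integrable_inverse_1_plus_sq: "integrable lborel (\<lambda>x::real. 1 / (1 + x\<^sup>2))"
  using integrable_inverse_1_plus_square by (simp add: set_integrable_def einterval_def inverse_eq_divide)

text \<open>Two derivatives are traded for the decay \<open>1 / (1 + \<xi>\<^sup>2)\<close>; one
  derivative would give only the order \<open>1 / \<bar>\<xi>\<bar>\<close> by this argument, which
  is not integrable.\<close>

lemma FT_integrable: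
  assumes f: "\<And>x. (f has_vector_derivative f' x) (at x)" and f': "\<And>x. (f' has_vector_derivative f'' x) (at x)"
    and f'': "continuous_on UNIV f''" and zero: "\<And>x. R < \<bar>x\<bar> \<Longrightarrow> f x = 0"
  shows "integrable lborel (FT f)"
proof -
  have fc: "continuous_on UNIV f" and fc': "continuous_on UNIV f'"
    using f f' by (auto intro!: continuous_at_imp_continuous_on has_vector_derivative_continuous)
  have zero': "f' x = 0" if "R < \<bar>x\<bar>" for x by (rule integral_deriv_compact_support(1)[OF f fc' zero that])
  have [measurable]: "f \<in> borel_measurable borel" using fc by (rule borel_measurable_continuous_onI)
  define M where "M = (LINT x|lborel. cmod (f x)) + (LINT x|lborel. cmod (f'' x))"
  have le: "cmod (FT f \<xi>) \<le> M * (1 / (1 + \<xi>\<^sup>2))" for \<xi>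
  proof -
    have "FT f'' \<xi> = (2 * of_real pi * \<i> * of_real \<xi>) * ((2 * of_real pi * \<i> * of_real \<xi>) * FT f \<xi>)"
      using FT_deriv[OF f' f'' zero'] FT_deriv[OF f fc' zero] by simp
    then have "cmod (FT f'' \<xi>) = (2 * pi)\<^sup>2 * \<xi>\<^sup>2 * cmod (FT f \<xi>)"
      by (simp add: norm_mult power2_eq_square)
    moreover have "1 * (\<xi>\<^sup>2 * cmod (FT f \<xi>)) \<le> (2 * pi)\<^sup>2 * (\<xi>\<^sup>2 * cmod (FT f \<xi>))"
      using pi_gt3 by (intro mult_right_mono one_le_power) auto
    ultimately have "\<xi>\<^sup>2 * cmod (FT f \<xi>) \<le> (LINT x|lborel. cmod (f'' x))"
      using norm_FT_le[of f'' \<xi>] by (simp add: mult.assoc)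
    then have "(1 + \<xi>\<^sup>2) * cmod (FT f \<xi>) \<le> M"
      using norm_FT_le[of f \<xi>] by (simp add: M_def algebra_simps)
    moreover have "1 + \<xi>\<^sup>2 > 0" by (simp add: add_pos_nonneg)
    ultimately show ?thesis by (simp add: pos_le_divide_eq mult.commute)
  qed
  have i: "integrable lborel (\<lambda>\<xi>. M * (1 / (1 + \<xi>\<^sup>2)))"
    by (rule integrable_mult_right) (rule integrable_inverse_1_plus_sq)
  show ?thesis
    by (rule Bochner_Integration.integrable_bound[OF i]) (measurable, rule AE_I2, rule order_trans[OF le], simp only: real_norm_def abs_ge_self)
qed

lemma cutoff_gauss_representation:
  assumes chi: "smooth chi" "compactly_supported chi"
  obtains \<Psi> where "integrable lborel \<Psi>"
    "\<And>t. complex_of_real (chi t) = of_real (exp (- (pi * t\<^sup>2))) * (LINT \<theta>|lborel. \<Psi> \<theta> * cis (2 * pi * t * \<theta>))"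
proof -
  have d: "((deriv ^^ n) chi has_real_derivative deriv ((deriv ^^ n) chi) t) (at t)" for n t
    using chi(1) unfolding smooth_def
    by (metis UNIV_I differentiable_on_def DERIV_deriv_iff_real_differentiable)
  define c1 c2 where "c1 = deriv chi" and "c2 = deriv (deriv chi)"
  have D0: "(chi has_real_derivative c1 t) (at t)" and D1: "(c1 has_real_derivative c2 t) (at t)"
    and D2: "isCont c2 t" for t
    using d[of 0 t] d[of 1 t] DERIV_isCont[OF d[of 2 t]] by (simp_all add: c1_def c2_def numeral_2_eq_2)
  \<comment> \<open>\<open>p\<close> undoes the Gaussian. It inherits the compact support of
    \<open>chi\<close>, so the growth of the exponential is harmless; the two explicit derivatives
    feed \<open>FT_integrable\<close>.\<close>
  define p p1 p2 where "p t = chi t * exp (pi * t\<^sup>2)"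
    and "p1 t = (c1 t + 2 * pi * t * chi t) * exp (pi * t\<^sup>2)"
    and "p2 t = (c2 t + 2 * pi * chi t + 2 * pi * t * c1 t + 2 * pi * t * (c1 t + 2 * pi * t * chi t)) * exp (pi * t\<^sup>2)" for t
  have P0: "(p has_real_derivative p1 t) (at t)" for t
    unfolding p_def p1_def by (auto intro!: derivative_eq_intros D0 simp: algebra_simps)
  have P1: "(p1 has_real_derivative p2 t) (at t)" for t
    unfolding p1_def p2_def by (auto intro!: derivative_eq_intros D0 D1 simp: algebra_simps)
  have P2: "isCont p2 t" for t
    unfolding p2_def by (intro continuous_intros D2 DERIV_isCont[OF D0] DERIV_isCont[OF D1])
  have "bounded (closure {t. chi t \<noteq> 0})" using chi(2) by (simp add: compactly_supported_def compact_imp_bounded)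
  then have "bounded {t. chi t \<noteq> 0}" using bounded_subset closure_subset by blast
  then obtain R where R: "\<And>t. chi t \<noteq> 0 \<Longrightarrow> \<bar>t\<bar> \<le> R" unfolding bounded_iff by auto
  have zero: "complex_of_real (p t) = 0" if "R < \<bar>t\<bar>" for t using R[of t] that by (auto simp: p_def)
  have pc: "continuous_on UNIV (\<lambda>t. complex_of_real (p t))"
    by (intro continuous_at_imp_continuous_on ballI continuous_of_real DERIV_isCont[OF P0])
  have p2c: "continuous_on UNIV (\<lambda>t. complex_of_real (p2 t))"
    by (intro continuous_at_imp_continuous_on ballI continuous_of_real P2)
  obtain B where B: "\<And>t. cmod (complex_of_real (p t)) \<le> B"
    using compact_support_integrable(3)[OF pc zero] by auto
  have F: "integrable lborel (FT (\<lambda>t. complex_of_real (p t)))"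
    by (rule FT_integrable[where f'="\<lambda>t. complex_of_real (p1 t)", OF has_vector_derivative_of_real[OF P0]
          has_vector_derivative_of_real[OF P1] p2c zero])
  show ?thesis
  proof (rule that[OF F])
    fix t
    have "complex_of_real (chi t) = of_real (exp (- (pi * t\<^sup>2))) * complex_of_real (p t)"
      by (simp add: p_def mult_exp_exp flip: of_real_mult)
    also have "complex_of_real (p t) = (LINT \<theta>|lborel. FT (\<lambda>t. complex_of_real (p t)) \<theta> * cis (2 * pi * t * \<theta>))"
      by (rule FT_inversion[OF pc compact_support_integrable(1)[OF pc zero] B F])
    finally show "complex_of_real (chi t) = of_real (exp (- (pi * t\<^sup>2))) * (LINT \<theta>|lborel. FT (\<lambda>t. complex_of_real (p t)) \<theta> * cis (2 * pi * t * \<theta>))" .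
  qed
qed

section \<open>Square integrable functions\<close>

text \<open>The definitions speak of Lebesgue measurable functions, whose compositions with maps
  such as \<open>x + t\<^sup>2\<close> on the plane need not be measurable for the product of the
  Borel algebras. The estimates are therefore made for Borel representatives.\<close>

lemma lebesgue_borel_representative:
  fixes f :: "real \<Rightarrow> complex"
  assumes f: "f \<in> borel_measurable lebesgue"
  obtains g where "g \<in> borel_measurable borel" "AE x in lborel. f x = g x"
proof -
  have "(\<lambda>x. Re (f x)) \<in> borel_measurable lebesgue" "(\<lambda>x. Im (f x)) \<in> borel_measurable lebesgue"
    using f by measurable
  from this[THEN completion_ex_borel_measurable_real] obtain u v where
    uv: "u \<in> borel_measurable lborel" "AE x in lborel. Re (f x) = u x"
      "v \<in> borel_measurable lborel" "AE x in lborel. Im (f x) = v x" by auto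
  show ?thesis
  proof (rule that)
    show "(\<lambda>x. Complex (u x) (v x)) \<in> borel_measurable borel" using uv(1,3) by (simp add: Complex_eq)
    show "AE x in lborel. f x = Complex (u x) (v x)" using uv(2,4) by eventually_elim (simp add: complex_eq_iff)
  qed
qed

lemma lebesgue_integral_AE_eq:
  fixes f :: "real \<Rightarrow> 'a::euclidean_space"
  assumes g: "g \<in> borel_measurable borel" and ae: "AE x in lborel. f x = g x"
  shows "f \<in> borel_measurable lebesgue" and "(LINT x|lebesgue. f x) = (LINT x|lborel. g x)"
    and "integrable lebesgue f \<longleftrightarrow> integrable lborel g"
proof -
  have ae': "AE x in lebesgue. g x = f x" using AE_completion[OF ae] by eventually_elim simp
  have g': "g \<in> borel_measurable lborel" using g by simp
  have gl: "g \<in> borel_measurable lebesgue" using g' by (rule measurable_completion)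
  show f: "f \<in> borel_measurable lebesgue" by (rule borel_measurable_AE[OF gl ae'])
  have "(LINT x|lebesgue. f x) = (LINT x|lebesgue. g x)"
    by (rule integral_cong_AE[OF f gl AE_completion[OF ae]])
  then show "(LINT x|lebesgue. f x) = (LINT x|lborel. g x)" by (simp add: integral_completion[OF g'])
  have "integrable lebesgue f \<longleftrightarrow> integrable lebesgue g"
    by (rule integrable_cong_AE[OF f gl AE_completion[OF ae]])
  then show "integrable lebesgue f \<longleftrightarrow> integrable lborel g" by (simp add: integrable_completion[OF g'])
qed

lemma L2_borel:
  assumes g [measurable]: "g \<in> borel_measurable borel" and ae: "AE x in lborel. f x = g x"
  shows "in_L2 f \<longleftrightarrow> integrable lborel (\<lambda>x. (cmod (g x))\<^sup>2)" and "L2_norm f = sqrt (LINT x|lborel. (cmod (g x))\<^sup>2)"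
proof -
  have m: "(\<lambda>x. (cmod (g x))\<^sup>2) \<in> borel_measurable borel" by measurable
  have ae2: "AE x in lborel. (cmod (f x))\<^sup>2 = (cmod (g x))\<^sup>2" using ae by eventually_elim simp
  show "in_L2 f \<longleftrightarrow> integrable lborel (\<lambda>x. (cmod (g x))\<^sup>2)"
    unfolding in_L2_def using lebesgue_integral_AE_eq(3)[OF m ae2] lebesgue_integral_AE_eq(1)[OF g ae] by simp
  show "L2_norm f = sqrt (LINT x|lborel. (cmod (g x))\<^sup>2)"
    unfolding L2_norm_def lebesgue_integral_AE_eq(2)[OF m ae2] ..
qed

lemma fourier_borel:
  assumes g [measurable]: "g \<in> borel_measurable borel" and ae: "AE x in lborel. f x = g x"
  shows "fourier f = FT g"
proof
  fix \<xi>
  have e: "exp (- 2 * of_real pi * \<i> * of_real x * of_real \<xi>) = cis (- (2 * pi * x * \<xi>))" for x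
    by (simp add: cis_conv_exp mult_ac)
  have ae2: "AE x in lborel. f x * cis (- (2 * pi * x * \<xi>)) = g x * cis (- (2 * pi * x * \<xi>))"
    using ae by eventually_elim simp
  show "fourier f \<xi> = FT g \<xi>" unfolding fourier_def FT_def e
    by (rule lebesgue_integral_AE_eq(2)[OF _ ae2]) measurable
qed

section \<open>The seminorm of square integrable functions\<close>

lemma L2_norm_nonneg: "L2_norm f \<ge> 0" by (simp add: L2_norm_def)

lemma L2_norm_sq: "(L2_norm f)\<^sup>2 = (LINT x|lebesgue. (cmod (f x))\<^sup>2)"
  by (simp add: L2_norm_def)

lemma in_L2_add:
  assumes f: "in_L2 f" and g: "in_L2 g"
  shows "in_L2 (\<lambda>x. f x + g x)" and "L2_norm (\<lambda>x. f x + g x) \<le> L2_norm f + L2_norm g"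
proof -
  have m: "f \<in> borel_measurable lebesgue" "g \<in> borel_measurable lebesgue"
    and i: "integrable lebesgue (\<lambda>x. (cmod (f x))\<^sup>2)" "integrable lebesgue (\<lambda>x. (cmod (g x))\<^sup>2)"
    using f g by (auto simp: in_L2_def)
  note [measurable] = m
  note CS = L2_Cauchy_Schwarz[OF m i]
  let ?h = "\<lambda>x. (cmod (f x))\<^sup>2 + 2 * (cmod (f x) * cmod (g x)) + (cmod (g x))\<^sup>2"
  have hi: "integrable lebesgue ?h" using i CS(1) by simp
  have le: "(cmod (f x + g x))\<^sup>2 \<le> ?h x" for x
  proof -
    have "(cmod (f x + g x))\<^sup>2 \<le> (cmod (f x) + cmod (g x))\<^sup>2" by (intro power_mono norm_triangle_ineq) auto
    then show ?thesis by (simp add: power2_sum)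
  qed
  have si: "integrable lebesgue (\<lambda>x. (cmod (f x + g x))\<^sup>2)"
    by (rule Bochner_Integration.integrable_bound[OF hi])
      (measurable, use le in \<open>auto intro: order_trans[OF _ abs_ge_self]\<close>)
  then show "in_L2 (\<lambda>x. f x + g x)" by (simp add: in_L2_def)
  have "(LINT x|lebesgue. (cmod (f x + g x))\<^sup>2) \<le> integral\<^sup>L lebesgue ?h"
    by (intro integral_mono si hi le)
  also have "\<dots> = (L2_norm f)\<^sup>2 + 2 * (LINT x|lebesgue. cmod (f x) * cmod (g x)) + (L2_norm g)\<^sup>2"
    using i CS(1) by (simp add: L2_norm_sq)
  also have "\<dots> \<le> (L2_norm f)\<^sup>2 + 2 * (L2_norm f * L2_norm g) + (L2_norm g)\<^sup>2"
    using CS(2) by (simp add: L2_norm_def)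
  also have "\<dots> = (L2_norm f + L2_norm g)\<^sup>2" by (simp add: power2_sum)
  finally show "L2_norm (\<lambda>x. f x + g x) \<le> L2_norm f + L2_norm g"
    unfolding L2_norm_def[of "\<lambda>x. f x + g x"] using L2_norm_nonneg[of f] L2_norm_nonneg[of g]
    by (intro real_le_lsqrt) auto
qed

lemma in_L2_mult:
  assumes f: "in_L2 f" and [measurable]: "c \<in> borel_measurable lebesgue" and c: "\<And>x. cmod (c x) \<le> 1"
  shows "in_L2 (\<lambda>x. c x * f x)" and "L2_norm (\<lambda>x. c x * f x) \<le> L2_norm f"
proof -
  have [measurable]: "f \<in> borel_measurable lebesgue" and i: "integrable lebesgue (\<lambda>x. (cmod (f x))\<^sup>2)"
    using f by (auto simp: in_L2_def)
  have le: "(cmod (c x * f x))\<^sup>2 \<le> (cmod (f x))\<^sup>2" for x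
    using c[of x] by (intro power_mono) (auto simp: norm_mult mult_left_le_one_le)
  have ci: "integrable lebesgue (\<lambda>x. (cmod (c x * f x))\<^sup>2)"
    by (rule Bochner_Integration.integrable_bound[OF i]) (measurable, use le in auto)
  then show "in_L2 (\<lambda>x. c x * f x)" by (simp add: in_L2_def)
  show "L2_norm (\<lambda>x. c x * f x) \<le> L2_norm f"
    unfolding L2_norm_def by (intro real_sqrt_le_mono integral_mono ci i le)
qed

lemma in_L2_uminus: "in_L2 f \<Longrightarrow> in_L2 (\<lambda>x. - f x)" "L2_norm (\<lambda>x. - f x) = L2_norm f"
  by (auto simp: in_L2_def L2_norm_def)

lemma in_L2_diff:
  assumes "in_L2 f" "in_L2 g"
  shows "in_L2 (\<lambda>x. f x - g x)" and "L2_norm (\<lambda>x. f x - g x) \<le> L2_norm f + L2_norm g"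
  using in_L2_add[OF assms(1) in_L2_uminus(1)[OF assms(2)]] by (simp_all add: in_L2_uminus)

lemma L2_norm_minus_commute: "L2_norm (\<lambda>x. f x - g x) = L2_norm (\<lambda>x. g x - f x)"
  by (simp add: L2_norm_def norm_minus_commute)

lemma L2_norm_diff_triangle:
  assumes "in_L2 f" "in_L2 g" "in_L2 h"
  shows "L2_norm (\<lambda>x. f x - h x) \<le> L2_norm (\<lambda>x. f x - g x) + L2_norm (\<lambda>x. g x - h x)"
  using in_L2_add(2)[OF in_L2_diff(1)[OF assms(1,2)] in_L2_diff(1)[OF assms(2,3)]] by simp

lemma L2_norm_reverse_triangle:
  assumes "in_L2 f" "in_L2 g"
  shows "\<bar>L2_norm f - L2_norm g\<bar> \<le> L2_norm (\<lambda>x. f x - g x)"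
  using in_L2_add(2)[OF in_L2_diff(1)[OF assms] assms(2)] in_L2_add(2)[OF in_L2_diff(1)[OF assms(2,1)] assms(1)]
  by (simp add: L2_norm_minus_commute[of g f] abs_le_iff)

lemma L2_tendsto_norm:
  assumes "L2_tendsto h f"
  shows "(\<lambda>n. L2_norm (h n)) \<longlonglongrightarrow> L2_norm f"
proof (rule LIM_zero_cancel)
  have lim: "(\<lambda>n. L2_norm (\<lambda>x. h n x - f x)) \<longlonglongrightarrow> 0" using assms by (simp add: L2_tendsto_def)
  have "norm (L2_norm (h n) - L2_norm f) \<le> L2_norm (\<lambda>x. h n x - f x)" for n
    using assms L2_norm_reverse_triangle[of "h n" f] by (simp add: L2_tendsto_def)
  then show "(\<lambda>n. L2_norm (h n) - L2_norm f) \<longlonglongrightarrow> 0"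
    by (intro Lim_null_comparison[OF always_eventually lim] allI)
qed

lemma L2_dominated_convergence:
  assumes [measurable]: "\<And>n. h n \<in> borel_measurable lebesgue" "f \<in> borel_measurable lebesgue"
    and w: "integrable lebesgue (\<lambda>x. (w x)\<^sup>2)"
    and lim: "AE x in lebesgue. (\<lambda>n. h n x) \<longlonglongrightarrow> f x"
    and le: "\<And>n x. cmod (h n x) \<le> w x" "\<And>x. cmod (f x) \<le> w x"
  shows "L2_tendsto h f"
proof -
  have i: "integrable lebesgue (\<lambda>x. (cmod (h n x))\<^sup>2)" "integrable lebesgue (\<lambda>x. (cmod (f x))\<^sup>2)" for n
    by (rule Bochner_Integration.integrable_bound[OF w], measurable, use le in \<open>auto intro!: power_mono\<close>)+
  have w0: "w x \<ge> 0" for x using le(2)[of x] norm_ge_zero order_trans by blast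
  have "(\<lambda>n. LINT x|lebesgue. (cmod (h n x - f x))\<^sup>2) \<longlonglongrightarrow> (LINT x|(lebesgue :: real measure). 0)"
  proof (rule integral_dominated_convergence[where w="\<lambda>x. 4 * (w x)\<^sup>2"])
    show "AE x in lebesgue. (\<lambda>n. (cmod (h n x - f x))\<^sup>2) \<longlonglongrightarrow> 0"
      using lim
    proof eventually_elim
      case (elim x)
      then have "(\<lambda>n. (cmod (h n x - f x))\<^sup>2) \<longlonglongrightarrow> (cmod (f x - f x))\<^sup>2" by (intro tendsto_intros)
      then show ?case by simp
    qed
    have "(cmod (h n x - f x))\<^sup>2 \<le> 4 * (w x)\<^sup>2" for n x
    proof -
      have "cmod (h n x - f x) \<le> 2 * w x" using norm_triangle_ineq4[of "h n x" "f x"] le(1)[of n x] le(2)[of x] by linarith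
      then have "(cmod (h n x - f x))\<^sup>2 \<le> (2 * w x)\<^sup>2" by (intro power_mono) auto
      then show ?thesis by (simp add: power_mult_distrib)
    qed
    then show "AE x in lebesgue. norm ((cmod (h n x - f x))\<^sup>2) \<le> 4 * (w x)\<^sup>2" for n by simp
  qed (use w in \<open>auto\<close>)
  then have "(\<lambda>n. L2_norm (\<lambda>x. h n x - f x)) \<longlonglongrightarrow> sqrt 0"
    unfolding L2_norm_def by (intro tendsto_real_sqrt) simp
  then show ?thesis using i by (simp add: L2_tendsto_def in_L2_def)
qed

section \<open>Density of continuous functions, and completeness\<close>

text \<open>The versions \<open>a m\<close> of \<open>f\<close>, cut off in space and clipped in
  size, converge to \<open>f\<close>. Each is the limit of continuous functions \<open>b m n\<close>
  truncated in the same way, all dominated by one bounded function of compact support. Choosing one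
  index \<open>n = k m\<close> for each \<open>m\<close> then suffices.\<close>

lemma L2_approx_continuous:
  assumes f: "in_L2 f"
  obtains h R where "\<And>n::nat. continuous_on UNIV (h n)" "\<And>n x. R n < \<bar>x\<bar> \<Longrightarrow> h n x = 0" "L2_tendsto h f"
proof -
  have fm [measurable]: "f \<in> borel_measurable lebesgue" and f2: "integrable lebesgue (\<lambda>x. (cmod (f x))\<^sup>2)"
    using f by (auto simp: in_L2_def)
  \<comment> \<open>This yields continuous functions converging to \<open>f\<close> off a negligible
    set, with no control of their size or support; the truncations below supply it.\<close>
  have "f measurable_on UNIV" by (rule lebesgue_measurable_imp_measurable_on[OF fm]) simp
  then obtain N g where N: "negligible N" and gc: "\<And>n. continuous_on UNIV (g n)"
    and glim: "\<And>x. x \<notin> N \<Longrightarrow> (\<lambda>n. g n x) \<longlonglongrightarrow> f x"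
    unfolding measurable_on_def by auto
  have aeN: "AE x in lebesgue. x \<notin> N"
    using N unfolding negligible_iff_null_sets by (rule AE_not_in)
  define cut where "cut m x = max 0 (min 1 (real m + 1 - \<bar>x\<bar>))" for m :: nat and x :: real
  \<comment> \<open>Radial projection onto the disc of radius \<open>m + 1\<close>. It is
    continuous, as the maximum keeps the denominator away from 0, so clipping preserves the
    convergence of \<open>g n\<close>.\<close>
  define clip where "clip m z = of_real ((real m + 1) / max (real m + 1) (cmod z)) * z" for m :: nat and z :: complex
  have cut: "0 \<le> cut m x" "cut m x \<le> 1" "real m + 1 < \<bar>x\<bar> \<Longrightarrow> cut m x = 0" for m x by (auto simp: cut_def)
  have clip_cont: "continuous_on UNIV (clip m)" for m
    unfolding clip_def by (intro continuous_intros) (auto simp: max_def)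
  have clip_le: "cmod (clip m z) \<le> cmod z" "cmod (clip m z) \<le> real m + 1" for m z
  proof -
    define M where "M = max (real m + 1) (cmod z)"
    have M: "M > 0" "cmod z \<le> M" "real m + 1 \<le> M" by (auto simp: M_def)
    have e: "cmod (clip m z) = (real m + 1) / M * cmod z"
      unfolding clip_def M_def[symmetric] norm_mult norm_of_real using M by simp
    show "cmod (clip m z) \<le> cmod z" unfolding e using M by (intro mult_left_le_one_le) (auto simp: divide_le_eq)
    have "(real m + 1) * (cmod z / M) \<le> real m + 1" using M by (intro mult_left_le) (auto simp: divide_le_eq)
    then show "cmod (clip m z) \<le> real m + 1" unfolding e by simp
  qed
  have cutc: "continuous_on UNIV (cut m)" for m unfolding cut_def by (intro continuous_intros)
  define b where "b m n x = of_real (cut m x) * clip m (g n x)" for m n x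
  define a where "a m x = of_real (cut m x) * clip m (f x)" for m x
  have bc: "continuous_on UNIV (b m n)" for m n
    unfolding b_def by (intro continuous_intros cutc continuous_on_compose2[OF clip_cont gc]) auto
  have bz: "b m n x = 0" if "real m + 1 < \<bar>x\<bar>" for m n x using cut(3)[OF that] by (simp add: b_def)
  have clipm [measurable]: "clip m \<in> borel_measurable borel" for m by (rule borel_measurable_continuous_onI[OF clip_cont])
  have cutm: "cut m \<in> borel_measurable borel" for m by (rule borel_measurable_continuous_onI[OF cutc])
  have cutl [measurable]: "cut m \<in> borel_measurable lebesgue" for m
    by (rule measurable_completion) (simp add: cutm)
  have am [measurable]: "a m \<in> borel_measurable lebesgue" for m
    unfolding a_def[abs_def] by measurable
  have bm [measurable]: "b m n \<in> borel_measurable lebesgue" for m n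
    by (rule measurable_completion) (simp add: borel_measurable_continuous_onI[OF bc])
  have af: "L2_tendsto a f"
  proof (rule L2_dominated_convergence[OF am fm, where w="\<lambda>x. cmod (f x)"])
    show "AE x in lebesgue. (\<lambda>m. a m x) \<longlonglongrightarrow> f x"
    proof (rule AE_I2, rule tendsto_eventually)
      fix x
      obtain m0 where m0: "max \<bar>x\<bar> (cmod (f x)) \<le> real m0" using real_arch_simple by blast
      show "\<forall>\<^sub>F m in sequentially. a m x = f x"
      proof (rule eventually_sequentiallyI[of m0])
        fix m assume "m0 \<le> m"
        then have "max \<bar>x\<bar> (cmod (f x)) \<le> real m" using m0 by (meson of_nat_le_iff order_trans)
        then have "cut m x = 1" "max (real m + 1) (cmod (f x)) = real m + 1" by (auto simp: cut_def)
        then show "a m x = f x" by (simp add: a_def clip_def)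
      qed
    qed
    show "cmod (a m x) \<le> cmod (f x)" for m x
    proof -
      have "cmod (a m x) = cut m x * cmod (clip m (f x))" using cut(1)[of m x] by (simp add: a_def norm_mult)
      also have "\<dots> \<le> 1 * cmod (f x)" using cut clip_le by (intro mult_mono) auto
      finally show ?thesis by simp
    qed
  qed (use f2 in auto)
  have ba: "L2_tendsto (b m) (a m)" for m
  proof (rule L2_dominated_convergence[OF bm am, where w="\<lambda>x. (real m + 1) * indicator {-(real m + 1)..real m + 1} x"])
    have e: "((real m + 1) * indicator {-(real m + 1)..real m + 1} x)\<^sup>2 = (real m + 1)\<^sup>2 * indicator {-(real m + 1)..real m + 1} x" for x :: real
      by (simp add: indicator_def)
    show "integrable lebesgue (\<lambda>x. ((real m + 1) * indicator {-(real m + 1)..real m + 1} x)\<^sup>2)"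
      unfolding e by (intro integrable_mult_right integrable_real_indicator) (auto simp: emeasure_lborel_Icc_eq)
    show "AE x in lebesgue. (\<lambda>n. b m n x) \<longlonglongrightarrow> a m x"
      using aeN
    proof eventually_elim
      case (elim x)
      have "(\<lambda>n. clip m (g n x)) \<longlonglongrightarrow> clip m (f x)"
        by (rule continuous_on_tendsto_compose[OF clip_cont glim[OF elim]]) auto
      then show ?case unfolding b_def a_def by (intro tendsto_intros)
    qed
    have B: "cmod (of_real (cut m x) * clip m z) \<le> (real m + 1) * indicator {-(real m + 1)..real m + 1} x" for x z
    proof (cases "x \<in> {-(real m + 1)..real m + 1}")
      case True
      have "cmod (of_real (cut m x) * clip m z) = cut m x * cmod (clip m z)" using cut(1)[of m x] by (simp add: norm_mult)
      also have "\<dots> \<le> 1 * (real m + 1)" using cut clip_le by (intro mult_mono) auto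
      finally show ?thesis using True by simp
    next
      case False
      then have "real m + 1 < \<bar>x\<bar>" by auto
      then show ?thesis using cut(3) by simp
    qed
    show "cmod (b m n x) \<le> (real m + 1) * indicator {-(real m + 1)..real m + 1} x" for n x unfolding b_def by (rule B)
    show "cmod (a m x) \<le> (real m + 1) * indicator {-(real m + 1)..real m + 1} x" for x unfolding a_def by (rule B)
  qed
  have "\<exists>n. L2_norm (\<lambda>x. b m n x - a m x) < 1 / real (Suc m)" for m
  proof -
    have "(\<lambda>n. L2_norm (\<lambda>x. b m n x - a m x)) \<longlonglongrightarrow> 0" using ba[of m] by (simp add: L2_tendsto_def)
    then have "\<forall>\<^sub>F n in sequentially. L2_norm (\<lambda>x. b m n x - a m x) < 1 / real (Suc m)"
      by (rule order_tendstoD) simp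
    then show ?thesis by (auto simp: eventually_sequentially)
  qed
  then obtain k where k: "\<And>m. L2_norm (\<lambda>x. b m (k m) x - a m x) < 1 / real (Suc m)" by metis
  define h where "h m = b m (k m)" for m
  have L: "in_L2 (h m)" "in_L2 (a m)" for m using ba[of m] af by (auto simp: L2_tendsto_def h_def)
  have "(\<lambda>m. L2_norm (\<lambda>x. h m x - f x)) \<longlonglongrightarrow> 0"
  proof (rule Lim_null_comparison[OF always_eventually])
    show "\<forall>m. norm (L2_norm (\<lambda>x. h m x - f x)) \<le> 1 / real (Suc m) + L2_norm (\<lambda>x. a m x - f x)"
    proof
      fix m
      show "norm (L2_norm (\<lambda>x. h m x - f x)) \<le> 1 / real (Suc m) + L2_norm (\<lambda>x. a m x - f x)"
        using L2_norm_diff_triangle[OF L(1)[of m] L(2)[of m] f] k[of m] L2_norm_nonneg[of "\<lambda>x. h m x - f x"]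
        unfolding h_def by simp
    qed
    have "(\<lambda>m. 1 / real (Suc m) + L2_norm (\<lambda>x. a m x - f x)) \<longlonglongrightarrow> 0 + 0"
      using af LIMSEQ_inverse_real_of_nat by (intro tendsto_add) (simp_all add: L2_tendsto_def inverse_eq_divide)
    then show "(\<lambda>m. 1 / real (Suc m) + L2_norm (\<lambda>x. a m x - f x)) \<longlonglongrightarrow> 0" by simp
  qed
  then have hf: "L2_tendsto h f" using L f by (simp add: L2_tendsto_def)
  show ?thesis
    by (rule that[of h "\<lambda>m. real m + 1", OF _ _ hf]) (auto simp: h_def bc bz)
qed

text \<open>Weighting by \<open>1 / (1 + x\<^sup>2)\<close> makes an \<open>L\<^sup>2\<close> Cauchy sequence a Cauchy sequence in \<open>L\<^sup>1\<close>.\<close>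

lemma L2_complete:
  assumes F: "\<And>n. in_L2 (F n)"
    and C: "\<And>e. e > 0 \<Longrightarrow> \<exists>N. \<forall>i\<ge>N. \<forall>j\<ge>N. L2_norm (\<lambda>x. F i x - F j x) < e"
  obtains g where "L2_tendsto F g"
proof -
  define w :: "real \<Rightarrow> real" where "w x = 1 / (1 + x\<^sup>2)" for x
  have p: "1 + x\<^sup>2 \<ge> 1" for x :: real by simp
  have w: "0 < w x" "w x \<le> 1" for x
    using p[of x] unfolding w_def by (auto simp: divide_le_eq zero_less_divide_iff add_pos_nonneg)
  have wm0: "w \<in> borel_measurable borel" unfolding w_def[abs_def] by measurable
  have wm [measurable]: "w \<in> borel_measurable lebesgue" by (rule measurable_completion) (simp add: wm0)
  have wi: "integrable lebesgue w"
    using integrable_inverse_1_plus_sq wm0 by (simp add: integrable_completion w_def[abs_def])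
  have w2: "integrable lebesgue (\<lambda>x. (norm (w x))\<^sup>2)"
  proof (rule Bochner_Integration.integrable_bound[OF wi])
    have "(w x)\<^sup>2 \<le> w x" for x using w[of x] by (simp add: power2_eq_square mult_left_le)
    then show "AE x in lebesgue. norm ((norm (w x))\<^sup>2) \<le> norm (w x)" using w(1) by (simp add: less_imp_le)
  qed measurable
  define W where "W = sqrt (LINT x|lebesgue. (norm (w x))\<^sup>2)"
  have Fm [measurable]: "F n \<in> borel_measurable lebesgue" and Fi: "integrable lebesgue (\<lambda>x. (cmod (F n x))\<^sup>2)" for n
    using F[of n] by (auto simp: in_L2_def)
  define s where "s n x = of_real (w x) * F n x" for n x
  have sn: "norm (s n x) = norm (w x) * cmod (F n x)" for n x by (simp add: s_def norm_mult)
  have si: "integrable lebesgue (s n)" for n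
  proof (rule Bochner_Integration.integrable_bound[OF L2_Cauchy_Schwarz(1)[OF wm Fm[of n] w2 Fi[of n]]])
    show "s n \<in> borel_measurable lebesgue" unfolding s_def[abs_def] by measurable
  qed (simp add: sn)
  have "\<exists>N. \<forall>i\<ge>N. \<forall>j\<ge>N. (LINT x|lebesgue. norm (s i x - s j x)) < e" if e: "e > 0" for e
  proof -
    have W0: "W \<ge> 0" by (simp add: W_def)
    obtain N where N: "\<And>i j. i \<ge> N \<Longrightarrow> j \<ge> N \<Longrightarrow> L2_norm (\<lambda>x. F i x - F j x) < e / (W + 1)"
      using C[of "e / (W + 1)"] e W0 by auto
    have "(LINT x|lebesgue. norm (s i x - s j x)) < e" if ij: "i \<ge> N" "j \<ge> N" for i j
    proof -
      have d: "in_L2 (\<lambda>x. F i x - F j x)" by (intro in_L2_diff F)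
      have "norm (s i x - s j x) = norm (w x) * cmod (F i x - F j x)" for x
        unfolding s_def right_diff_distrib[symmetric] norm_mult by simp
      then have "(LINT x|lebesgue. norm (s i x - s j x)) = (LINT x|lebesgue. norm (w x) * cmod (F i x - F j x))" by simp
      also have "\<dots> \<le> W * L2_norm (\<lambda>x. F i x - F j x)"
        unfolding W_def L2_norm_def using d by (intro L2_Cauchy_Schwarz(2) w2) (auto simp: in_L2_def)
      also have "\<dots> \<le> W * (e / (W + 1))" using N[OF ij] W0 by (intro mult_left_mono) auto
      also have "\<dots> < e" using e W0 by (simp add: field_simps)
      finally show ?thesis .
    qed
    then show ?thesis by blast
  qed
  \<comment> \<open>A subsequence of the weighted functions is Cauchy at almost every point; as
    \<open>w\<close> never vanishes, the weight can then be divided out.\<close>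
  from cauchy_L1_AE_cauchy_subseq[OF si this] obtain r where r: "strict_mono r" and ae: "AE x in lebesgue. Cauchy (\<lambda>i. s (r i) x)"
    by blast
  define g where "g x = lim (\<lambda>i. F (r i) x)" for x
  have gm [measurable]: "g \<in> borel_measurable lebesgue" unfolding g_def[abs_def] by measurable
  have lim: "AE x in lebesgue. (\<lambda>i. F (r i) x) \<longlonglongrightarrow> g x"
    using ae
  proof eventually_elim
    case (elim x)
    then obtain l where "(\<lambda>i. s (r i) x) \<longlonglongrightarrow> l" using Cauchy_convergent_iff convergent_def by blast
    then have "(\<lambda>i. of_real (1 / w x) * s (r i) x) \<longlonglongrightarrow> of_real (1 / w x) * l" by (intro tendsto_intros)
    moreover have "of_real (1 / w x) * s (r i) x = F (r i) x" for i using w(1)[of x] by (simp add: s_def)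
    ultimately have "convergent (\<lambda>i. F (r i) x)" unfolding convergent_def by auto
    then show ?case unfolding g_def by (rule convergent_LIMSEQ_iff[THEN iffD1])
  qed
  \<comment> \<open>Fatou along the subsequence, with \<open>n\<close> fixed.\<close>
  have main: "(\<integral>\<^sup>+x. ennreal ((cmod (F n x - g x))\<^sup>2) \<partial>lebesgue) \<le> ennreal (e\<^sup>2)"
    if e: "e > 0" and N: "\<And>i j. i \<ge> N \<Longrightarrow> j \<ge> N \<Longrightarrow> L2_norm (\<lambda>x. F i x - F j x) < e" and n: "n \<ge> N" for e N n
  proof -
    have "(\<integral>\<^sup>+x. ennreal ((cmod (F n x - g x))\<^sup>2) \<partial>lebesgue) = (\<integral>\<^sup>+x. liminf (\<lambda>i. ennreal ((cmod (F n x - F (r i) x))\<^sup>2)) \<partial>lebesgue)"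
    proof (rule nn_integral_cong_AE)
      show "AE x in lebesgue. ennreal ((cmod (F n x - g x))\<^sup>2) = liminf (\<lambda>i. ennreal ((cmod (F n x - F (r i) x))\<^sup>2))"
        using lim
      proof eventually_elim
        case (elim x)
        then have "(\<lambda>i. ennreal ((cmod (F n x - F (r i) x))\<^sup>2)) \<longlonglongrightarrow> ennreal ((cmod (F n x - g x))\<^sup>2)"
          by (intro tendsto_ennrealI tendsto_intros)
        then show ?case by (rule lim_imp_Liminf[OF sequentially_bot, symmetric])
      qed
    qed
    also have "\<dots> \<le> liminf (\<lambda>i. \<integral>\<^sup>+x. ennreal ((cmod (F n x - F (r i) x))\<^sup>2) \<partial>lebesgue)"
      by (rule nn_integral_liminf) measurable
    also have "\<dots> \<le> liminf (\<lambda>i. ennreal (e\<^sup>2))"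
    proof (rule Liminf_mono, rule eventually_sequentiallyI[of N])
      fix i assume "N \<le> i"
      then have "N \<le> r i" using seq_suble[OF r, of i] by linarith
      then have le: "L2_norm (\<lambda>x. F n x - F (r i) x) < e" using N n by blast
      have d: "in_L2 (\<lambda>x. F n x - F (r i) x)" by (intro in_L2_diff F)
      then have "(\<integral>\<^sup>+x. ennreal ((cmod (F n x - F (r i) x))\<^sup>2) \<partial>lebesgue) = ennreal ((L2_norm (\<lambda>x. F n x - F (r i) x))\<^sup>2)"
        unfolding L2_norm_sq by (intro nn_integral_eq_integral) (auto simp: in_L2_def)
      also have "\<dots> \<le> ennreal (e\<^sup>2)"
        using le L2_norm_nonneg[of "\<lambda>x. F n x - F (r i) x"] by (intro ennreal_leI power_mono) auto
      finally show "(\<integral>\<^sup>+x. ennreal ((cmod (F n x - F (r i) x))\<^sup>2) \<partial>lebesgue) \<le> ennreal (e\<^sup>2)" .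
    qed
    also have "\<dots> = ennreal (e\<^sup>2)" by (simp add: Liminf_const)
    finally show ?thesis .
  qed
  have diff: "in_L2 (\<lambda>x. F n x - g x) \<and> L2_norm (\<lambda>x. F n x - g x) \<le> e"
    if e: "e > 0" and N: "\<And>i j. i \<ge> N \<Longrightarrow> j \<ge> N \<Longrightarrow> L2_norm (\<lambda>x. F i x - F j x) < e" and n: "n \<ge> N" for e N n
  proof
    note m = main[OF e N n]
    have i: "integrable lebesgue (\<lambda>x. (cmod (F n x - g x))\<^sup>2)"
      by (rule integrableI_bounded) (use m in \<open>auto intro: le_less_trans\<close>)
    then show "in_L2 (\<lambda>x. F n x - g x)" by (simp add: in_L2_def)
    have "(LINT x|lebesgue. (cmod (F n x - g x))\<^sup>2) \<le> e\<^sup>2"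
      using m unfolding nn_integral_eq_integral[OF i AE_I2[OF zero_le_power2]] by (simp add: ennreal_le_iff)
    then show "L2_norm (\<lambda>x. F n x - g x) \<le> e" unfolding L2_norm_def using e by (intro real_le_lsqrt) auto
  qed
  obtain N1 where N1: "\<And>i j. i \<ge> N1 \<Longrightarrow> j \<ge> N1 \<Longrightarrow> L2_norm (\<lambda>x. F i x - F j x) < 1" using C[of 1] by auto
  have "in_L2 (\<lambda>x. F N1 x - g x)" using diff[OF _ N1 order_refl] by simp
  from in_L2_diff(1)[OF F[of N1] this] have gL: "in_L2 g" by simp
  have "(\<lambda>n. L2_norm (\<lambda>x. F n x - g x)) \<longlonglongrightarrow> 0"
  proof (rule LIMSEQ_I)
    fix e :: real assume e: "e > 0"
    obtain N where "\<And>i j. i \<ge> N \<Longrightarrow> j \<ge> N \<Longrightarrow> L2_norm (\<lambda>x. F i x - F j x) < e / 2" using C[of "e / 2"] e by auto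
    then have half: "L2_norm (\<lambda>x. F n x - g x) \<le> e / 2" if "n \<ge> N" for n
      using diff[of "e / 2" N n] e that by simp
    have "norm (L2_norm (\<lambda>x. F n x - g x) - 0) < e" if "n \<ge> N" for n
      unfolding diff_zero real_norm_def using half[OF that] e L2_norm_nonneg[of "\<lambda>x. F n x - g x"] by linarith
    then show "\<exists>no. \<forall>n\<ge>no. norm (L2_norm (\<lambda>x. F n x - g x) - 0) < e" by blast
  qed
  then show ?thesis using that F gL by (simp add: L2_tendsto_def)
qed

section \<open>The Fourier transform of square integrable functions\<close>

lemma fourier_L2:
  assumes h: "in_L1 h" "in_L2 h"
  shows "in_L2 (fourier h)" and "L2_norm (fourier h) \<le> L2_norm h"
proof -
  have "h \<in> borel_measurable lebesgue" using h by (simp add: in_L2_def)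
  then obtain k where k [measurable]: "k \<in> borel_measurable borel" and ae: "AE x in lborel. h x = k x"
    by (rule lebesgue_borel_representative)
  have k1: "integrable lborel k" using h(1) lebesgue_integral_AE_eq(3)[OF k ae] by (simp add: in_L1_def)
  have k2: "integrable lborel (\<lambda>x. (cmod (k x))\<^sup>2)" using h(2) L2_borel(1)[OF k ae] by simp
  have e: "fourier h = FT k" by (rule fourier_borel[OF k ae])
  have m: "FT k \<in> borel_measurable borel" by measurable
  show "in_L2 (fourier h)" unfolding e L2_borel(1)[OF m AE_I2[OF refl]] by (rule Bessel(1)[OF k1 k2])
  show "L2_norm (fourier h) \<le> L2_norm h"
    unfolding e L2_borel(2)[OF m AE_I2[OF refl]] L2_borel(2)[OF k ae] using Bessel(2)[OF k1 k2] by simp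
qed

lemma fourier_diff:
  assumes "in_L1 f" "in_L1 g"
  shows "fourier (\<lambda>x. f x - g x) = (\<lambda>\<xi>. fourier f \<xi> - fourier g \<xi>)"
proof
  fix \<xi>
  have e: "exp (- 2 * of_real pi * \<i> * of_real x * of_real \<xi>) = cis (- (2 * pi * x * \<xi>))" for x
    by (simp add: cis_conv_exp mult_ac)
  have m: "(\<lambda>x. - (2 * pi * x * \<xi>)) \<in> borel_measurable lebesgue" by (rule measurable_completion) simp
  have "integrable lebesgue (\<lambda>x. k x * cis (- (2 * pi * x * \<xi>)))" if "in_L1 k" for k
    using that m unfolding in_L1_def by (rule integrable_mult_cis)
  then show "fourier (\<lambda>x. f x - g x) \<xi> = fourier f \<xi> - fourier g \<xi>"
    unfolding fourier_def e using assms by (simp add: left_diff_distrib)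
qed

text \<open>\<open>L2_fourier\<close> is a choice, so nothing is known about it before some function
  meets its specification. The transforms of one approximating sequence are Cauchy because the
  transform is a contraction; any other sequence has the same limit, by comparing the two term by
  term.\<close>

lemma is_L2_fourier_exists:
  assumes f: "in_L2 f"
  shows "is_L2_fourier f (L2_fourier f)"
proof -
  obtain h R where hc: "\<And>n::nat. continuous_on UNIV (h n)"
    and hz: "\<And>n x. R n < \<bar>x\<bar> \<Longrightarrow> h n x = 0" and hf: "L2_tendsto h f"
    by (rule L2_approx_continuous[OF f]) (rule that)
  have h2: "in_L2 (h n)" for n using hf by (simp add: L2_tendsto_def)
  have h1: "in_L1 (h n)" for n
  proof -
    have "continuous_on UNIV (h n)" by (rule hc)
    then have m: "h n \<in> borel_measurable borel" by (rule borel_measurable_continuous_onI)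
    have "integrable lborel (h n)" by (rule compact_support_integrable(1)[OF hc hz])
    then show ?thesis using lebesgue_integral_AE_eq(3)[OF m AE_I2[OF refl]] by (simp add: in_L1_def)
  qed
  have dist: "in_L2 (fourier a)" "L2_norm (\<lambda>\<xi>. fourier a \<xi> - fourier b \<xi>) \<le> L2_norm (\<lambda>x. a x - b x)"
    if "in_L1 a" "in_L2 a" "in_L1 b" "in_L2 b" for a b
  proof -
    show "in_L2 (fourier a)" by (rule fourier_L2) fact+
    have "in_L1 (\<lambda>x. a x - b x)" using that by (simp add: in_L1_def)
    then have "L2_norm (fourier (\<lambda>x. a x - b x)) \<le> L2_norm (\<lambda>x. a x - b x)"
      by (intro fourier_L2 in_L2_diff that)
    then show "L2_norm (\<lambda>\<xi>. fourier a \<xi> - fourier b \<xi>) \<le> L2_norm (\<lambda>x. a x - b x)"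
      using fourier_diff that by simp
  qed
  have lim: "(\<lambda>n. L2_norm (\<lambda>x. h n x - f x)) \<longlonglongrightarrow> 0" using hf by (simp add: L2_tendsto_def)
  have "\<exists>N. \<forall>i\<ge>N. \<forall>j\<ge>N. L2_norm (\<lambda>\<xi>. fourier (h i) \<xi> - fourier (h j) \<xi>) < e" if e: "e > 0" for e
  proof -
    have "\<forall>\<^sub>F n in sequentially. L2_norm (\<lambda>x. h n x - f x) < e / 2"
      using lim e by (intro order_tendstoD) auto
    then obtain N where N: "\<And>n. n \<ge> N \<Longrightarrow> L2_norm (\<lambda>x. h n x - f x) < e / 2" by (auto simp: eventually_sequentially)
    have "L2_norm (\<lambda>\<xi>. fourier (h i) \<xi> - fourier (h j) \<xi>) < e" if "i \<ge> N" "j \<ge> N" for i j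
      using dist(2)[OF h1 h2 h1 h2, of i j] L2_norm_diff_triangle[OF h2[of i] f h2[of j]] N[OF that(1)] N[OF that(2)]
      by (simp add: L2_norm_minus_commute[of f])
    then show ?thesis by blast
  qed
  then obtain g where g: "L2_tendsto (\<lambda>n. fourier (h n)) g"
    using L2_complete[of "\<lambda>n. fourier (h n)"] fourier_L2(1)[OF h1 h2] by blast
  have gL: "in_L2 g" using g by (simp add: L2_tendsto_def)
  have "is_L2_fourier f g"
    unfolding is_L2_fourier_def
  proof (intro conjI allI impI gL)
    fix k assume k: "(\<forall>n. in_L1 (k n)) \<and> L2_tendsto k f"
    then have k1: "in_L1 (k n)" and k2: "in_L2 (k n)" for n by (auto simp: L2_tendsto_def)
    have klim: "(\<lambda>n. L2_norm (\<lambda>x. k n x - f x)) \<longlonglongrightarrow> 0" using k by (simp add: L2_tendsto_def)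
    have glim: "(\<lambda>n. L2_norm (\<lambda>\<xi>. fourier (h n) \<xi> - g \<xi>)) \<longlonglongrightarrow> 0" using g by (simp add: L2_tendsto_def)
    have "(\<lambda>n. L2_norm (\<lambda>\<xi>. fourier (k n) \<xi> - g \<xi>)) \<longlonglongrightarrow> 0"
    proof (rule Lim_null_comparison[OF always_eventually])
      show "\<forall>n. norm (L2_norm (\<lambda>\<xi>. fourier (k n) \<xi> - g \<xi>)) \<le>
        (L2_norm (\<lambda>x. k n x - f x) + L2_norm (\<lambda>x. h n x - f x)) + L2_norm (\<lambda>\<xi>. fourier (h n) \<xi> - g \<xi>)"
      proof
        fix n
        show "norm (L2_norm (\<lambda>\<xi>. fourier (k n) \<xi> - g \<xi>)) \<le>
        (L2_norm (\<lambda>x. k n x - f x) + L2_norm (\<lambda>x. h n x - f x)) + L2_norm (\<lambda>\<xi>. fourier (h n) \<xi> - g \<xi>)"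
          using L2_norm_diff_triangle[OF dist(1)[OF k1 k2 k1 k2, of n] dist(1)[OF h1 h2 h1 h2, of n] gL]
            dist(2)[OF k1 k2 h1 h2, of n n] L2_norm_diff_triangle[OF k2[of n] f h2[of n]]
            L2_norm_nonneg[of "\<lambda>\<xi>. fourier (k n) \<xi> - g \<xi>"]
          by (simp add: L2_norm_minus_commute[of f])
      qed
      show "(\<lambda>n. (L2_norm (\<lambda>x. k n x - f x) + L2_norm (\<lambda>x. h n x - f x)) + L2_norm (\<lambda>\<xi>. fourier (h n) \<xi> - g \<xi>)) \<longlonglongrightarrow> 0"
        using tendsto_add[OF tendsto_add[OF klim lim] glim] by simp
    qed
    then show "L2_tendsto (\<lambda>n. fourier (k n)) g"
      using gL dist(1)[OF k1 k2 k1 k2] by (simp add: L2_tendsto_def)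
  qed
  then show ?thesis unfolding L2_fourier_def by (rule someI[where P="is_L2_fourier f"])
qed

section \<open>The trilinear form\<close>

lemma borel_measurable_mollify [measurable]:
  assumes [measurable]: "f \<in> borel_measurable borel"
  shows "mollify \<epsilon> f \<in> borel_measurable borel"
  unfolding mollify_def[abs_def] by measurable

lemma FT_uminus: "(LINT x|lborel. f x * cis (2 * pi * x * u)) = FT f (- u)"
  by (simp add: FT_def)

lemma FT_flip_L2:
  assumes f: "integrable lborel f" and f2: "integrable lborel (\<lambda>x. (cmod (f x))\<^sup>2)"
  shows "integrable lborel (\<lambda>u. (cmod (FT f (c - u)))\<^sup>2)"
    and "(LINT u|lborel. (cmod (FT f (c - u)))\<^sup>2) \<le> (LINT x|lborel. (cmod (f x))\<^sup>2)"
proof -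
  show "integrable lborel (\<lambda>u. (cmod (FT f (c - u)))\<^sup>2)"
    using Bessel(1)[OF f f2] by (subst lborel_integrable_shift(4))
  have "(LINT u|lborel. (cmod (FT f (c - u)))\<^sup>2) = (LINT u|lborel. (cmod (FT f u))\<^sup>2)" by (rule lborel_integral_shift(4))
  then show "(LINT u|lborel. (cmod (FT f (c - u)))\<^sup>2) \<le> (LINT x|lborel. (cmod (f x))\<^sup>2)"
    using Bessel(2)[OF f f2] by simp
qed

lemma sobolev_weight_integral_nonneg: "0 \<le> (LINT x|lborel. (cmod (k x))\<^sup>2 * sobolev_weight x)"
  using sobolev_weight_bounds(1) by (intro integral_nonneg_AE) (auto simp: less_imp_le)

definition trilinear_const :: real where "trilinear_const = 2 + 6 / (1 - 2 powr (-1/32))"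

lemma trilinear_const_pos: "trilinear_const > 0"
proof -
  have "(2::real) powr (-1/32) < 1" using powr_less_mono[of "-1/32" 0 "2::real"] by auto
  then show ?thesis by (simp add: trilinear_const_def add_pos_pos)
qed

section \<open>From the multiplier to the trilinear form\<close>

text \<open>The parameter \<open>\<theta>\<close>, which stems from the expansion of the cutoff, is
  absorbed by translating the spectra of \<open>h1\<close> and \<open>f0\<close>, which changes no
  norm; the Gaussian factors in \<open>gauss_cutoff\<close> only shrink the spectra. Hence the bound
  is uniform in \<open>\<theta>\<close> and \<open>\<epsilon>\<close>.\<close>

lemma multiplier_form_bound:
  fixes f0 h1 h2 :: "real \<Rightarrow> complex"
  assumes f0: "integrable lborel f0" "integrable lborel (\<lambda>x. (cmod (f0 x))\<^sup>2)"
    and h1: "integrable lborel h1" "integrable lborel (\<lambda>x. (cmod (h1 x))\<^sup>2)"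
    and h2: "integrable lborel h2" "integrable lborel (\<lambda>x. (cmod (h2 x))\<^sup>2)"
    and e: "\<epsilon> > 0"
  defines "W \<equiv> sqrt (LINT \<xi>|lborel. (cmod (FT h2 \<xi>))\<^sup>2 * sobolev_weight \<xi>)"
  shows "cmod (LINT a|lborel. gauss_cutoff \<epsilon> h2 a * (LINT \<xi>|lborel. gauss_cutoff \<epsilon> h1 \<xi> * (FT f0 (- (a + \<xi>)) * gmult a (\<xi> + \<theta>))))
    \<le> trilinear_const * W * (sqrt (LINT x|lborel. (cmod (h1 x))\<^sup>2) * sqrt (LINT x|lborel. (cmod (f0 x))\<^sup>2))"
proof -
  have [measurable]: "f0 \<in> borel_measurable borel" "h1 \<in> borel_measurable borel" "h2 \<in> borel_measurable borel"
    using f0 h1 h2 by auto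
  have [measurable]: "gauss_cutoff \<epsilon> h1 \<in> borel_measurable borel" "gauss_cutoff \<epsilon> h2 \<in> borel_measurable borel"
    unfolding gauss_cutoff_def[abs_def] by measurable
  have cut: "cmod (gauss_cutoff \<epsilon> h \<xi>) \<le> cmod (FT h \<xi>)" for h \<xi>
    by (simp add: gauss_cutoff_def norm_mult mult_left_le)
  have cut2: "integrable lborel (\<lambda>\<xi>. (cmod (gauss_cutoff \<epsilon> h \<xi>))\<^sup>2)"
    "(LINT \<xi>|lborel. (cmod (gauss_cutoff \<epsilon> h \<xi>))\<^sup>2) \<le> (LINT x|lborel. (cmod (h x))\<^sup>2)"
    if h: "integrable lborel h" "integrable lborel (\<lambda>x. (cmod (h x))\<^sup>2)" for h
  proof -
    have [measurable]: "h \<in> borel_measurable borel" using h by auto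
    have [measurable]: "gauss_cutoff \<epsilon> h \<in> borel_measurable borel" unfolding gauss_cutoff_def[abs_def] by measurable
    show i: "integrable lborel (\<lambda>\<xi>. (cmod (gauss_cutoff \<epsilon> h \<xi>))\<^sup>2)"
      by (rule Bochner_Integration.integrable_bound[OF Bessel(1)[OF h]]) (auto intro!: power_mono cut)
    have "(LINT \<xi>|lborel. (cmod (gauss_cutoff \<epsilon> h \<xi>))\<^sup>2) \<le> (LINT \<xi>|lborel. (cmod (FT h \<xi>))\<^sup>2)"
      by (intro integral_mono i Bessel(1) h power_mono cut) auto
    with Bessel(2)[OF h] show "(LINT \<xi>|lborel. (cmod (gauss_cutoff \<epsilon> h \<xi>))\<^sup>2) \<le> (LINT x|lborel. (cmod (h x))\<^sup>2)" by linarith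
  qed
  \<comment> \<open>A common bound for \<open>\<phi>\<close> and for the spectrum of
    \<open>h2\<close>, since \<open>dyadic_bound\<close> works with a single one.\<close>
  define B where "B = (LINT x|lborel. cmod (f0 x)) + (LINT x|lborel. cmod (h2 x))"
  define g1 where "g1 \<xi> = gauss_cutoff \<epsilon> h1 (\<xi> - \<theta>)" for \<xi>
  define \<phi> where "\<phi> u = FT f0 (\<theta> - u)" for u
  have fB: "cmod (FT f0 x) \<le> B" "cmod (FT h2 x) \<le> B" for x
    using norm_FT_le[of f0 x] norm_FT_le[of h2 x] by (auto simp: B_def intro: add_increasing add_increasing2)
  have g1L2: "(LINT x|lborel. (cmod (g1 x))\<^sup>2) \<le> (LINT x|lborel. (cmod (h1 x))\<^sup>2)"
  proof -
    have "(LINT x|lborel. (cmod (g1 x))\<^sup>2) = (LINT x|lborel. (cmod (gauss_cutoff \<epsilon> h1 x))\<^sup>2)"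
      unfolding g1_def by (rule lborel_integral_shift(3))
    with cut2(2)[OF h1] show ?thesis by simp
  qed
  interpret M: multiplier_data g1 \<phi> B
  proof
    show "integrable lborel g1" unfolding g1_def[abs_def]
      using gauss_cutoff_integrable[OF h1(1) e] by (simp only: lborel_integrable_shift(3))
    show "integrable lborel (\<lambda>x. (cmod (g1 x))\<^sup>2)" unfolding g1_def
      using cut2(1)[OF h1] by (subst lborel_integrable_shift(3))
    show "\<phi> \<in> borel_measurable borel" unfolding \<phi>_def[abs_def] by measurable
    show "integrable lborel (\<lambda>x. (cmod (\<phi> x))\<^sup>2)" unfolding \<phi>_def by (rule FT_flip_L2(1)[OF f0])
    show "cmod (\<phi> x) \<le> B" for x unfolding \<phi>_def by (rule fB)
  qed
  have L: "(LINT \<xi>|lborel. gauss_cutoff \<epsilon> h1 \<xi> * (FT f0 (- (a + \<xi>)) * gmult a (\<xi> + \<theta>))) = M.L a" for a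
  proof -
    have "M.L a = (LINT \<xi>|lborel. g1 (\<xi> + \<theta>) * \<phi> (a + (\<xi> + \<theta>)) * gmult a (\<xi> + \<theta>))"
      unfolding M.L_def by (rule lborel_integral_shift(1)[symmetric])
    then show ?thesis by (simp add: g1_def \<phi>_def mult.assoc algebra_simps)
  qed
  have Wb: "integrable lborel (\<lambda>x. (cmod (k x))\<^sup>2 * sobolev_weight x)"
    if "integrable lborel (\<lambda>x. (cmod (k x))\<^sup>2)" and [measurable]: "k \<in> borel_measurable borel" for k :: "real \<Rightarrow> complex"
  proof (rule Bochner_Integration.integrable_bound[OF that(1)])
    show "AE x in lborel. norm ((cmod (k x))\<^sup>2 * sobolev_weight x) \<le> norm ((cmod (k x))\<^sup>2)"
      using sobolev_weight_bounds by (auto simp: abs_mult less_imp_le intro!: mult_left_le)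
  qed measurable
  have "cmod (LINT a|lborel. gauss_cutoff \<epsilon> h2 a * M.L a) \<le>
    trilinear_const * sqrt (LINT x|lborel. (cmod (gauss_cutoff \<epsilon> h2 x))\<^sup>2 * sobolev_weight x) * M.Q"
    unfolding trilinear_const_def
    by (rule M.dyadic_bound[OF gauss_cutoff_integrable[OF h2(1) e] cut2(1)[OF h2] order_trans[OF cut fB(2)]])
  also have "\<dots> \<le> trilinear_const * W * (sqrt (LINT x|lborel. (cmod (h1 x))\<^sup>2) * sqrt (LINT x|lborel. (cmod (f0 x))\<^sup>2))"
  proof (intro mult_mono)
    show "sqrt (LINT x|lborel. (cmod (gauss_cutoff \<epsilon> h2 x))\<^sup>2 * sobolev_weight x) \<le> W"
      unfolding W_def using sobolev_weight_bounds(1)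
      by (intro real_sqrt_le_mono integral_mono Wb cut2 h2 Bessel(1) mult_right_mono power_mono cut) (auto simp: less_imp_le)
    show "M.Q \<le> sqrt (LINT x|lborel. (cmod (h1 x))\<^sup>2) * sqrt (LINT x|lborel. (cmod (f0 x))\<^sup>2)"
      unfolding M.Q_def using g1L2 FT_flip_L2(2)[OF f0] by (intro mult_mono real_sqrt_le_mono) (auto simp: \<phi>_def)
    show "trilinear_const * W \<ge> 0"
      using trilinear_const_pos sobolev_weight_integral_nonneg[of "FT h2"] unfolding W_def by simp
  qed (use trilinear_const_pos M.Q_nonneg sobolev_weight_integral_nonneg in auto)
  finally show ?thesis unfolding L .
qed

text \<open>Three uses of \<open>fourier_swap\<close> expand the cutoff, then the mollified
  \<open>h2\<close>, then the mollified \<open>h1\<close>. What is left in \<open>(x, t)\<close> is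
  a product, giving the transform of \<open>f0\<close> and \<open>gmult\<close>. Mollification makes
  the spectra integrable, which justifies the exchanges.\<close>

lemma trilinear_mollified:
  fixes f0 h1 h2 \<Psi> :: "real \<Rightarrow> complex" and chi :: "real \<Rightarrow> real"
  assumes f0: "integrable lborel f0" "integrable lborel (\<lambda>x. (cmod (f0 x))\<^sup>2)"
    and h1: "integrable lborel h1" "integrable lborel (\<lambda>x. (cmod (h1 x))\<^sup>2)" "\<And>x. cmod (h1 x) \<le> B"
    and h2: "integrable lborel h2" "integrable lborel (\<lambda>x. (cmod (h2 x))\<^sup>2)" "\<And>x. cmod (h2 x) \<le> B"
    and \<Psi>: "integrable lborel \<Psi>"
    and chi: "\<And>t. complex_of_real (chi t) = of_real (exp (- (pi * t\<^sup>2))) * (LINT \<theta>|lborel. \<Psi> \<theta> * cis (2 * pi * t * \<theta>))"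
    and e: "\<epsilon> > 0"
  shows "cmod (LINT w|lborel. f0 (fst w) * mollify \<epsilon> h1 (fst w + snd w) * mollify \<epsilon> h2 (fst w + (snd w)\<^sup>2) * of_real (chi (snd w)))
    \<le> (LINT \<theta>|lborel. cmod (\<Psi> \<theta>)) * (trilinear_const * sqrt (LINT \<xi>|lborel. (cmod (FT h2 \<xi>))\<^sup>2 * sobolev_weight \<xi>) *
      (sqrt (LINT x|lborel. (cmod (h1 x))\<^sup>2) * sqrt (LINT x|lborel. (cmod (f0 x))\<^sup>2)))"
proof -
  have m0 [measurable]: "f0 \<in> borel_measurable borel" "h1 \<in> borel_measurable borel" "h2 \<in> borel_measurable borel"
    "\<Psi> \<in> borel_measurable borel"
    using f0 h1 h2 \<Psi> by auto
  define \<gamma> where "\<gamma> t = complex_of_real (exp (- (pi * t\<^sup>2)))" for t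
  have [measurable]: "\<gamma> \<in> borel_measurable borel" unfolding \<gamma>_def[abs_def] by measurable
  have \<gamma>i: "integrable lborel \<gamma>" unfolding \<gamma>_def[abs_def] using gauss_integrable_one(1) by (simp only: complex_of_real_integrable_eq)
  have base: "integrable lborel (\<lambda>w. f0 (fst w) * \<gamma> (snd w))" by (rule integral_pair_mult(1)[OF f0(1) \<gamma>i])
  have B0: "B \<ge> 0" using h1(3) norm_ge_zero order_trans by blast
  \<comment> \<open>Every integrand on the plane that occurs below is dominated by a multiple of one
    product function.\<close>
  have dom: "integrable lborel k" if [measurable]: "k \<in> borel_measurable lborel" and le: "\<And>w. cmod (k w) \<le> c * cmod (f0 (fst w) * \<gamma> (snd w))"
    for k :: "real \<times> real \<Rightarrow> complex" and c
  proof (rule Bochner_Integration.integrable_bound)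
    show "integrable lborel (\<lambda>w. c * cmod (f0 (fst w) * \<gamma> (snd w)))" using base by (intro integrable_mult_right integrable_norm)
    show "AE w in lborel. cmod (k w) \<le> norm (c * cmod (f0 (fst w) * \<gamma> (snd w)))"
      by (rule AE_I2, rule order_trans[OF le], simp only: real_norm_def abs_ge_self)
  qed measurable
  let ?m1 = "mollify \<epsilon> h1" and ?m2 = "mollify \<epsilon> h2"
  let ?g1 = "gauss_cutoff \<epsilon> h1" and ?g2 = "gauss_cutoff \<epsilon> h2"
  have mb: "cmod (?m1 x) \<le> B" "cmod (?m2 x) \<le> B" for x by (intro norm_mollify_le h1 h2)+
  define k0 where "k0 w = f0 (fst w) * ?m1 (fst w + snd w) * ?m2 (fst w + (snd w)\<^sup>2) * \<gamma> (snd w)" for w :: "real \<times> real"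
  have mk: "k0 \<in> borel_measurable lborel" unfolding k0_def[abs_def] lborel_prod[symmetric] by measurable
  have k0: "integrable lborel k0"
  proof (rule dom[OF mk])
    fix w :: "real \<times> real"
    have "cmod (?m1 (fst w + snd w)) * cmod (?m2 (fst w + (snd w)\<^sup>2)) \<le> B * B"
      by (intro mult_mono mb B0 norm_ge_zero)
    then have "cmod (f0 (fst w) * \<gamma> (snd w)) * (cmod (?m1 (fst w + snd w)) * cmod (?m2 (fst w + (snd w)\<^sup>2))) \<le> cmod (f0 (fst w) * \<gamma> (snd w)) * (B * B)"
      by (intro mult_left_mono) auto
    then show "cmod (k0 w) \<le> (B * B) * cmod (f0 (fst w) * \<gamma> (snd w))"
      by (simp add: k0_def norm_mult mult_ac)
  qed
  define A where "A \<theta> = (LINT w|lborel. k0 w * cis (2 * pi * snd w * \<theta>))" for \<theta>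
  have sndm: "(snd :: real \<times> real \<Rightarrow> real) \<in> borel_measurable borel"
    "(\<lambda>w :: real \<times> real. fst w + (snd w)\<^sup>2) \<in> borel_measurable borel"
    "(\<lambda>w :: real \<times> real. fst w + snd w) \<in> borel_measurable borel"
    unfolding borel_prod[symmetric] by measurable
  note step1 = fourier_swap[OF k0 \<Psi> sndm(1), folded A_def]
  have lhs: "(LINT w|lborel. f0 (fst w) * ?m1 (fst w + snd w) * ?m2 (fst w + (snd w)\<^sup>2) * of_real (chi (snd w))) = (LINT \<theta>|lborel. \<Psi> \<theta> * A \<theta>)"
    unfolding step1(2)[symmetric] chi k0_def \<gamma>_def by (simp only: mult_ac)
  have A: "A \<theta> = (LINT a|lborel. ?g2 a * (LINT \<xi>|lborel. ?g1 \<xi> * (FT f0 (- (a + \<xi>)) * gmult a (\<xi> + \<theta>))))" for \<theta>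
  proof -
    define k1 where "k1 w = f0 (fst w) * ?m1 (fst w + snd w) * \<gamma> (snd w) * cis (2 * pi * snd w * \<theta>)" for w :: "real \<times> real"
    have mk1: "k1 \<in> borel_measurable lborel" unfolding k1_def[abs_def] lborel_prod[symmetric] by measurable
    have k1: "integrable lborel k1"
    proof (rule dom[OF mk1])
      show "cmod (k1 w) \<le> B * cmod (f0 (fst w) * \<gamma> (snd w))" for w
        using mult_left_mono[OF mb(1)[of "fst w + snd w"], of "cmod (f0 (fst w) * \<gamma> (snd w))"]
        by (simp add: k1_def norm_mult mult_ac)
    qed
    have in2: "(LINT w|lborel. k1 w * cis (2 * pi * (fst w + (snd w)\<^sup>2) * a)) =
       (LINT \<xi>|lborel. ?g1 \<xi> * (FT f0 (- (a + \<xi>)) * gmult a (\<xi> + \<theta>)))" for a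
    proof -
      define k2 where "k2 w = f0 (fst w) * \<gamma> (snd w) * cis (2 * pi * snd w * \<theta>) * cis (2 * pi * (fst w + (snd w)\<^sup>2) * a)" for w :: "real \<times> real"
      have mk2: "k2 \<in> borel_measurable lborel" unfolding k2_def[abs_def] lborel_prod[symmetric] by measurable
      have k2: "integrable lborel k2"
        by (rule dom[OF mk2, of 1]) (simp add: k2_def norm_mult)
      have in3: "(LINT w|lborel. k2 w * cis (2 * pi * (fst w + snd w) * \<xi>)) = FT f0 (- (a + \<xi>)) * gmult a (\<xi> + \<theta>)" for \<xi>
      proof -
        let ?p = "\<lambda>x. f0 x * cis (2 * pi * x * (a + \<xi>))"
        let ?q = "\<lambda>t. \<gamma> t * cis (2 * pi * (a * t\<^sup>2 + (\<xi> + \<theta>) * t))"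
        have eq: "k2 w * cis (2 * pi * (fst w + snd w) * \<xi>) = ?p (fst w) * ?q (snd w)" for w
        proof -
          \<comment> \<open>The total phase
            \<open>t \<theta> + (x + t\<^sup>2) a + (x + t) \<xi>\<close>, sorted by
            \<open>x\<close> and \<open>t\<close>.\<close>
          have c: "cis (2 * pi * snd w * \<theta>) * cis (2 * pi * (fst w + (snd w)\<^sup>2) * a) * cis (2 * pi * (fst w + snd w) * \<xi>)
            = cis (2 * pi * fst w * (a + \<xi>)) * cis (2 * pi * (a * (snd w)\<^sup>2 + (\<xi> + \<theta>) * snd w))"
            unfolding cis_mult by (rule arg_cong[where f=cis]) (simp add: algebra_simps)
          have "k2 w * cis (2 * pi * (fst w + snd w) * \<xi>) = f0 (fst w) * \<gamma> (snd w) *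
            (cis (2 * pi * snd w * \<theta>) * cis (2 * pi * (fst w + (snd w)\<^sup>2) * a) * cis (2 * pi * (fst w + snd w) * \<xi>))"
            by (simp add: k2_def mult.assoc)
          then show ?thesis unfolding c by (simp only: mult_ac)
        qed
        have "(LINT w|lborel. ?p (fst w) * ?q (snd w)) = (LINT x|lborel. ?p x) * (LINT t|lborel. ?q t)"
          by (intro integral_pair_mult(2) integrable_mult_cis f0(1) \<gamma>i) measurable
        then show ?thesis unfolding eq FT_uminus gmult_eq_integral \<gamma>_def .
      qed
      have "(LINT w|lborel. k1 w * cis (2 * pi * (fst w + (snd w)\<^sup>2) * a)) =
        (LINT w|lborel. k2 w * (LINT \<xi>|lborel. ?g1 \<xi> * cis (2 * pi * (fst w + snd w) * \<xi>)))"
        unfolding k1_def k2_def mollify_eq[OF h1(1) e, symmetric] by (simp only: mult_ac)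
      also have "\<dots> = (LINT \<xi>|lborel. ?g1 \<xi> * (LINT w|lborel. k2 w * cis (2 * pi * (fst w + snd w) * \<xi>)))"
        by (rule fourier_swap(2)[OF k2 gauss_cutoff_integrable[OF h1(1) e] sndm(3)])
      finally show ?thesis unfolding in3 .
    qed
    have "A \<theta> = (LINT w|lborel. k1 w * (LINT a|lborel. ?g2 a * cis (2 * pi * (fst w + (snd w)\<^sup>2) * a)))"
      unfolding A_def k0_def k1_def mollify_eq[OF h2(1) e, symmetric] by (simp only: mult_ac)
    also have "\<dots> = (LINT a|lborel. ?g2 a * (LINT w|lborel. k1 w * cis (2 * pi * (fst w + (snd w)\<^sup>2) * a)))"
      by (rule fourier_swap(2)[OF k1 gauss_cutoff_integrable[OF h2(1) e] sndm(2)])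
    finally show ?thesis unfolding in2 .
  qed
  define C where "C = trilinear_const * sqrt (LINT \<xi>|lborel. (cmod (FT h2 \<xi>))\<^sup>2 * sobolev_weight \<xi>) *
      (sqrt (LINT x|lborel. (cmod (h1 x))\<^sup>2) * sqrt (LINT x|lborel. (cmod (f0 x))\<^sup>2))"
  have Ab: "cmod (A \<theta>) \<le> C" for \<theta>
    unfolding A C_def by (rule multiplier_form_bound[OF f0 h1(1,2) h2(1,2) e])
  have "cmod (LINT \<theta>|lborel. \<Psi> \<theta> * A \<theta>) \<le> (LINT \<theta>|lborel. cmod (\<Psi> \<theta>) * C)"
  proof (rule Bochner_Integration.integral_norm_bound_integral[OF step1(1)])
    show "integrable lborel (\<lambda>\<theta>. cmod (\<Psi> \<theta>) * C)" using \<Psi> by simp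
    show "cmod (\<Psi> \<theta> * A \<theta>) \<le> cmod (\<Psi> \<theta>) * C" for \<theta>
      unfolding norm_mult by (intro mult_left_mono Ab) simp
  qed
  then show ?thesis unfolding lhs C_def by simp
qed

text \<open>The bound for mollified functions has a right side free of \<open>\<epsilon>\<close>, so
  only the left side needs a limit. Continuity and boundedness of \<open>h1\<close> and
  \<open>h2\<close> reduce it to dominated convergence.\<close>

lemma trilinear_continuous:
  fixes f0 h1 h2 \<Psi> :: "real \<Rightarrow> complex" and chi :: "real \<Rightarrow> real"
  assumes f0: "integrable lborel f0" "integrable lborel (\<lambda>x. (cmod (f0 x))\<^sup>2)"
    and h1: "continuous_on UNIV h1" "\<And>x. R < \<bar>x\<bar> \<Longrightarrow> h1 x = 0"
    and h2: "continuous_on UNIV h2" "\<And>x. R < \<bar>x\<bar> \<Longrightarrow> h2 x = 0"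
    and \<Psi>: "integrable lborel \<Psi>"
    and chi: "\<And>t. complex_of_real (chi t) = of_real (exp (- (pi * t\<^sup>2))) * (LINT \<theta>|lborel. \<Psi> \<theta> * cis (2 * pi * t * \<theta>))"
    and chii: "integrable lborel chi"
  shows "cmod (LINT w|lborel. f0 (fst w) * h1 (fst w + snd w) * h2 (fst w + (snd w)\<^sup>2) * of_real (chi (snd w)))
    \<le> (LINT \<theta>|lborel. cmod (\<Psi> \<theta>)) * (trilinear_const * sqrt (LINT \<xi>|lborel. (cmod (FT h2 \<xi>))\<^sup>2 * sobolev_weight \<xi>) *
      (sqrt (LINT x|lborel. (cmod (h1 x))\<^sup>2) * sqrt (LINT x|lborel. (cmod (f0 x))\<^sup>2)))"
proof -
  have [measurable]: "h1 \<in> borel_measurable borel" "h2 \<in> borel_measurable borel"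
    using h1 h2 by (auto intro: borel_measurable_continuous_onI)
  have [measurable]: "f0 \<in> borel_measurable borel" "chi \<in> borel_measurable borel" using f0 chii by auto
  obtain B1 where B1: "\<And>x. cmod (h1 x) \<le> B1" using compact_support_integrable(3)[OF h1] by auto
  obtain B2 where B2: "\<And>x. cmod (h2 x) \<le> B2" using compact_support_integrable(3)[OF h2] by auto
  define B where "B = max B1 B2"
  have B: "cmod (h1 x) \<le> B" "cmod (h2 x) \<le> B" for x using B1[of x] B2[of x] by (auto simp: B_def)
  have B0: "B \<ge> 0" using order_trans[OF norm_ge_zero B(1)] .
  define \<epsilon> where "\<epsilon> n = 1 / real (Suc n)" for n
  have e: "\<epsilon> \<longlonglongrightarrow> 0" unfolding \<epsilon>_def using LIMSEQ_inverse_real_of_nat by (simp add: inverse_eq_divide)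
  have e0: "\<epsilon> n > 0" for n by (simp add: \<epsilon>_def)
  let ?F = "\<lambda>k1 k2 (w :: real \<times> real). f0 (fst w) * k1 (fst w + snd w) * k2 (fst w + (snd w)\<^sup>2) * complex_of_real (chi (snd w))"
  have mF: "?F k1 k2 \<in> borel_measurable lborel"
    if [measurable]: "k1 \<in> borel_measurable borel" "k2 \<in> borel_measurable borel" for k1 k2
    unfolding lborel_prod[symmetric] by measurable
  have chic: "integrable lborel (\<lambda>t. complex_of_real (chi t))" using chii by (simp only: complex_of_real_integrable_eq)
  have "(\<lambda>n. LINT w|lborel. ?F (mollify (\<epsilon> n) h1) (mollify (\<epsilon> n) h2) w) \<longlonglongrightarrow> (LINT w|lborel. ?F h1 h2 w)"
  proof (rule integral_dominated_convergence[where w="\<lambda>w. cmod (f0 (fst w) * complex_of_real (chi (snd w))) * (B * B)"])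
    show "?F h1 h2 \<in> borel_measurable lborel" by (rule mF) measurable
    show "?F (mollify (\<epsilon> n) h1) (mollify (\<epsilon> n) h2) \<in> borel_measurable lborel" for n by (rule mF) measurable
    show "integrable lborel (\<lambda>w. cmod (f0 (fst w) * complex_of_real (chi (snd w))) * (B * B))"
      by (intro integrable_mult_left integrable_norm integral_pair_mult(1) f0(1) chic)
    show "AE w in lborel. (\<lambda>n. ?F (mollify (\<epsilon> n) h1) (mollify (\<epsilon> n) h2) w) \<longlonglongrightarrow> ?F h1 h2 w"
      by (intro AE_I2 tendsto_intros mollify_tendsto[OF h1(1) B(1) e] mollify_tendsto[OF h2(1) B(2) e])
    fix n
    have "cmod (?F (mollify (\<epsilon> n) h1) (mollify (\<epsilon> n) h2) w) \<le> cmod (f0 (fst w) * complex_of_real (chi (snd w))) * (B * B)" for w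
    proof -
      have "cmod (mollify (\<epsilon> n) h1 (fst w + snd w)) * cmod (mollify (\<epsilon> n) h2 (fst w + (snd w)\<^sup>2)) \<le> B * B"
        by (intro mult_mono norm_mollify_le B B0 norm_ge_zero)
      then have "cmod (f0 (fst w) * complex_of_real (chi (snd w))) * (cmod (mollify (\<epsilon> n) h1 (fst w + snd w)) * cmod (mollify (\<epsilon> n) h2 (fst w + (snd w)\<^sup>2)))
         \<le> cmod (f0 (fst w) * complex_of_real (chi (snd w))) * (B * B)" by (intro mult_left_mono) auto
      then show ?thesis by (simp only: norm_mult mult_ac)
    qed
    then show "AE w in lborel. cmod (?F (mollify (\<epsilon> n) h1) (mollify (\<epsilon> n) h2) w) \<le> cmod (f0 (fst w) * complex_of_real (chi (snd w))) * (B * B)"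
      by simp
  qed
  then have "(\<lambda>n. cmod (LINT w|lborel. ?F (mollify (\<epsilon> n) h1) (mollify (\<epsilon> n) h2) w)) \<longlonglongrightarrow> cmod (LINT w|lborel. ?F h1 h2 w)"
    by (rule tendsto_norm)
  moreover have "cmod (LINT w|lborel. ?F (mollify (\<epsilon> n) h1) (mollify (\<epsilon> n) h2) w) \<le> (LINT \<theta>|lborel. cmod (\<Psi> \<theta>)) * (trilinear_const * sqrt (LINT \<xi>|lborel. (cmod (FT h2 \<xi>))\<^sup>2 * sobolev_weight \<xi>) *
      (sqrt (LINT x|lborel. (cmod (h1 x))\<^sup>2) * sqrt (LINT x|lborel. (cmod (f0 x))\<^sup>2)))" for n
    by (rule trilinear_mollified[OF f0 compact_support_integrable(1,2)[OF h1] B(1) compact_support_integrable(1,2)[OF h2] B(2) \<Psi> chi e0])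
  ultimately show ?thesis by (intro Lim_bounded[where M=0]) auto
qed

section \<open>Passage to square integrable functions\<close>

text \<open>For fixed \<open>t\<close> both shifts in \<open>x\<close> preserve
  \<open>L\<^sup>2\<close> norms, so Cauchy-Schwarz is applied in \<open>x\<close> and
  \<open>t\<close> is integrated last; for fixed \<open>x\<close> the map from \<open>t\<close> to
  \<open>x + t\<^sup>2\<close> has no such invariance. Nothing is gained in \<open>f2\<close>, but
  the form becomes continuous on \<open>L\<^sup>2\<close>, as the approximation argument
  requires.\<close>

lemma trilinear_trivial_bound:
  fixes f0 f1 f2 :: "real \<Rightarrow> complex" and chi :: "real \<Rightarrow> real"
  assumes [measurable]: "f0 \<in> borel_measurable borel" "f1 \<in> borel_measurable borel" "f2 \<in> borel_measurable borel"
    and f0: "\<And>x. cmod (f0 x) \<le> M"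
    and f1: "integrable lborel (\<lambda>x. (cmod (f1 x))\<^sup>2)" and f2: "integrable lborel (\<lambda>x. (cmod (f2 x))\<^sup>2)"
    and chi: "integrable lborel chi"
  defines "F \<equiv> \<lambda>w. f0 (fst w) * f1 (fst w + snd w) * f2 (fst w + (snd w)\<^sup>2) * complex_of_real (chi (snd w))"
  shows "integrable lborel F"
    and "cmod (LINT w|lborel. F w) \<le> M * (LINT t|lborel. \<bar>chi t\<bar>) *
      (sqrt (LINT x|lborel. (cmod (f1 x))\<^sup>2) * sqrt (LINT x|lborel. (cmod (f2 x))\<^sup>2))"
proof -
  have [measurable]: "chi \<in> borel_measurable borel" using chi by auto
  have M0: "M \<ge> 0" using f0 norm_ge_zero order_trans by blast
  define n where "n = sqrt (LINT x|lborel. (cmod (f1 x))\<^sup>2) * sqrt (LINT x|lborel. (cmod (f2 x))\<^sup>2)"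
  have n0: "n \<ge> 0" by (simp add: n_def)
  have Fm [measurable]: "F \<in> borel_measurable (lborel \<Otimes>\<^sub>M lborel)" unfolding F_def by measurable
  have inner: "(\<integral>\<^sup>+x. ennreal (cmod (F (x, t))) \<partial>lborel) \<le> ennreal (M * n * \<bar>chi t\<bar>)" for t
  proof -
    have i1: "integrable lborel (\<lambda>x. (cmod (f1 (x + t)))\<^sup>2)" using f1 by (subst lborel_integrable_shift(1))
    have i2: "integrable lborel (\<lambda>x. (cmod (f2 (x + t\<^sup>2)))\<^sup>2)" using f2 by (subst lborel_integrable_shift(1))
    have e: "(LINT x|lborel. (cmod (f1 (x + t)))\<^sup>2) = (LINT x|lborel. (cmod (f1 x))\<^sup>2)"
      "(LINT x|lborel. (cmod (f2 (x + t\<^sup>2)))\<^sup>2) = (LINT x|lborel. (cmod (f2 x))\<^sup>2)"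
      by (rule lborel_integral_shift(1))+
    have m: "(\<lambda>x. f1 (x + t)) \<in> borel_measurable lborel" "(\<lambda>x. f2 (x + t\<^sup>2)) \<in> borel_measurable lborel" by measurable
    note CS = L2_Cauchy_Schwarz[OF m i1 i2, unfolded e, folded n_def]
    have le: "cmod (F (x, t)) \<le> M * \<bar>chi t\<bar> * (cmod (f1 (x + t)) * cmod (f2 (x + t\<^sup>2)))" for x
    proof -
      have "cmod (F (x, t)) = cmod (f0 x) * (\<bar>chi t\<bar> * (cmod (f1 (x + t)) * cmod (f2 (x + t\<^sup>2))))"
        by (simp add: F_def norm_mult mult_ac)
      also have "\<dots> \<le> M * (\<bar>chi t\<bar> * (cmod (f1 (x + t)) * cmod (f2 (x + t\<^sup>2))))"
        by (intro mult_right_mono f0) auto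
      finally show ?thesis by (simp only: mult.assoc)
    qed
    have "(\<integral>\<^sup>+x. ennreal (cmod (F (x, t))) \<partial>lborel) \<le> (\<integral>\<^sup>+x. ennreal (M * \<bar>chi t\<bar> * (cmod (f1 (x + t)) * cmod (f2 (x + t\<^sup>2)))) \<partial>lborel)"
      by (intro nn_integral_mono ennreal_leI le)
    also have "\<dots> = ennreal (LINT x|lborel. M * \<bar>chi t\<bar> * (cmod (f1 (x + t)) * cmod (f2 (x + t\<^sup>2))))"
      using CS(1) M0 by (intro nn_integral_eq_integral integrable_mult_right AE_I2) auto
    also have "\<dots> \<le> ennreal (M * \<bar>chi t\<bar> * n)"
      unfolding integral_mult_right_zero using CS(2) M0 by (intro ennreal_leI mult_left_mono) auto
    finally show ?thesis by (simp add: mult_ac)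
  qed
  have "(\<integral>\<^sup>+w. ennreal (cmod (F w)) \<partial>lborel) = (\<integral>\<^sup>+w. ennreal (cmod (F w)) \<partial>(lborel \<Otimes>\<^sub>M lborel))" by (simp add: lborel_prod)
  also have "\<dots> = (\<integral>\<^sup>+t. \<integral>\<^sup>+x. ennreal (cmod (F (x, t))) \<partial>lborel \<partial>lborel)"
    by (subst lborel_pair.nn_integral_snd[symmetric]) auto
  also have "\<dots> \<le> (\<integral>\<^sup>+t. ennreal (M * n * \<bar>chi t\<bar>) \<partial>lborel)" by (intro nn_integral_mono inner)
  also have "\<dots> = ennreal (LINT t|lborel. M * n * \<bar>chi t\<bar>)"
    using chi M0 n0 by (intro nn_integral_eq_integral integrable_mult_right AE_I2) auto
  also have "(LINT t|lborel. M * n * \<bar>chi t\<bar>) = M * (LINT t|lborel. \<bar>chi t\<bar>) * n" by simp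
  finally have le: "(\<integral>\<^sup>+w. ennreal (cmod (F w)) \<partial>lborel) \<le> ennreal (M * (LINT t|lborel. \<bar>chi t\<bar>) * n)" .
  show i: "integrable lborel F"
  proof (rule integrableI_bounded)
    show "F \<in> borel_measurable lborel" using Fm by (simp add: lborel_prod)
    show "(\<integral>\<^sup>+w. ennreal (norm (F w)) \<partial>lborel) < \<infinity>" using le by (auto intro: le_less_trans)
  qed
  have "ennreal (cmod (LINT w|lborel. F w)) \<le> ennreal (M * (LINT t|lborel. \<bar>chi t\<bar>) * n)"
    by (rule order_trans[OF integral_norm_bound_ennreal[OF i] le])
  then show "cmod (LINT w|lborel. F w) \<le> M * (LINT t|lborel. \<bar>chi t\<bar>) *
      (sqrt (LINT x|lborel. (cmod (f1 x))\<^sup>2) * sqrt (LINT x|lborel. (cmod (f2 x))\<^sup>2))"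
    using M0 n0 unfolding n_def[symmetric] by (subst (asm) ennreal_le_iff) auto
qed

lemma AE_shift:
  fixes P :: "real \<Rightarrow> bool"
  assumes "AE z in lborel. P z"
  shows "AE t in lborel. P (x + t)"
proof -
  obtain N where N: "N \<in> null_sets lborel" "{z. \<not> P z} \<subseteq> N" using assms unfolding eventually_ae_filter by auto
  have "N \<in> sets borel" using N(1) by auto
  then have [measurable]: "Measurable.pred borel (\<lambda>z. z \<notin> N)" by measurable
  have "AE t in lborel. x + 1 * t \<notin> N" by (rule AE_borel_affine) (use AE_not_in[OF N(1)] in auto)
  then show ?thesis by eventually_elim (use N(2) in auto)
qed

text \<open>Tonelli: for fixed \<open>t\<close> the exceptional \<open>x\<close> lie in a translate
  of a null set. Almost every \<open>x\<close> suffices, since the inner integral of the form is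
  integrated in \<open>x\<close> afterwards.\<close>

lemma AE_AE_shift_square:
  fixes P :: "real \<Rightarrow> bool"
  assumes "AE z in lborel. P z"
  shows "AE x in lborel. AE t in lborel. P (x + t\<^sup>2)"
proof -
  obtain N where N: "N \<in> null_sets lborel" "{z. \<not> P z} \<subseteq> N" using assms unfolding eventually_ae_filter by auto
  have [measurable]: "N \<in> sets borel" using N(1) by auto
  have "(\<integral>\<^sup>+x. \<integral>\<^sup>+t. indicator N (x + t\<^sup>2) \<partial>lborel \<partial>lborel) = (\<integral>\<^sup>+t. \<integral>\<^sup>+x. indicator N (x + t\<^sup>2) \<partial>lborel \<partial>lborel)"
    by (rule lborel_pair.Fubini') measurable
  also have "\<dots> = (\<integral>\<^sup>+t. \<integral>\<^sup>+x. indicator N x \<partial>lborel \<partial>(lborel :: real measure))"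
    by (intro nn_integral_cong nn_integral_lborel_shift(3)) measurable
  also have "\<dots> = 0" using N(1) by (simp add: null_setsD1)
  finally have "(\<integral>\<^sup>+x. \<integral>\<^sup>+t. indicator N (x + t\<^sup>2) \<partial>lborel \<partial>lborel) = (0 :: ennreal)" .
  then have "AE x in lborel. (\<integral>\<^sup>+t. indicator N (x + t\<^sup>2) \<partial>lborel) = (0 :: ennreal)"
    by (subst (asm) nn_integral_0_iff_AE) auto
  then show ?thesis
  proof eventually_elim
    case (elim x)
    then have "AE t in lborel. indicator N (x + t\<^sup>2) = (0 :: ennreal)"
      by (subst (asm) nn_integral_0_iff_AE) auto
    then show ?case by eventually_elim (use N(2) in \<open>auto simp: indicator_def split: if_splits\<close>)
  qed
qed

text \<open>The iterated Lebesgue integral of the definition ignores null sets at both levels, and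
  integrability on the plane merges it into the double integral that the estimates use.\<close>

lemma trilinear_form_borel:
  assumes [measurable]: "k0 \<in> borel_measurable borel" "k1 \<in> borel_measurable borel" "k2 \<in> borel_measurable borel"
    "chi \<in> borel_measurable borel"
    and ae: "AE x in lborel. f0 x = k0 x" "AE x in lborel. f1 x = k1 x" "AE x in lborel. f2 x = k2 x"
    and i: "integrable lborel (\<lambda>w. k0 (fst w) * k1 (fst w + snd w) * k2 (fst w + (snd w)\<^sup>2) * complex_of_real (chi (snd w)))"
  shows "trilinear_form chi f0 f1 f2 =
    cmod (LINT w|lborel. k0 (fst w) * k1 (fst w + snd w) * k2 (fst w + (snd w)\<^sup>2) * complex_of_real (chi (snd w)))"
proof -
  let ?F = "\<lambda>w. k0 (fst w) * k1 (fst w + snd w) * k2 (fst w + (snd w)\<^sup>2) * complex_of_real (chi (snd w))"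
  let ?G = "\<lambda>x t. f0 x * f1 (x + t) * f2 (x + t\<^sup>2) * of_real (chi t)"
  have "AE x in lborel. (LINT t|lebesgue. ?G x t) = (LINT t|lborel. ?F (x, t))"
    using ae(1) AE_AE_shift_square[OF ae(3)]
  proof eventually_elim
    case (elim x)
    have "AE t in lborel. ?G x t = ?F (x, t)"
      using AE_shift[OF ae(2), of x] elim(2) by eventually_elim (simp add: elim(1))
    then show ?case by (intro lebesgue_integral_AE_eq(2)) simp_all
  qed
  then have "(LINT x|lebesgue. LINT t|lebesgue. ?G x t) = (LINT x|lborel. LINT t|lborel. ?F (x, t))"
    by (intro lebesgue_integral_AE_eq(2)) simp_all
  also have "\<dots> = (LINT w|lborel. ?F w)"
    using lborel_pair.integral_fst'[of ?F] i by (simp add: lborel_prod)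
  finally show ?thesis unfolding trilinear_form_def by simp
qed

text \<open>Bounds that hold almost everywhere are made pointwise by setting the representative to 0
  where they fail.\<close>

lemma Linf_representative:
  assumes f: "in_Linf f" and K: "ae_supported_in f {a..b}"
  obtains k where "k \<in> borel_measurable borel" "AE x in lborel. f x = k x"
    "\<And>x. cmod (k x) \<le> Linf_norm f" "\<And>x. x \<notin> {a..b} \<Longrightarrow> k x = 0" "0 \<le> Linf_norm f"
proof -
  have fm: "f \<in> borel_measurable lebesgue" using f by (simp add: in_Linf_def)
  define e where "e = esssup lebesgue (\<lambda>x. ereal (cmod (f x)))"
  have e: "e < \<infinity>" using f by (simp add: in_Linf_def e_def)
  have ae: "AE x in lebesgue. ereal (cmod (f x)) \<le> e" unfolding e_def by (rule esssup_AE)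
  \<comment> \<open>Lebesgue measure is not zero, which excludes a negative essential supremum; in
    particular the value -\<infinity>, which \<open>real_of_ereal\<close> would send to 0, does not
    occur.\<close>
  have nF: "\<not> (AE x in (lebesgue :: real measure). False)"
    by (subst AE_iff_null) (auto simp: null_sets_def)
  have e0: "0 \<le> e"
  proof (rule ccontr)
    assume "\<not> 0 \<le> e"
    have "AE x in (lebesgue :: real measure). False"
      using ae
    proof eventually_elim
      case (elim x)
      have "(0 :: ereal) \<le> ereal (cmod (f x))" by simp
      with elim have "0 \<le> e" by (rule order_trans[rotated])
      with \<open>\<not> 0 \<le> e\<close> show False ..
    qed
    with nF show False ..
  qed
  define M where "M = Linf_norm f"
  have eM: "e = ereal M" using e e0 unfolding M_def Linf_norm_def e_def[symmetric] by (cases e) auto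
  have M0: "M \<ge> 0" using e0 by (simp add: eM)
  obtain g where g [measurable]: "g \<in> borel_measurable borel" and fg: "AE x in lborel. f x = g x"
    by (rule lebesgue_borel_representative[OF fm])
  define k where "k x = (if x \<in> {a..b} \<and> cmod (g x) \<le> M then g x else 0)" for x
  have "AE x in lebesgue. cmod (f x) \<le> M \<and> (x \<notin> {a..b} \<longrightarrow> f x = 0)"
    using ae K unfolding ae_supported_in_def eM by eventually_elim simp
  then have "AE x in lebesgue. f x = k x"
    using AE_completion[OF fg] by eventually_elim (auto simp: k_def)
  then have "AE x in lborel. f x = k x" by (simp add: AE_completion_iff)
  moreover have "k \<in> borel_measurable borel" unfolding k_def[abs_def] by measurable
  ultimately show ?thesis
    by (intro that[of k]) (use M0 in \<open>auto simp: k_def M_def\<close>)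
qed

text \<open>The weight is at most 1, so multiplication by its root is a contraction and convergence
  passes to the weighted norm.\<close>

lemma weighted_L2_tendsto:
  assumes "L2_tendsto h g"
  defines "V \<equiv> \<lambda>k. L2_norm (\<lambda>\<xi>. of_real (sqrt (sobolev_weight \<xi>)) * k \<xi>)"
  shows "(\<lambda>n. V (h n)) \<longlonglongrightarrow> V g"
proof -
  let ?c = "\<lambda>\<xi>. complex_of_real (sqrt (sobolev_weight \<xi>))"
  have c: "?c \<in> borel_measurable lebesgue" by (rule measurable_completion) simp
  have c1: "cmod (?c \<xi>) \<le> 1" for \<xi> using sobolev_weight_bounds[of \<xi>] by (simp add: less_imp_le)
  have L: "in_L2 (h n)" "in_L2 g" for n using assms by (auto simp: L2_tendsto_def)
  have lim: "(\<lambda>n. L2_norm (\<lambda>x. h n x - g x)) \<longlonglongrightarrow> 0" using assms by (simp add: L2_tendsto_def)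
  have "L2_tendsto (\<lambda>n \<xi>. ?c \<xi> * h n \<xi>) (\<lambda>\<xi>. ?c \<xi> * g \<xi>)"
    unfolding L2_tendsto_def
  proof (intro conjI allI in_L2_mult(1)[OF _ c c1] L)
    have "norm (L2_norm (\<lambda>x. ?c x * h n x - ?c x * g x)) \<le> L2_norm (\<lambda>x. h n x - g x)" for n
      using in_L2_mult(2)[OF in_L2_diff(1)[OF L] c c1, of n] L2_norm_nonneg by (simp add: right_diff_distrib)
    then show "(\<lambda>n. L2_norm (\<lambda>x. ?c x * h n x - ?c x * g x)) \<longlonglongrightarrow> 0"
      by (intro Lim_null_comparison[OF always_eventually lim] allI)
  qed
  then show ?thesis unfolding V_def by (rule L2_tendsto_norm)
qed

lemma weighted_norm_sq: "(cmod (of_real (sqrt (sobolev_weight \<xi>)) * z))\<^sup>2 = (cmod z)\<^sup>2 * sobolev_weight \<xi>"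
  using sobolev_weight_bounds(1)[of \<xi>] by (simp add: norm_mult power_mult_distrib less_imp_le)

text \<open>Both sides pass to the limit along approximations \<open>h1\<close>, \<open>h2\<close>:
  the left by \<open>trilinear_trivial_bound\<close>, the right because
  \<open>fourier (h2 n)\<close> tends to \<open>L2_fourier f2\<close>, which is the specification of
  the extended transform.\<close>

lemma trilinear_smoothing:
  fixes chi :: "real \<Rightarrow> real"
  assumes f0m [measurable]: "k0 \<in> borel_measurable borel"
    and f0: "\<And>x. cmod (k0 x) \<le> M" "\<And>x. x \<notin> {a..b} \<Longrightarrow> k0 x = 0" and ab: "a \<le> b" and M: "M \<ge> 0"
    and f0ae: "AE x in lborel. f0 x = k0 x"
    and f1: "in_L2 f1" and f2: "in_L2 f2"
    and \<Psi>: "integrable lborel \<Psi>"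
    and chi: "\<And>t. complex_of_real (chi t) = of_real (exp (- (pi * t\<^sup>2))) * (LINT \<theta>|lborel. \<Psi> \<theta> * cis (2 * pi * t * \<theta>))"
    and chii: "integrable lborel chi"
  shows "trilinear_form chi f0 f1 f2 \<le>
    ((LINT \<theta>|lborel. cmod (\<Psi> \<theta>)) * trilinear_const * sqrt (b - a)) * M * L2_norm f1 * sobolev_norm (- (1 / 32)) f2"
proof -
  have [measurable]: "chi \<in> borel_measurable borel" using chii by auto
  obtain k1 where k1 [measurable]: "k1 \<in> borel_measurable borel" and ae1: "AE x in lborel. f1 x = k1 x"
    using f1 lebesgue_borel_representative unfolding in_L2_def by blast
  obtain k2 where k2 [measurable]: "k2 \<in> borel_measurable borel" and ae2: "AE x in lborel. f2 x = k2 x"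
    using f2 lebesgue_borel_representative unfolding in_L2_def by blast
  have k1i: "integrable lborel (\<lambda>x. (cmod (k1 x))\<^sup>2)" using f1 L2_borel(1)[OF k1 ae1] by simp
  have k2i: "integrable lborel (\<lambda>x. (cmod (k2 x))\<^sup>2)" using f2 L2_borel(1)[OF k2 ae2] by simp
  have ind: "integrable lborel (\<lambda>x. c * indicator {a..b} x :: real)" for c
    by (intro integrable_mult_right integrable_real_indicator) (auto simp: emeasure_lborel_Icc_eq)
  have le0: "cmod (k0 x) \<le> M * indicator {a..b} x" for x using f0 by (auto simp: indicator_def)
  have le0': "(cmod (k0 x))\<^sup>2 \<le> M\<^sup>2 * indicator {a..b} x" for x
    using f0(1)[of x] f0(2)[of x] by (auto simp: indicator_def intro!: power_mono)
  have k0i: "integrable lborel k0"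
    by (rule Bochner_Integration.integrable_bound[OF ind[of M]])
      (measurable, rule AE_I2, rule order_trans[OF le0], simp only: real_norm_def abs_ge_self)
  have k0i2: "integrable lborel (\<lambda>x. (cmod (k0 x))\<^sup>2)"
    by (rule Bochner_Integration.integrable_bound[OF ind[of "M\<^sup>2"]])
      (measurable, use le0' in \<open>auto intro: order_trans[OF _ abs_ge_self]\<close>)
  \<comment> \<open>Here the length of the interval enters: it converts the sup norm into the
    \<open>L\<^sup>2\<close> norm that the estimate uses.\<close>
  have k0n: "sqrt (LINT x|lborel. (cmod (k0 x))\<^sup>2) \<le> M * sqrt (b - a)"
  proof -
    have "(LINT x|lborel. (cmod (k0 x))\<^sup>2) \<le> (LINT x|lborel. M\<^sup>2 * indicator {a..b} x)"
      by (intro integral_mono k0i2 ind le0')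
    also have "\<dots> = M\<^sup>2 * (b - a)" using ab by simp
    finally have "sqrt (LINT x|lborel. (cmod (k0 x))\<^sup>2) \<le> sqrt (M\<^sup>2 * (b - a))" by simp
    then show ?thesis using M by (simp add: real_sqrt_mult)
  qed
  obtain h1 R1 where h1: "\<And>n::nat. continuous_on UNIV (h1 n)" "\<And>n x. R1 n < \<bar>x\<bar> \<Longrightarrow> h1 n x = 0" "L2_tendsto h1 f1"
    by (rule L2_approx_continuous[OF f1]) (rule that)
  obtain h2 R2 where h2: "\<And>n::nat. continuous_on UNIV (h2 n)" "\<And>n x. R2 n < \<bar>x\<bar> \<Longrightarrow> h2 n x = 0" "L2_tendsto h2 f2"
    by (rule L2_approx_continuous[OF f2]) (rule that)
  have hm [measurable]: "h1 n \<in> borel_measurable borel" "h2 n \<in> borel_measurable borel" for n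
    by (intro borel_measurable_continuous_onI h1 h2)+
  have hi: "integrable lborel (\<lambda>x. (cmod (h1 n x))\<^sup>2)" "integrable lborel (\<lambda>x. (cmod (h2 n x))\<^sup>2)" "integrable lborel (h2 n)" for n
  proof -
    show "integrable lborel (\<lambda>x. (cmod (h1 n x))\<^sup>2)" by (rule compact_support_integrable(2)[OF h1(1,2)])
    show "integrable lborel (\<lambda>x. (cmod (h2 n x))\<^sup>2)" by (rule compact_support_integrable(2)[OF h2(1,2)])
    show "integrable lborel (h2 n)" by (rule compact_support_integrable(1)[OF h2(1,2)])
  qed
  define A where "A u v = (LINT w|lborel. k0 (fst w) * u (fst w + snd w) * v (fst w + (snd w)\<^sup>2) * complex_of_real (chi (snd w)))" for u v
  note TB = trilinear_trivial_bound[OF f0m _ _ f0(1) _ _ chii, folded A_def]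
  define c where "c = M * (LINT t|lborel. \<bar>chi t\<bar>)"
  have c0: "c \<ge> 0" using M by (simp add: c_def)
  have d1: "integrable lborel (\<lambda>x. (cmod (k1 x - h1 n x))\<^sup>2)"
    "sqrt (LINT x|lborel. (cmod (k1 x - h1 n x))\<^sup>2) = L2_norm (\<lambda>x. h1 n x - f1 x)" for n
  proof -
    have m: "(\<lambda>x. k1 x - h1 n x) \<in> borel_measurable borel" by measurable
    have ae: "AE x in lborel. f1 x - h1 n x = k1 x - h1 n x" using ae1 by eventually_elim simp
    have "in_L2 (\<lambda>x. f1 x - h1 n x)" using h1(3) by (intro in_L2_diff f1) (simp add: L2_tendsto_def)
    then show "integrable lborel (\<lambda>x. (cmod (k1 x - h1 n x))\<^sup>2)" using L2_borel(1)[OF m ae] by simp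
    show "sqrt (LINT x|lborel. (cmod (k1 x - h1 n x))\<^sup>2) = L2_norm (\<lambda>x. h1 n x - f1 x)"
      using L2_borel(2)[OF m ae] by (simp add: L2_norm_minus_commute)
  qed
  have d2: "integrable lborel (\<lambda>x. (cmod (k2 x - h2 n x))\<^sup>2)"
    "sqrt (LINT x|lborel. (cmod (k2 x - h2 n x))\<^sup>2) = L2_norm (\<lambda>x. h2 n x - f2 x)" for n
  proof -
    have m: "(\<lambda>x. k2 x - h2 n x) \<in> borel_measurable borel" by measurable
    have ae: "AE x in lborel. f2 x - h2 n x = k2 x - h2 n x" using ae2 by eventually_elim simp
    have "in_L2 (\<lambda>x. f2 x - h2 n x)" using h2(3) by (intro in_L2_diff f2) (simp add: L2_tendsto_def)
    then show "integrable lborel (\<lambda>x. (cmod (k2 x - h2 n x))\<^sup>2)" using L2_borel(1)[OF m ae] by simp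
    show "sqrt (LINT x|lborel. (cmod (k2 x - h2 n x))\<^sup>2) = L2_norm (\<lambda>x. h2 n x - f2 x)"
      using L2_borel(2)[OF m ae] by (simp add: L2_norm_minus_commute)
  qed
  have hn: "sqrt (LINT x|lborel. (cmod (h1 n x))\<^sup>2) = L2_norm (h1 n)" for n
    by (rule L2_borel(2)[OF hm(1) AE_I2[OF refl], symmetric])
  have k2n: "sqrt (LINT x|lborel. (cmod (k2 x))\<^sup>2) = L2_norm f2"
    by (rule L2_borel(2)[OF k2 ae2, symmetric])
  have Adiff: "cmod (A k1 k2 - A (h1 n) (h2 n)) \<le>
     c * (L2_norm (\<lambda>x. h1 n x - f1 x) * L2_norm f2) + c * (L2_norm (h1 n) * L2_norm (\<lambda>x. h2 n x - f2 x))" for n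
  proof -
    have m: "(\<lambda>x. k1 x - h1 n x) \<in> borel_measurable borel" "(\<lambda>x. k2 x - h2 n x) \<in> borel_measurable borel" by measurable
    note i1 = TB(1)[OF m(1) k2 d1(1) k2i] and i2 = TB(1)[OF hm(1) m(2) hi(1) d2(1)]
    note I1 = TB(1)[OF k1 k2 k1i k2i] and I2 = TB(1)[OF hm hi(1,2)]
    \<comment> \<open>Replacing one function at a time leaves in each term one difference, which is
      small in norm.\<close>
    have "A k1 k2 - A (h1 n) (h2 n) = A (\<lambda>x. k1 x - h1 n x) k2 + A (h1 n) (\<lambda>x. k2 x - h2 n x)"
      unfolding A_def Bochner_Integration.integral_diff[OF I1 I2, symmetric] Bochner_Integration.integral_add[OF i1 i2, symmetric]
      by (simp add: algebra_simps)
    also have "cmod \<dots> \<le> cmod (A (\<lambda>x. k1 x - h1 n x) k2) + cmod (A (h1 n) (\<lambda>x. k2 x - h2 n x))" by (rule norm_triangle_ineq)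
    also have "\<dots> \<le> c * (L2_norm (\<lambda>x. h1 n x - f1 x) * L2_norm f2) + c * (L2_norm (h1 n) * L2_norm (\<lambda>x. h2 n x - f2 x))"
      using TB(2)[OF m(1) k2 d1(1) k2i] TB(2)[OF hm(1) m(2) hi(1) d2(1)]
      unfolding d1(2) d2(2) hn k2n c_def[symmetric] by (rule add_mono)
    finally show ?thesis .
  qed
  have lim1: "(\<lambda>n. L2_norm (\<lambda>x. h1 n x - f1 x)) \<longlonglongrightarrow> 0" and lim2: "(\<lambda>n. L2_norm (\<lambda>x. h2 n x - f2 x)) \<longlonglongrightarrow> 0"
    using h1(3) h2(3) by (simp_all add: L2_tendsto_def)
  note limh1 = L2_tendsto_norm[OF h1(3)]
  have "(\<lambda>n. c * (L2_norm (\<lambda>x. h1 n x - f1 x) * L2_norm f2) + c * (L2_norm (h1 n) * L2_norm (\<lambda>x. h2 n x - f2 x))) \<longlonglongrightarrow>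
     c * (0 * L2_norm f2) + c * (L2_norm f1 * 0)"
    by (intro tendsto_intros lim1 lim2 limh1)
  then have lim0: "(\<lambda>n. c * (L2_norm (\<lambda>x. h1 n x - f1 x) * L2_norm f2) + c * (L2_norm (h1 n) * L2_norm (\<lambda>x. h2 n x - f2 x))) \<longlonglongrightarrow> 0"
    by simp
  define V where "V k = L2_norm (\<lambda>\<xi>. of_real (sqrt (sobolev_weight \<xi>)) * k \<xi>)" for k
  define P where "P = (LINT \<theta>|lborel. cmod (\<Psi> \<theta>)) * trilinear_const"
  have P0: "P \<ge> 0" using trilinear_const_pos by (simp add: P_def)
  define n0 where "n0 = sqrt (LINT x|lborel. (cmod (k0 x))\<^sup>2)"
  have VW: "sqrt (LINT \<xi>|lborel. (cmod (FT (h2 n) \<xi>))\<^sup>2 * sobolev_weight \<xi>) = V (fourier (h2 n))" for n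
  proof -
    have e: "fourier (h2 n) = FT (h2 n)" by (rule fourier_borel[OF hm(2) AE_I2[OF refl]])
    have m: "(\<lambda>\<xi>. of_real (sqrt (sobolev_weight \<xi>)) * FT (h2 n) \<xi>) \<in> borel_measurable borel" by measurable
    show ?thesis unfolding V_def e L2_borel(2)[OF m AE_I2[OF refl]] weighted_norm_sq ..
  qed
  have Ah: "cmod (A (h1 n) (h2 n)) \<le> P * (V (fourier (h2 n)) * (L2_norm (h1 n) * n0))" for n
  proof -
    have "cmod (A (h1 n) (h2 n)) \<le> (LINT \<theta>|lborel. cmod (\<Psi> \<theta>)) * (trilinear_const * V (fourier (h2 n)) * (L2_norm (h1 n) * n0))"
      unfolding A_def VW[symmetric] hn[symmetric] n0_def
      by (rule trilinear_continuous[OF k0i k0i2 h1(1) _ h2(1) _ \<Psi> chi chii, where R="max (R1 n) (R2 n)"])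
        (use h1(2) h2(2) in auto)
    then show ?thesis by (simp only: P_def mult.assoc)
  qed
  have "is_L2_fourier f2 (L2_fourier f2)" by (rule is_L2_fourier_exists[OF f2])
  moreover have "in_L1 (h2 n)" for n
    using hi(3)[of n] lebesgue_integral_AE_eq(3)[OF hm(2)[of n] AE_I2[OF refl]] by (simp add: in_L1_def)
  ultimately have "L2_tendsto (\<lambda>n. fourier (h2 n)) (L2_fourier f2)"
    using h2(3) unfolding is_L2_fourier_def by blast
  then have limV: "(\<lambda>n. V (fourier (h2 n))) \<longlonglongrightarrow> V (L2_fourier f2)"
    unfolding V_def by (rule weighted_L2_tendsto)
  have Vs: "V (L2_fourier f2) = sobolev_norm (- (1 / 32)) f2"
    by (simp only: V_def L2_norm_def weighted_norm_sq sobolev_norm_def) (simp add: sobolev_weight_def)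
  have "(\<lambda>n. P * (V (fourier (h2 n)) * (L2_norm (h1 n) * n0)) +
      (c * (L2_norm (\<lambda>x. h1 n x - f1 x) * L2_norm f2) + c * (L2_norm (h1 n) * L2_norm (\<lambda>x. h2 n x - f2 x))))
     \<longlonglongrightarrow> P * (V (L2_fourier f2) * (L2_norm f1 * n0)) + 0"
    by (intro tendsto_intros limV limh1 lim0)
  moreover have "cmod (A k1 k2) \<le> P * (V (fourier (h2 n)) * (L2_norm (h1 n) * n0)) +
      (c * (L2_norm (\<lambda>x. h1 n x - f1 x) * L2_norm f2) + c * (L2_norm (h1 n) * L2_norm (\<lambda>x. h2 n x - f2 x)))" for n
    using norm_triangle_ineq[of "A (h1 n) (h2 n)" "A k1 k2 - A (h1 n) (h2 n)"] Ah[of n] Adiff[of n] by simp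
  ultimately have "cmod (A k1 k2) \<le> P * (V (L2_fourier f2) * (L2_norm f1 * n0)) + 0"
    by (intro LIMSEQ_le_const) auto
  also have "\<dots> \<le> P * (V (L2_fourier f2) * (L2_norm f1 * (M * sqrt (b - a))))"
  proof -
    have "V (L2_fourier f2) \<ge> 0" by (simp add: V_def L2_norm_nonneg)
    then show ?thesis using P0 k0n unfolding n0_def[symmetric] add_0_right
      by (intro mult_left_mono) (auto simp: L2_norm_nonneg)
  qed
  also have "\<dots> = ((LINT \<theta>|lborel. cmod (\<Psi> \<theta>)) * trilinear_const * sqrt (b - a)) * M * L2_norm f1 * sobolev_norm (- (1 / 32)) f2"
    unfolding P_def Vs by (simp only: mult_ac)
  finally show ?thesis
    using trilinear_form_borel[OF f0m k1 k2 _ f0ae ae1 ae2 TB(1)[OF k1 k2 k1i k2i], folded A_def] by simp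
qed

theorem theorem1:
  shows "\<exists>\<sigma>::real. \<sigma> > 0 \<and>
    (\<forall>(chi :: real \<Rightarrow> real) (K :: real set) (a :: real) (b :: real).
       smooth chi \<and> compactly_supported chi \<and> (\<forall>t. 0 \<le> chi t \<and> chi t \<le> 1) \<and> a \<le> b \<and> K = {a..b} \<longrightarrow>
       (\<exists>C::real. \<forall>(f\<^sub>0 :: real \<Rightarrow> complex) (f\<^sub>1 :: real \<Rightarrow> complex) (f\<^sub>2 :: real \<Rightarrow> complex).
          in_Linf f\<^sub>0 \<and> ae_supported_in f\<^sub>0 K \<and> in_L2 f\<^sub>1 \<and> in_L2 f\<^sub>2 \<longrightarrow>
          trilinear_form chi f\<^sub>0 f\<^sub>1 f\<^sub>2 \<le> C * Linf_norm f\<^sub>0 * L2_norm f\<^sub>1 * sobolev_norm (- \<sigma>) f\<^sub>2))"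
proof (rule exI[of _ "1/32"], intro conjI allI impI)
  fix chi :: "real \<Rightarrow> real" and K :: "real set" and a b :: real
  assume H: "smooth chi \<and> compactly_supported chi \<and> (\<forall>t. 0 \<le> chi t \<and> chi t \<le> 1) \<and> a \<le> b \<and> K = {a..b}"
  then have chi: "smooth chi" "compactly_supported chi" and ab: "a \<le> b" and K: "K = {a..b}" by auto
  obtain \<Psi> where \<Psi>: "integrable lborel \<Psi>"
    "\<And>t. complex_of_real (chi t) = of_real (exp (- (pi * t\<^sup>2))) * (LINT \<theta>|lborel. \<Psi> \<theta> * cis (2 * pi * t * \<theta>))"
    by (rule cutoff_gauss_representation[OF chi]) (rule that)
  have chii: "integrable lborel chi"
  proof -
    have "chi differentiable_on UNIV" using chi(1) unfolding smooth_def by (metis funpow_0)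
    then have c: "continuous_on UNIV (\<lambda>t. complex_of_real (chi t))"
      by (intro continuous_on_of_real differentiable_imp_continuous_on)
    have "bounded {t. chi t \<noteq> 0}"
      using chi(2) closure_subset unfolding compactly_supported_def by (metis bounded_subset compact_imp_bounded)
    then obtain R where R: "\<And>t. chi t \<noteq> 0 \<Longrightarrow> \<bar>t\<bar> \<le> R" unfolding bounded_iff by auto
    have "integrable lborel (\<lambda>t. complex_of_real (chi t))"
      by (rule compact_support_integrable(1)[OF c, of R]) (use R in force)
    then show ?thesis by (simp only: complex_of_real_integrable_eq)
  qed
  show "\<exists>C. \<forall>f0 f1 f2. in_Linf f0 \<and> ae_supported_in f0 K \<and> in_L2 f1 \<and> in_L2 f2 \<longrightarrow>
      trilinear_form chi f0 f1 f2 \<le> C * Linf_norm f0 * L2_norm f1 * sobolev_norm (- (1 / 32)) f2"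
  proof (rule exI, intro allI impI)
    fix f0 f1 f2 :: "real \<Rightarrow> complex"
    assume A: "in_Linf f0 \<and> ae_supported_in f0 K \<and> in_L2 f1 \<and> in_L2 f2"
    then have f0: "in_Linf f0" "ae_supported_in f0 {a..b}" and f1: "in_L2 f1" and f2: "in_L2 f2" by (auto simp: K)
    obtain k where k: "k \<in> borel_measurable borel" "AE x in lborel. f0 x = k x"
      "\<And>x. cmod (k x) \<le> Linf_norm f0" "\<And>x. x \<notin> {a..b} \<Longrightarrow> k x = 0" "0 \<le> Linf_norm f0"
      by (rule Linf_representative[OF f0]) (rule that)
    \<comment> \<open>In the constant, \<open>\<Psi>\<close> depends on \<open>chi\<close> alone,
      the root on \<open>K\<close> alone, and the remaining factor is absolute.\<close>
    show "trilinear_form chi f0 f1 f2 \<le>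
      ((LINT \<theta>|lborel. cmod (\<Psi> \<theta>)) * trilinear_const * sqrt (b - a)) * Linf_norm f0 * L2_norm f1 * sobolev_norm (- (1 / 32)) f2"
      by (rule trilinear_smoothing[OF k(1,3,4) ab k(5,2) f1 f2 \<Psi> chii])
  qed
qed simp

end
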